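(* Let $n\geq 2$ and let $\Gamma\subset \mathrm{SU}\big((n,1),\mathbb{C}\big)$ be a discrete, torsion-free, cocompact subgroup, with $X_\Gamma=\Gamma\backslash\mathbb{B}^n$. For $k\geq 1$ let $\mathcal{B}_\Gamma^k$ denote the Bergman kernel of the space $\mathcal{S}_k(\Gamma)$ of weight-$k$ Picard modular cusp forms. Then for every $z\in X_{\Gamma}$, \[ \lim_{k\rightarrow \infty}\frac{1}{k^n}\big|\mathcal{B}_\Gamma^k(z)\big|_{\mathrm{pet}}= \frac{1}{(4\pi)^{n}}, \] and the convergence is uniform in $z\in X_{\Gamma}$.
   Context: $\mathbb{B}^n=\{z=(z_1,\dots,z_n)^t\in\mathbb{C}^n : |z|^2=|z_1|^2+\dots+|z_n|^2<1\}$ with the hyperbolic metric $\mu_{\mathrm{hyp}}(z)=-2i\partial\overline{\partial}\log(1-|z|^2)$ and associated volume form $\mu^{\mathrm{vol}}_{\mathrm{hyp}}$. $\mathrm{SU}((n,1),\mathbb{C})=\{A : \det A=1,\ A^*HA=H\}$ with $H=\mathrm{diag}(\mathrm{Id}_n,-1)$; $\gamma=\begin{pmatrix}A&B\\ C&D\end{pmatrix}$ ($A$ of size $n\times n$, $D$ scalar) acts by $\gamma z=(Az+B)/(Cz+D)$. A weight-$k$ Picard modular cusp form for $\Gamma$ is a holomorphic $f:\mathbb{B}^n\to\mathbb{C}$ with $f(\gamma z)=(Cz+D)^kf(z)$ for all $\gamma\in\Gamma$; $\mathcal{S}_k(\Gamma)$ is the space of these, with Petersson inner product $\langle f,g\rangle_{\mathrm{pet}}=\int_{\mathcal{F}}(1-|z|^2)^k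 f(z)\overline{g(z)}\,\mu^{\mathrm{vol}}_{\mathrm{hyp}}(z)$ over a fundamental domain $\mathcal{F}$. If $\{f_1,\dots,f_{d_k}\}$ is an orthonormal basis, $\mathcal{B}_\Gamma^k(z,w)=\sum_j f_j(z)\overline{f_j(w)}$, $\mathcal{B}_\Gamma^k(z)=\mathcal{B}_\Gamma^k(z,z)$, and $|\mathcal{B}_\Gamma^k(z)|_{\mathrm{pet}}=(1-|z|^2)^k|\mathcal{B}_\Gamma^k(z,z)|$. *)

theory Defs
  imports "HOL-Analysis.Analysis" "HOL-Algebra.Group"
begin

subsection \<open>The unitary group of signature (n,1) and its action on the ball\<close>

text \<open>Matrices of size n+1 are indexed by \<^typ>\<open>'n option\<close>: the indices \<^term>\<open>Some i\<close> are the
  first n coordinates and \<^term>\<open>None\<close> is the last one.\<close>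

type_synonym 'n mat1 = "((complex, 'n option) vec, 'n option) vec"

abbreviation unit_ball :: "(complex ^ 'n) set" where
  "unit_ball \<equiv> ball 0 1"

definition conj_transpose :: "complex ^ 'm ^ 'l \<Rightarrow> complex ^ 'l ^ 'm" where
  "conj_transpose M = (\<chi> i j. cnj (M $ j $ i))"

definition H_form :: "'n::finite mat1" where
  "H_form = (\<chi> i j. if i = j then (if i = None then -1 else 1) else 0)"

definition SU_n1 :: "'n::finite mat1 monoid" where
  "SU_n1 = \<lparr>carrier = {M. det M = 1 \<and> conj_transpose M ** H_form ** M = H_form},
            mult = (**), one = mat 1\<rparr>"

lemma conj_transpose_mult: "conj_transpose (A ** B) = conj_transpose B ** conj_transpose A"
  by (simp add: conj_transpose_def matrix_matrix_mult_def vec_eq_iff mult.commute)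

lemma conj_transpose_conj [simp]: "conj_transpose (conj_transpose A) = A"
  by (simp add: conj_transpose_def vec_eq_iff)

lemma H_form_mult: "(H_form ** M) $ i $ j = (if i = None then -1 else 1) * M $ i $ j"
proof -
  have "(H_form ** M) $ i $ j
      = (\<Sum>k\<in>UNIV. if k = i then (if i = None then -1 else 1) * M $ i $ j else 0)"
    unfolding matrix_matrix_mult_def H_form_def vec_lambda_beta by (rule sum.cong) auto
  then show ?thesis by simp
qed

lemma H_form_square: "H_form ** H_form = mat 1"
  unfolding vec_eq_iff H_form_mult by (auto simp: H_form_def mat_def)

lemma conj_transpose_one: "conj_transpose (mat 1) = mat 1"
  by (simp add: conj_transpose_def mat_def vec_eq_iff)

lemma group_SU_n1: "group (SU_n1 :: 'n::finite mat1 monoid)"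
proof (rule groupI)
  show "\<one>\<^bsub>SU_n1\<^esub> \<in> carrier (SU_n1 :: 'n::finite mat1 monoid)"
    by (simp add: SU_n1_def conj_transpose_one)
next
  fix x y :: "'n mat1" assume "x \<in> carrier SU_n1" "y \<in> carrier SU_n1"
  then show "x \<otimes>\<^bsub>SU_n1\<^esub> y \<in> carrier SU_n1"
    by (simp add: SU_n1_def det_mul conj_transpose_mult) (metis matrix_mul_assoc)
next
  fix x :: "'n mat1" assume x: "x \<in> carrier SU_n1"
  let ?y = "H_form ** conj_transpose x ** H_form"
  have e: "conj_transpose x ** H_form ** x = H_form" and d: "det x = 1" using x by (auto simp: SU_n1_def)
  have l: "?y ** x = mat 1" by (metis e H_form_square matrix_mul_assoc)
  then have r: "x ** ?y = mat 1" using matrix_left_right_inverse by blast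
  have "det ?y = 1" using arg_cong[OF l, of det] d by (simp add: det_mul)
  moreover have "conj_transpose ?y ** H_form ** ?y = H_form"
  proof -
    have "conj_transpose (H_form :: 'n mat1) = H_form" by (auto simp: H_form_def conj_transpose_def vec_eq_iff)
    then have "conj_transpose ?y = H_form ** x ** H_form"
      by (simp add: conj_transpose_mult matrix_mul_assoc)
    then show ?thesis using r by (metis H_form_square matrix_mul_assoc matrix_mul_lid matrix_mul_rid)
  qed
  ultimately show "\<exists>y\<in>carrier SU_n1. y \<otimes>\<^bsub>SU_n1\<^esub> x = \<one>\<^bsub>SU_n1\<^esub>"
    using l by (auto simp: SU_n1_def)
qed (auto simp: SU_n1_def matrix_mul_assoc)

definition block_A :: "'n::finite mat1 \<Rightarrow> complex ^ 'n ^ 'n" where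
  "block_A \<gamma> = (\<chi> i j. \<gamma> $ Some i $ Some j)"

definition block_B :: "'n::finite mat1 \<Rightarrow> complex ^ 'n" where
  "block_B \<gamma> = (\<chi> i. \<gamma> $ Some i $ None)"

definition block_C :: "'n::finite mat1 \<Rightarrow> complex ^ 'n" where
  "block_C \<gamma> = (\<chi> j. \<gamma> $ None $ Some j)"

definition block_D :: "'n::finite mat1 \<Rightarrow> complex" where
  "block_D \<gamma> = \<gamma> $ None $ None"

definition aut_factor :: "'n::finite mat1 \<Rightarrow> complex ^ 'n \<Rightarrow> complex" where
  "aut_factor \<gamma> z = (\<Sum>j\<in>UNIV. block_C \<gamma> $ j * z $ j) + block_D \<gamma>"

definition act :: "'n::finite mat1 \<Rightarrow> complex ^ 'n \<Rightarrow> complex ^ 'n" where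
  "act \<gamma> z = inverse (aut_factor \<gamma> z) *s (block_A \<gamma> *v z + block_B \<gamma>)"

definition torsion_free :: "'n::finite mat1 set \<Rightarrow> bool" where
  "torsion_free \<Gamma> \<longleftrightarrow>
     (\<forall>\<gamma>\<in>\<Gamma>. \<forall>m::nat. m \<ge> 1 \<longrightarrow> \<gamma> [^]\<^bsub>SU_n1\<^esub> m = \<one>\<^bsub>SU_n1\<^esub> \<longrightarrow> \<gamma> = \<one>\<^bsub>SU_n1\<^esub>)"

subsection \<open>The quotient of the ball\<close>

definition orbit :: "'n::finite mat1 set \<Rightarrow> complex ^ 'n \<Rightarrow> (complex ^ 'n) set" where
  "orbit \<Gamma> z = (\<lambda>\<gamma>. act \<gamma> z) ` \<Gamma>"

text \<open>The space of orbits with the quotient topology: a set of orbits is open iff the union of its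
  members, i.e. its preimage in the ball, is open.\<close>

definition ball_quotient :: "'n::finite mat1 set \<Rightarrow> (complex ^ 'n) set topology" where
  "ball_quotient \<Gamma> =
     topology (\<lambda>U. U \<subseteq> orbit \<Gamma> ` unit_ball \<and> open {z \<in> unit_ball. orbit \<Gamma> z \<in> U})"

lemma openin_ball_quotient:
  "openin (ball_quotient \<Gamma>) U \<longleftrightarrow>
     U \<subseteq> orbit \<Gamma> ` unit_ball \<and> open {z \<in> unit_ball. orbit \<Gamma> z \<in> U}"
proof -
  have "istopology (\<lambda>U. U \<subseteq> orbit \<Gamma> ` unit_ball \<and> open {z \<in> unit_ball. orbit \<Gamma> z \<in> U})"
    unfolding istopology_def
  proof (intro conjI allI impI; (elim conjE)?)
    fix S T
    assume "open {z \<in> unit_ball. orbit \<Gamma> z \<in> S}" "open {z \<in> unit_ball. orbit \<Gamma> z \<in> T}"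
    then have "open ({z \<in> unit_ball. orbit \<Gamma> z \<in> S} \<inter> {z \<in> unit_ball. orbit \<Gamma> z \<in> T})"
      by (rule open_Int)
    also have "{z \<in> unit_ball. orbit \<Gamma> z \<in> S} \<inter> {z \<in> unit_ball. orbit \<Gamma> z \<in> T}
               = {z \<in> unit_ball. orbit \<Gamma> z \<in> S \<inter> T}" by auto
    finally show "open {z \<in> unit_ball. orbit \<Gamma> z \<in> S \<inter> T}" .
  next
    fix \<K>
    assume *: "\<forall>K\<in>\<K>. K \<subseteq> orbit \<Gamma> ` unit_ball \<and> open {z \<in> unit_ball. orbit \<Gamma> z \<in> K}"
    then have "open (\<Union>K\<in>\<K>. {z \<in> unit_ball. orbit \<Gamma> z \<in> K})" by blast
    also have "(\<Union>K\<in>\<K>. {z \<in> unit_ball. orbit \<Gamma> z \<in> K}) = {z \<in> unit_ball. orbit \<Gamma> z \<in> \<Union>\<K>}"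
      by auto
    finally show "open {z \<in> unit_ball. orbit \<Gamma> z \<in> \<Union>\<K>}" .
  qed blast+
  then show ?thesis
    unfolding ball_quotient_def by (simp add: topology_inverse')
qed

lemma topspace_ball_quotient: "topspace (ball_quotient \<Gamma>) = orbit \<Gamma> ` unit_ball"
proof -
  have "{z \<in> unit_ball. orbit \<Gamma> z \<in> orbit \<Gamma> ` unit_ball} = unit_ball"
    by auto
  then have "openin (ball_quotient \<Gamma>) (orbit \<Gamma> ` unit_ball)"
    unfolding openin_ball_quotient by simp
  moreover have "topspace (ball_quotient \<Gamma>) \<subseteq> orbit \<Gamma> ` unit_ball"
    using openin_topspace[of "ball_quotient \<Gamma>"] unfolding openin_ball_quotient by (rule conjunct1)
  ultimately show ?thesis
    using openin_subset by (intro subset_antisym)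
qed

subsection \<open>The hyperbolic metric and its volume form\<close>

definition wirtinger :: "'n::finite \<Rightarrow> (complex ^ 'n \<Rightarrow> complex) \<Rightarrow> complex ^ 'n \<Rightarrow> complex" where
  "wirtinger j f z =
     (frechet_derivative f (at z) (axis j 1) - \<i> * frechet_derivative f (at z) (axis j \<i>)) / 2"

definition wirtinger_bar :: "'n::finite \<Rightarrow> (complex ^ 'n \<Rightarrow> complex) \<Rightarrow> complex ^ 'n \<Rightarrow> complex" where
  "wirtinger_bar j f z =
     (frechet_derivative f (at z) (axis j 1) + \<i> * frechet_derivative f (at z) (axis j \<i>)) / 2"

text \<open>The metric \<open>\<mu> = -2 i \<partial>\<partial>bar log (1 - |z|^2)\<close> is written
  \<open>\<mu> = (i/2) \<Sum> h\<^sub>j\<^sub>k dz\<^sub>j \<and> dzbar\<^sub>k\<close>, so that \<open>h\<^sub>j\<^sub>k = -4 \<partial>\<^sub>j \<partial>bar\<^sub>k log (1 - |z|^2)\<close>.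
  As \<open>(i/2) dz \<and> dzbar = dx \<and> dy\<close>, its volume form \<open>\<mu>^n / n!\<close> is \<open>det h\<close> times Lebesgue measure.\<close>

definition hyp_metric :: "complex ^ 'n \<Rightarrow> complex ^ 'n ^ 'n::finite" where
  "hyp_metric z = (\<chi> j k. - 4 *
     wirtinger j (wirtinger_bar k (\<lambda>w. complex_of_real (ln (1 - (norm w)\<^sup>2)))) z)"

definition hyp_vol :: "(complex ^ 'n::finite) measure" where
  "hyp_vol = density lborel (\<lambda>z. ennreal (indicator unit_ball z * Re (det (hyp_metric z))))"

lemma det_axis_row:
  fixes v :: "complex ^ 'n::finite"
  shows "det (\<chi> i. if i = k then v else axis i 1) = v $ k"
proof -
  have r: "row i (mat 1 :: complex^'n^'n) = axis i 1" for i
    by (simp add: row_def mat_def axis_def vec_eq_iff)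
  have s: "(\<Sum>i\<in>UNIV. v $ i *s axis i 1) = v"
    by (simp add: vec_eq_iff axis_def if_distrib cong: if_cong)
  show ?thesis
    using cramer_lemma_transpose[where x = v and A = "mat 1 :: complex^'n^'n" and k = k] by (simp add: r s cong: if_cong)
qed

lemma det_row_v:
  fixes u v :: "complex ^ 'n::finite"
  assumes "finite S" "k \<notin> S"
  shows "det (\<chi> i. if i = k then v else if i \<in> S then axis i 1 + u $ i *s v else axis i 1) = v $ k"
  using assms
proof (induction S rule: finite_induct)
  case empty
  then show ?case using det_axis_row[of k v] by (simp cong: if_cong)
next
  case (insert m S)
  let ?R = "\<lambda>i. if i = k then v else if i \<in> S then axis i 1 + u $ i *s v else axis i 1"
  have "(\<chi> i. if i = k then v else if i \<in> insert m S then axis i 1 + u $ i *s v else axis i 1)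
      = (\<chi> i. if i = m then axis m 1 + u $ m *s v else ?R i)"
    using insert by (auto simp: vec_eq_iff)
  moreover have "(\<chi> i. if i = m then axis m 1 else ?R i) = (\<chi> i. ?R i)"
    using insert by (auto simp: vec_eq_iff)
  moreover have "det (\<chi> i. if i = m then v else ?R i) = 0"
    by (rule det_identical_rows[of m k]) (use insert in \<open>auto simp: row_def vec_eq_iff\<close>)
  ultimately show ?case
    using insert by (simp add: det_row_add[of m] det_row_mul[of m])
qed

lemma det_rank1_aux:
  fixes u v :: "complex ^ 'n::finite"
  assumes "finite S"
  shows "det (\<chi> i. if i \<in> S then axis i 1 + u $ i *s v else axis i 1) = 1 + (\<Sum>i\<in>S. u $ i * v $ i)"
  using assms
proof (induction S rule: finite_induct)
  case empty
  have "(\<chi> i. axis i 1) = (mat 1 :: complex^'n^'n)"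
    by (simp add: mat_def axis_def vec_eq_iff)
  then show ?case by simp
next
  case (insert m S)
  let ?R = "\<lambda>i. if i \<in> S then axis i 1 + u $ i *s v else axis i 1"
  have "(\<chi> i. if i \<in> insert m S then axis i 1 + u $ i *s v else axis i 1)
      = (\<chi> i. if i = m then axis m 1 + u $ m *s v else ?R i)"
    using insert by (auto simp: vec_eq_iff)
  moreover have "(\<chi> i. if i = m then axis m 1 else ?R i) = (\<chi> i. ?R i)"
    using insert by (auto simp: vec_eq_iff)
  moreover have "det (\<chi> i. if i = m then v else ?R i) = v $ m"
    using det_row_v[OF insert(1,2), of v u] by simp
  ultimately show ?case
    using insert by (simp add: det_row_add[of m] det_row_mul[of m])
qed

lemma det_rank1:
  fixes u v :: "complex ^ 'n::finite"
  shows "det (\<chi> i j. (if i = j then 1 else 0) + u $ i * v $ j) = 1 + (\<Sum>i\<in>UNIV. u $ i * v $ i)"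
proof -
  have "(\<chi> i j. (if i = j then 1 else 0) + u $ i * v $ j)
      = (\<chi> i. if i \<in> UNIV then axis i 1 + u $ i *s v else axis i 1)"
    by (simp add: vec_eq_iff axis_def)
  then show ?thesis using det_rank1_aux[of UNIV u v] by simp
qed

lemma of_real_norm_sq: "complex_of_real ((norm (z::complex^'n::finite))\<^sup>2) = (\<Sum>i\<in>UNIV. cnj (z $ i) * z $ i)"
proof -
  have "(norm z)\<^sup>2 = (\<Sum>i\<in>UNIV. (cmod (z $ i))\<^sup>2)"
    by (simp add: norm_vec_def L2_set_def sum_nonneg)
  then show ?thesis
    by (simp only: of_real_sum complex_norm_square mult.commute)
qed

lemma hyp_potential_has_derivative:
  fixes z :: "complex ^ 'n::finite"
  assumes "norm z < 1"
  shows "((\<lambda>w. complex_of_real (ln (1 - (norm w)\<^sup>2))) has_derivative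
     (\<lambda>v. complex_of_real (- 2 * (z \<bullet> v) / (1 - (norm z)\<^sup>2)))) (at z)"
proof -
  have "z \<bullet> z < 1" using assms by (simp add: dot_square_norm power_less_one_iff abs_square_less_1)
  then show ?thesis
  unfolding power2_norm_eq_inner
  by (auto intro!: derivative_eq_intros simp: inner_commute field_simps)
qed

lemma wirtinger_bar_hyp_potential:
  fixes z :: "complex ^ 'n::finite"
  assumes "norm z < 1"
  shows "wirtinger_bar k (\<lambda>w. complex_of_real (ln (1 - (norm w)\<^sup>2))) z
    = - z $ k / complex_of_real (1 - (norm z)\<^sup>2)"
proof -
  define r where "r = 1 - (norm z)\<^sup>2"
  have r: "r \<noteq> 0" using assms by (simp add: abs_square_eq_1 r_def)
  have c: "z $ k = complex_of_real (z \<bullet> axis k 1) + \<i> * complex_of_real (z \<bullet> axis k \<i>)"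
    by (simp add: inner_axis complex_eq_iff inner_complex_def)
  show ?thesis
    unfolding wirtinger_bar_def frechet_derivative_at[OF hyp_potential_has_derivative[OF assms], symmetric]
      r_def[symmetric] c
    using r by (simp add: field_simps)
qed

lemma wirtinger_bar_hyp_potential_has_derivative:
  fixes z :: "complex ^ 'n::finite"
  assumes "norm z < 1"
  shows "(wirtinger_bar k (\<lambda>w. complex_of_real (ln (1 - (norm w)\<^sup>2))) has_derivative
     (\<lambda>v. - v $ k / complex_of_real (1 - (norm z)\<^sup>2)
        - z $ k * complex_of_real (2 * (z \<bullet> v)) / complex_of_real (1 - (norm z)\<^sup>2) ^ 2)) (at z)"
proof -
  define r where "r = complex_of_real (1 - (norm z)\<^sup>2)"
  have r: "r \<noteq> 0"
    using assms unfolding r_def of_real_eq_0_iff by (simp add: abs_square_eq_1)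
  have 1: "((\<lambda>w. - w $ k) has_derivative (\<lambda>v. - v $ k)) (at z)"
    by (intro has_derivative_minus bounded_linear.has_derivative[OF bounded_linear_vec_nth]
        has_derivative_ident)
  have 2: "((\<lambda>w. complex_of_real (1 - (norm w)\<^sup>2)) has_derivative
      (\<lambda>v. - complex_of_real (2 * (z \<bullet> v)))) (at z)"
    unfolding power2_norm_eq_inner
    by (auto intro!: derivative_eq_intros simp: inner_commute)
  have "((\<lambda>w. - w $ k / complex_of_real (1 - (norm w)\<^sup>2)) has_derivative
     (\<lambda>v. (- v $ k * r - (- z $ k) * (- complex_of_real (2 * (z \<bullet> v)))) / (r * r))) (at z)"
    using has_derivative_divide'[OF 1 2] r unfolding r_def by blast
  also have "(\<lambda>v. (- v $ k * r - (- z $ k) * (- complex_of_real (2 * (z \<bullet> v)))) / (r * r))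
      = (\<lambda>v. - v $ k / r - z $ k * complex_of_real (2 * (z \<bullet> v)) / r ^ 2)"
    using r by (simp add: fun_eq_iff field_simps power2_eq_square)
  finally show ?thesis
    unfolding r_def
    by (rule has_derivative_transform_within_open[of _ _ _ _ "ball 0 1"])
      (use assms in \<open>auto simp: wirtinger_bar_hyp_potential\<close>)
qed

lemma hyp_metric_eq:
  fixes z :: "complex ^ 'n::finite"
  assumes "norm z < 1"
  shows "hyp_metric z $ j $ k = 4 * ((if j = k then 1 else 0) / complex_of_real (1 - (norm z)\<^sup>2)
      + cnj (z $ j) * z $ k / complex_of_real (1 - (norm z)\<^sup>2) ^ 2)"
proof -
  have nz: "complex_of_real (1 - (norm z)\<^sup>2) \<noteq> 0" 
    using assms unfolding of_real_eq_0_iff by (simp add: abs_square_eq_1)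
  define r where "r = complex_of_real (1 - (norm z)\<^sup>2)"
  have c: "cnj (z $ j) = complex_of_real (z \<bullet> axis j 1) - \<i> * complex_of_real (z \<bullet> axis j \<i>)"
    by (simp add: inner_axis complex_eq_iff inner_complex_def)
  show ?thesis
    using nz
    unfolding hyp_metric_def wirtinger_def frechet_derivative_at[OF wirtinger_bar_hyp_potential_has_derivative[OF assms], symmetric] c
      r_def[symmetric]
    by (auto simp: axis_def field_simps)
qed

lemma det_hyp_metric:
  fixes z :: "complex ^ 'n::finite"
  assumes "norm z < 1"
  shows "det (hyp_metric z) = complex_of_real (4 ^ CARD('n) / (1 - (norm z)\<^sup>2) ^ (CARD('n) + 1))"
proof -
  define r where "r = complex_of_real (1 - (norm z)\<^sup>2)"
  have nz: "r \<noteq> 0" 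
    using assms unfolding r_def of_real_eq_0_iff by (simp add: abs_square_eq_1)
  have "hyp_metric z = (\<chi> j. (4 / r) *s (\<chi> k. (if j = k then 1 else 0) + (\<chi> j. cnj (z $ j) / r) $ j * z $ k))"
    using nz by (simp add: vec_eq_iff hyp_metric_eq[OF assms, folded r_def] field_simps power2_eq_square)
  then have "det (hyp_metric z) = (4 / r) ^ CARD('n) * (1 + (\<Sum>i\<in>UNIV. cnj (z $ i) / r * z $ i))"
    using det_rows_mul[of "\<lambda>_. 4 / r" "\<lambda>j. (\<chi> k. (if j = k then 1 else 0) + (\<chi> j. cnj (z $ j) / r) $ j * z $ k)"]
      det_rank1[of "\<chi> j. cnj (z $ j) / r" z]
    by simp
  also have "(\<Sum>i\<in>UNIV. cnj (z $ i) / r * z $ i) = (1 - r) / r"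
    using of_real_norm_sq[of z] by (simp add: r_def sum_divide_distrib)
  also have "1 + (1 - r) / r = 1 / r" using nz by (simp add: field_simps)
  finally show ?thesis by (simp add: r_def power_divide mult.commute)
qed

subsection \<open>Cusp forms, Petersson inner product, Bergman kernel\<close>

definition holomorphic_ball :: "(complex ^ 'n::finite \<Rightarrow> complex) \<Rightarrow> bool" where
  "holomorphic_ball f \<longleftrightarrow> (\<forall>z\<in>unit_ball. \<exists>f'. (f has_derivative f') (at z) \<and>
     (\<forall>c v. f' (c *s v) = c * f' v))"

text \<open>Functions on the ball are represented by total functions vanishing outside it, so that
  equality of forms is equality of functions.\<close>

definition cusp_forms :: "'n::finite mat1 set \<Rightarrow> nat \<Rightarrow> (complex ^ 'n \<Rightarrow> complex) set" where
  "cusp_forms \<Gamma> k = {f. holomorphic_ball f \<and> (\<forall>z. z \<notin> unit_ball \<longrightarrow> f z = 0) \<and>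
     (\<forall>\<gamma>\<in>\<Gamma>. \<forall>z\<in>unit_ball. f (act \<gamma> z) = aut_factor \<gamma> z ^ k * f z)}"

definition fundamental_domain :: "'n::finite mat1 set \<Rightarrow> (complex ^ 'n) set \<Rightarrow> bool" where
  "fundamental_domain \<Gamma> F \<longleftrightarrow> F \<in> sets borel \<and> F \<subseteq> unit_ball \<and>
     (AE z in lborel. z \<in> unit_ball \<longrightarrow> z \<in> (\<Union>\<gamma>\<in>\<Gamma>. act \<gamma> ` F)) \<and>
     (\<forall>\<gamma>\<in>\<Gamma>. \<gamma> \<noteq> mat 1 \<longrightarrow> (AE z in lborel. z \<notin> F \<inter> act \<gamma> ` F))"

definition petersson ::
  "(complex ^ 'n::finite) set \<Rightarrow> nat \<Rightarrow> (complex ^ 'n \<Rightarrow> complex) \<Rightarrow> (complex ^ 'n \<Rightarrow> complex) \<Rightarrow> complex"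
  where "petersson F k f g =
     (LINT z:F|hyp_vol. complex_of_real ((1 - (norm z)\<^sup>2) ^ k) * f z * cnj (g z))"

definition orthonormal_basis ::
  "'n::finite mat1 set \<Rightarrow> (complex ^ 'n) set \<Rightarrow> nat \<Rightarrow> (complex ^ 'n \<Rightarrow> complex) set \<Rightarrow> bool" where
  "orthonormal_basis \<Gamma> F k B \<longleftrightarrow> finite B \<and> B \<subseteq> cusp_forms \<Gamma> k \<and>
     (\<forall>f\<in>B. \<forall>g\<in>B. petersson F k f g = (if f = g then 1 else 0)) \<and>
     (\<forall>f\<in>cusp_forms \<Gamma> k. \<exists>c. f = (\<lambda>z. \<Sum>g\<in>B. c g * g z))"

text \<open>The kernel does not depend on the orthonormal basis. One exists when the quotient is compact,
  since the space of cusp forms is then finite-dimensional; this existence is not assumed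
  anywhere.\<close>

definition bergman_kernel ::
  "'n::finite mat1 set \<Rightarrow> (complex ^ 'n) set \<Rightarrow> nat \<Rightarrow> complex ^ 'n \<Rightarrow> complex ^ 'n \<Rightarrow> complex" where
  "bergman_kernel \<Gamma> F k z w =
     (\<Sum>f\<in>(SOME B. orthonormal_basis \<Gamma> F k B). f z * cnj (f w))"

definition bergman_pet ::
  "'n::finite mat1 set \<Rightarrow> (complex ^ 'n) set \<Rightarrow> nat \<Rightarrow> complex ^ 'n \<Rightarrow> real" where
  "bergman_pet \<Gamma> F k z = (1 - (norm z)\<^sup>2) ^ k * cmod (bergman_kernel \<Gamma> F k z z)"

end

theory Submission
  imports Defs "HOL-Complex_Analysis.Cauchy_Integral_Formula" "HOL-Real_Asymp.Real_Asymp"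
begin

text \<open>The Poincare series \<open>P\<^sub>w(z) = \<Sum>\<^sub>\<gamma> (j(\<gamma>,z) (1 - \<langle>\<gamma>z,w\<rangle>))\<^sup>-\<^sup>k\<close> is a cusp form. Unfolding the Petersson
  product and applying the mean value property at \<open>w\<close> gives \<open>\<langle>f, P\<^sub>w\<rangle> = I\<^sub>k f(w)\<close>, where
  \<open>I\<^sub>k = \<integral> (1 - |z|\<^sup>2)\<^sup>k\<close> over the ball equals \<open>(4\<pi>)\<^sup>n (k-n-1)!/(k-1)!\<close>. Hence the Bergman kernel at \<open>(z,w)\<close> is
  \<open>P\<^sub>w(z) / I\<^sub>k\<close>. In \<open>(1 - |z|\<^sup>2)\<^sup>k P\<^sub>z(z)\<close> the identity contributes \<open>1\<close>; since the lattice acts freely and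
  cocompactly, every other element displaces every point by at least a fixed hyperbolic distance, so the
  remaining terms sum to something exponentially small in \<open>k\<close>, uniformly in \<open>z\<close>.\<close>

subsection \<open>The action of U(n,1) on the ball\<close>

text \<open>One invariant carries all estimates: multiplied by the square roots of
  \<open>gap z ^ k\<close> and \<open>gap w ^ k\<close>, the term of \<gamma> in the series has
  absolute value \<open>sqrt (rho (act \<gamma> z) w) ^ k\<close>. Of these k factors, 2n+2 are
  spent on convergence, because the sums of \<open>rho ^ (n+1)\<close> over the lattice are bounded
  uniformly by comparison with an integral; the other k-2n-2 supply the exponential decay. Hence the
  bound k \<ge> 2n+2 that recurs below. The kernel is defined through a chosen orthonormal basis, so
  it says something only once such a basis is known to exist. Finite dimension is extracted from the
  same series: Bessel's inequality for it bounds the size of every orthonormal system. The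
  invariance statements are proved for all of \<open>unitary_n1\<close>, since the reduction of an
  arbitrary point to the origin uses translations of the ball that do not belong to the lattice. The
  origin is where the mean value property takes its simplest form, by averaging over the rotations z
  \<mapsto> cz with |c| = 1.\<close>

definition unitary_n1 :: "'n::finite mat1 set" where
  "unitary_n1 = {M. conj_transpose M ** H_form ** M = H_form}"

definition herm :: "complex ^ 'n \<Rightarrow> complex ^ 'n::finite \<Rightarrow> complex" where
  "herm z w = (\<Sum>i\<in>UNIV. z $ i * cnj (w $ i))"

text \<open>Homogeneous coordinates. The ball is the chart t = 1 of the cone on which
  \<open>hform x x\<close> is negative; a matrix acts linearly upstairs, \<open>act\<close> is the
  induced projective map and \<open>aut_factor\<close> the last coordinate of the image of
  \<open>lift z 1\<close>. All transformation rules below are read off from this picture.\<close>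

definition lift :: "complex ^ 'n \<Rightarrow> complex \<Rightarrow> complex ^ 'n::finite option" where
  "lift z t = (\<chi> i. case i of None \<Rightarrow> t | Some j \<Rightarrow> z $ j)"

definition hform :: "complex ^ 'n option \<Rightarrow> complex ^ 'n::finite option \<Rightarrow> complex" where
  "hform x y = herm (H_form *v x) y"

abbreviation gap :: "'a::real_normed_vector \<Rightarrow> real" where
  "gap z \<equiv> 1 - (norm z)\<^sup>2"

definition Q_ker :: "complex ^ 'n \<Rightarrow> complex ^ 'n::finite \<Rightarrow> complex" where
  "Q_ker z w = 1 - herm z w"

text \<open>In terms of the hyperbolic distance, \<open>rho z w = 1 / cosh (d(z,w) / 2)\<^sup>2\<close>.\<close>

definition rho :: "complex ^ 'n \<Rightarrow> complex ^ 'n::finite \<Rightarrow> real" where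
  "rho z w = gap z * gap w / (cmod (Q_ker z w))\<^sup>2"

text \<open>The inverse of a form-preserving matrix, in explicit form: its continuity in
  \<open>M\<close> enters the discreteness argument, and its entries turn relations between columns
  into relations between rows.\<close>

definition u_inv :: "'n::finite mat1 \<Rightarrow> 'n mat1" where
  "u_inv M = H_form ** conj_transpose M ** H_form"

lemma sum_option: "(\<Sum>i\<in>UNIV. f i) = f None + (\<Sum>j\<in>UNIV. f (Some j))"
  for f :: "'n::finite option \<Rightarrow> 'a::comm_monoid_add"
  by (simp add: UNIV_option_conv sum.reindex)

lemma lift_nth [simp]: "lift z t $ None = t" "lift z t $ Some j = z $ j"
  by (simp_all add: lift_def)

lemma lift_eqI: "x $ None = t \<Longrightarrow> (\<And>j. x $ Some j = z $ j) \<Longrightarrow> x = lift z t"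
  by (auto simp: vec_eq_iff lift_def split: option.splits)

lemma H_form_vec: "(H_form *v x) $ i = (if i = None then -1 else 1) * x $ i"
proof -
  have "(H_form *v x) $ i = (\<Sum>k\<in>UNIV. if k = i then (if i = None then -1 else 1) * x $ i else 0)"
    unfolding matrix_vector_mult_def H_form_def vec_lambda_beta by (rule sum.cong) auto
  then show ?thesis by simp
qed

lemma hform_lift: "hform (lift z s) (lift w t) = herm z w - s * cnj t"
  by (simp add: hform_def herm_def H_form_vec sum_option)

lemma herm_adjoint: "herm (A *v x) y = herm x (conj_transpose A *v y)"
proof -
  have "herm (A *v x) y = (\<Sum>i\<in>UNIV. \<Sum>j\<in>UNIV. A $ i $ j * x $ j * cnj (y $ i))"
    by (simp add: herm_def matrix_vector_mult_def sum_distrib_right)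
  also have "\<dots> = (\<Sum>j\<in>UNIV. \<Sum>i\<in>UNIV. A $ i $ j * x $ j * cnj (y $ i))" by (rule sum.swap)
  also have "\<dots> = herm x (conj_transpose A *v y)"
    by (simp add: herm_def matrix_vector_mult_def conj_transpose_def sum_distrib_left mult_ac)
  finally show ?thesis .
qed

lemma conj_transpose_H: "conj_transpose (H_form :: 'n::finite mat1) = H_form"
  by (auto simp: H_form_def conj_transpose_def vec_eq_iff)

lemma hform_unitary:
  assumes "M \<in> unitary_n1" shows "hform (M *v x) (M *v y) = hform x y"
proof -
  have "hform (M *v x) (M *v y) = herm (conj_transpose (conj_transpose (H_form ** M)) *v x) (M *v y)"
    by (simp add: hform_def matrix_vector_mul_assoc)
  also have "\<dots> = herm x ((conj_transpose (H_form ** M) ** M) *v y)"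
    by (simp add: herm_adjoint matrix_vector_mul_assoc)
  also have "conj_transpose (H_form ** M) ** M = conj_transpose M ** H_form ** M"
    by (simp add: conj_transpose_mult conj_transpose_H)
  also have "\<dots> = conj_transpose H_form"
    using assms by (simp add: unitary_n1_def conj_transpose_H)
  also have "herm x (conj_transpose H_form *v y) = hform x y"
    by (simp add: hform_def herm_adjoint)
  finally show ?thesis .
qed

lemma SU_subset_unitary: "carrier SU_n1 \<subseteq> unitary_n1"
  by (auto simp: SU_n1_def unitary_n1_def)

lemma u_inv:
  assumes "M \<in> unitary_n1"
  shows "u_inv M ** M = mat 1" "M ** u_inv M = mat 1" "u_inv M \<in> unitary_n1"
proof -
  have e: "conj_transpose M ** H_form ** M = H_form" using assms by (auto simp: unitary_n1_def)
  show l: "u_inv M ** M = mat 1" unfolding u_inv_def by (metis e H_form_square matrix_mul_assoc)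
  then show r: "M ** u_inv M = mat 1" using matrix_left_right_inverse by blast
  have "conj_transpose (u_inv M) = H_form ** M ** H_form"
    by (simp add: u_inv_def conj_transpose_mult matrix_mul_assoc conj_transpose_H)
  then have "conj_transpose (u_inv M) ** H_form ** u_inv M = H_form"
    using r by (metis H_form_square matrix_mul_assoc matrix_mul_lid matrix_mul_rid)
  then show "u_inv M \<in> unitary_n1" by (simp add: unitary_n1_def)
qed

lemma unitary_mult: "M \<in> unitary_n1 \<Longrightarrow> N \<in> unitary_n1 \<Longrightarrow> M ** N \<in> unitary_n1"
  by (simp add: unitary_n1_def conj_transpose_mult) (metis matrix_mul_assoc)

lemma herm_self: "herm z z = complex_of_real ((norm z)\<^sup>2)"
  unfolding of_real_norm_sq by (simp add: herm_def mult.commute)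

lemma herm_cnj: "cnj (herm z w) = herm w z"
  by (simp add: herm_def mult.commute)

lemma cmod_herm_le: "cmod (herm z w) \<le> norm z * norm w"
proof -
  have "cmod (herm z w) \<le> (\<Sum>i\<in>UNIV. \<bar>cmod (z $ i)\<bar> * \<bar>cmod (w $ i)\<bar>)"
    unfolding herm_def by (rule sum_norm_le) (simp add: norm_mult)
  also have "\<dots> \<le> norm z * norm w"
    unfolding norm_vec_def by (rule L2_set_mult_ineq)
  finally show ?thesis .
qed

lemma Q_ker_norm_ge: "cmod (Q_ker z w) \<ge> 1 - norm z * norm w"
  using norm_triangle_ineq2[of 1 "herm z w"] cmod_herm_le[of z w] by (simp add: Q_ker_def)

lemma Q_ker_norm_le: "cmod (Q_ker z w) \<le> 1 + norm z * norm w"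
  using norm_triangle_ineq4[of 1 "herm z w"] cmod_herm_le[of z w] by (simp add: Q_ker_def)

lemma norm_prod_less_1: "norm z < 1 \<Longrightarrow> norm w < 1 \<Longrightarrow> norm z * norm w < 1"
  using mult_strict_mono[of "norm z" 1 "norm w" 1] by simp

lemma Q_ker_nz: "norm z < 1 \<Longrightarrow> norm w < 1 \<Longrightarrow> Q_ker z w \<noteq> 0"
  using Q_ker_norm_ge[of z w] norm_prod_less_1[of z w] by auto

lemma one_minus_norm_sq_pos: "norm z < 1 \<Longrightarrow> gap z > 0"
  by (simp add: abs_square_less_1)

lemma mult_lift:
  "M *v lift z t = lift (block_A M *v z + t *s block_B M) ((\<Sum>j\<in>UNIV. block_C M $ j * z $ j) + block_D M * t)"
  by (rule lift_eqI)
     (auto simp: matrix_vector_mult_def sum_option block_A_def block_B_def block_C_def block_D_def mult_ac)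

lemma mult_lift1: "(M *v lift z 1) $ None = aut_factor M z"
  by (simp add: mult_lift aut_factor_def)

text \<open>A vector with last coordinate 0 has nonnegative \<open>hform\<close>, whereas
  \<open>lift z 1\<close> has the negative value |z|^2 - 1, which \<open>M\<close>
  preserves.\<close>

lemma aut_factor_nz:
  assumes "M \<in> unitary_n1" "norm z < 1" shows "aut_factor M z \<noteq> 0"
proof
  assume 0: "aut_factor M z = 0"
  define u where "u = block_A M *v z + block_B M"
  have u: "M *v lift z 1 = lift u (aut_factor M z)"
    by (simp add: mult_lift aut_factor_def u_def)
  have "herm u u - 0 = herm z z - 1"
    using hform_unitary[OF assms(1), of "lift z 1" "lift z 1"] by (simp add: u hform_lift 0)
  then have "(norm u)\<^sup>2 = (norm z)\<^sup>2 - 1" unfolding herm_self by (metis of_real_1 of_real_diff of_real_eq_iff diff_zero)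
  then show False using one_minus_norm_sq_pos[OF assms(2)] zero_le_power2[of "norm u"] by linarith
qed

lemma mult_lift_act:
  assumes "aut_factor M z \<noteq> 0"
  shows "M *v lift z 1 = aut_factor M z *s lift (act M z) 1"
proof -
  have "M *v lift z 1 = lift (block_A M *v z + block_B M) (aut_factor M z)"
    by (simp add: mult_lift aut_factor_def)
  also have "\<dots> = aut_factor M z *s lift (act M z) 1"
    using assms by (intro lift_eqI[symmetric]) (auto simp: act_def field_simps)
  finally show ?thesis .
qed

lemma hform_scale: "hform (a *s x) (b *s y) = a * cnj b * hform x y"
proof -
  have "H_form *v (a *s x) = a *s (H_form *v x)" by (simp add: vec_eq_iff H_form_vec)
  then show ?thesis by (simp add: hform_def herm_def sum_distrib_left mult_ac)
qed

text \<open>\<open>Q_ker z w\<close> is minus the form on \<open>lift z 1\<close> and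
  \<open>lift w 1\<close>; the images of these vectors are the lifts of the image points, scaled by
  the automorphy factors.\<close>

lemma Q_ker_act:
  assumes "M \<in> unitary_n1" "norm z < 1" "norm w < 1"
  shows "Q_ker (act M z) (act M w) * aut_factor M z * cnj (aut_factor M w) = Q_ker z w"
proof -
  have "hform (M *v lift z 1) (M *v lift w 1) = hform (lift z 1) (lift w 1)"
    by (rule hform_unitary[OF assms(1)])
  then show ?thesis
    unfolding mult_lift_act[OF aut_factor_nz[OF assms(1,2)]] mult_lift_act[OF aut_factor_nz[OF assms(1,3)]]
      hform_scale hform_lift Q_ker_def
    by (simp add: algebra_simps)
qed

lemma one_minus_norm_act:
  assumes "M \<in> unitary_n1" "norm z < 1"
  shows "gap (act M z) * (cmod (aut_factor M z))\<^sup>2 = gap z"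
proof -
  have *: "Q_ker x x = complex_of_real (gap x)" for x :: "complex ^ 'a"
    by (simp add: Q_ker_def herm_self)
  have "complex_of_real (gap (act M z) * (cmod (aut_factor M z))\<^sup>2) = complex_of_real (gap z)"
    using Q_ker_act[OF assms assms(2)] unfolding * of_real_mult complex_norm_square
    by (simp add: mult_ac)
  then show ?thesis using of_real_eq_iff by blast
qed

lemma act_ball:
  assumes "M \<in> unitary_n1" "norm z < 1" shows "norm (act M z) < 1"
proof -
  have "gap (act M z) * (cmod (aut_factor M z))\<^sup>2 > 0"
    using one_minus_norm_act[OF assms] one_minus_norm_sq_pos[OF assms(2)] by simp
  then have "gap (act M z) > 0" 
    by (simp add: zero_less_mult_iff)
  then show ?thesis by (simp add: abs_square_less_1)
qed

text \<open>Both identities express associativity of the linear action on \<open>lift z 1\<close>: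
  comparing last coordinates gives the cocycle rule, and dividing by them gives the rule for the
  action.\<close>

lemma act_aut_mult:
  assumes "M \<in> unitary_n1" "N \<in> unitary_n1" "norm z < 1"
  shows "act (M ** N) z = act M (act N z)"
    and "aut_factor (M ** N) z = aut_factor M (act N z) * aut_factor N z"
proof -
  let ?a = "aut_factor M (act N z)" and ?b = "aut_factor N z" and ?c = "aut_factor (M ** N) z"
  note MN = unitary_mult[OF assms(1,2)]
  have nz: "?a \<noteq> 0" "?b \<noteq> 0" "?c \<noteq> 0"
    using aut_factor_nz[OF assms(1) act_ball[OF assms(2,3)]] aut_factor_nz[OF assms(2,3)] aut_factor_nz[OF MN assms(3)]
    by auto
  have "?c *s lift (act (M ** N) z) 1 = M *v (N *v lift z 1)"
    by (simp add: mult_lift_act[OF nz(3), symmetric] matrix_vector_mul_assoc)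
  also have "\<dots> = ?b *s (M *v lift (act N z) 1)"
    by (simp add: mult_lift_act[OF nz(2)] vector_scalar_commute)
  also have "\<dots> = (?a * ?b) *s lift (act M (act N z)) 1"
    by (simp add: mult_lift_act[OF nz(1)] mult_ac)
  finally have e: "?c *s lift (act (M ** N) z) 1 = (?a * ?b) *s lift (act M (act N z)) 1" .
  show 1: "?c = ?a * ?b" using arg_cong[OF e, of "\<lambda>x. x $ None"] by simp
  show "act (M ** N) z = act M (act N z)"
  proof (subst vec_eq_iff, rule allI)
    fix i show "act (M ** N) z $ i = act M (act N z) $ i"
      using arg_cong[OF e, of "\<lambda>x. x $ Some i"] 1 nz by simp
  qed
qed

lemma aut_factor_one [simp]: "aut_factor (mat 1) z = 1"
  by (simp add: mult_lift1[symmetric])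

lemma act_one [simp]: "act (mat 1) z = z"
  using mult_lift_act[of "mat 1" z] by (simp add: vec_eq_iff) (metis lift_nth(2))

lemma act_u_inv:
  assumes "M \<in> unitary_n1" "norm z < 1"
  shows "act (u_inv M) (act M z) = z" "act M (act (u_inv M) z) = z"
  using act_aut_mult(1)[OF u_inv(3)[OF assms(1)] assms] act_aut_mult(1)[OF assms(1) u_inv(3)[OF assms(1)] assms(2)]
    u_inv[OF assms(1)] by simp_all

section \<open>The invariant \<open>rho\<close> and translations of the ball\<close>

lemma rho_act:
  assumes "M \<in> unitary_n1" "norm z < 1" "norm w < 1"
  shows "rho (act M z) (act M w) = rho z w"
proof -
  note q = Q_ker_act[OF assms]
  note nz = aut_factor_nz[OF assms(1,2)] aut_factor_nz[OF assms(1,3)]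
  have 1: "cmod (Q_ker z w) = cmod (Q_ker (act M z) (act M w)) * cmod (aut_factor M z) * cmod (aut_factor M w)"
    using arg_cong[OF q, of cmod] by (simp add: norm_mult)
  show ?thesis
    unfolding rho_def 1 one_minus_norm_act[OF assms(1,2), symmetric] one_minus_norm_act[OF assms(1,3), symmetric]
    using nz by (simp add: power_mult_distrib)
qed

lemma rho_pos: "norm z < 1 \<Longrightarrow> norm w < 1 \<Longrightarrow> rho z w > 0"
  using Q_ker_nz[of z w] one_minus_norm_sq_pos[of z] one_minus_norm_sq_pos[of w] by (simp add: rho_def)

lemma rho_0: "rho z 0 = gap z" "rho 0 z = gap z"
  by (simp_all add: rho_def Q_ker_def herm_def)

lemma rho_sym: "rho z w = rho w z"
proof -
  have "Q_ker z w = cnj (Q_ker w z)" by (simp add: Q_ker_def herm_cnj)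
  then show ?thesis by (simp add: rho_def)
qed

lemma cmod_power2_sum: "(norm (z::complex^'n::finite))\<^sup>2 = (\<Sum>i\<in>UNIV. (cmod (z $ i))\<^sup>2)"
  by (simp add: norm_vec_def L2_set_def sum_nonneg)

text \<open>The hyperbolic translation along the geodesic from \<open>0\<close> to \<open>w\<close>; its determinant is irrelevant, since
  only the invariance of the Hermitian form is used.\<close>

definition boost :: "complex ^ 'n \<Rightarrow> 'n::finite mat1" where
  "boost w = (let s = complex_of_real (sqrt (gap w)) in
     (\<chi> i j. case i of
        None \<Rightarrow> (case j of None \<Rightarrow> 1 / s | Some b \<Rightarrow> cnj (w $ b) / s)
      | Some a \<Rightarrow> (case j of None \<Rightarrow> w $ a / s
           | Some b \<Rightarrow> (if a = b then 1 else 0) + w $ a * cnj (w $ b) / (s * (1 + s)))))"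

lemma boost:
  assumes "norm (w::complex^'n::finite) < 1"
  shows "boost w \<in> unitary_n1" "act (boost w) 0 = w"
proof -
  define s where "s = complex_of_real (sqrt (gap w))"
  have sp: "sqrt (gap w) > 0" using one_minus_norm_sq_pos[OF assms] by simp
  have s0: "s \<noteq> 0" using sp by (simp add: s_def)
  have s1: "1 + s \<noteq> 0" using sp unfolding s_def by (metis add_pos_pos of_real_1 of_real_add of_real_eq_0_iff order_less_irrefl zero_less_one)
  have s2: "s\<^sup>2 = 1 - complex_of_real ((norm w)\<^sup>2)"
    unfolding s_def using sp by (simp del: of_real_diff flip: of_real_power) simp
  define N where "N = (\<Sum>k\<in>UNIV. w $ k * cnj (w $ k))"
  have N: "N = 1 - s\<^sup>2" unfolding s2 of_real_norm_sq N_def by (simp add: mult.commute)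
  have cs: "cnj s = s" by (simp add: s_def)
  \<comment> \<open>The spatial block of a boost is the identity plus (1/s - 1) times the projection
    onto the line of w. With |w|^2 = 1 - s^2 the coefficient (1/s - 1)/|w|^2 simplifies to
    1/(s(1+s)), which is also defined for w = 0.\<close>
  define c where "c = 1 / (s * (1 + s))"
  define e where "e k i = (if k = i then 1 else 0 :: complex)" for k i :: 'n
  have b: "boost w $ None $ None = 1 / s" "boost w $ None $ Some i = cnj (w $ i) / s"
     "boost w $ Some i $ None = w $ i / s" "boost w $ Some i $ Some j = e i j + c * w $ i * cnj (w $ j)" for i j
    by (simp_all add: boost_def Let_def s_def c_def e_def)
  have ccj: "cnj c = c" by (simp add: c_def cs)
  have cc: "c * s * (1 + s) = 1" using s0 s1 by (simp add: c_def)
  \<comment> \<open>The relation to which the mixed entries of M* H M = H reduce; \<open>c2\<close>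
    below is the one for the spatial block. Both follow from N = (1-s)(1+s).\<close>
  have c1: "1 + c * N = 1 / s"
  proof -
    have "s * (1 + c * N) = s + c * s * (1 + s) * (1 - s)" unfolding N by (simp add: power2_eq_square algebra_simps)
    also have "\<dots> = 1" unfolding cc by simp
    finally show ?thesis using s0 by (simp add: nonzero_eq_divide_eq mult.commute)
  qed
  have c2: "2 * c + c * c * N = 1 / s\<^sup>2"
  proof -
    have "s\<^sup>2 * (2 * c + c * c * N) = 2 * s\<^sup>2 * c + c * s * (1 + s) * (c * s) * (1 - s)" unfolding N by (simp add: power2_eq_square algebra_simps)
    also have "\<dots> = 2 * s\<^sup>2 * c + c * s * (1 - s)" unfolding cc by simp
    also have "\<dots> = c * s * (1 + s)" by (simp add: algebra_simps power2_eq_square)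
    finally show ?thesis using s0 unfolding cc by (simp add: nonzero_eq_divide_eq mult.commute)
  qed
  have ent: "(conj_transpose (boost w) ** H_form ** boost w) $ i $ j
     = (\<Sum>k\<in>UNIV. cnj (boost w $ Some k $ i) * boost w $ Some k $ j) - cnj (boost w $ None $ i) * boost w $ None $ j" for i j
  proof -
    have "(conj_transpose (boost w) ** (H_form ** boost w)) $ i $ j = (\<Sum>k\<in>UNIV. cnj (boost w $ k $ i) * (H_form ** boost w) $ k $ j)"
      by (subst matrix_matrix_mult_def) (simp add: conj_transpose_def)
    also have "\<dots> = (\<Sum>k\<in>UNIV. cnj (boost w $ Some k $ i) * boost w $ Some k $ j) - cnj (boost w $ None $ i) * boost w $ None $ j"
      by (simp add: H_form_mult sum_option)
    finally show ?thesis by (simp add: matrix_mul_assoc)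
  qed
  have ce: "cnj (e k i) = e k i" for k i by (simp add: e_def)
  have d1: "(\<Sum>k\<in>UNIV. e k a * f k) = f a" for a :: 'n and f :: "'n \<Rightarrow> complex"
    by (simp add: e_def if_distrib[of "\<lambda>x. x * _"] cong: if_cong)
  have nn: "(\<Sum>k\<in>UNIV. cnj (w $ k / s) * (w $ k / s)) = N / s\<^sup>2"
    by (simp add: N_def cs sum_divide_distrib power2_eq_square mult_ac)
  have sn: "(\<Sum>k\<in>UNIV. cnj (e k i + c * w $ k * cnj (w $ i)) * (w $ k / s)) = w $ i / s\<^sup>2" for i
  proof -
    have "cnj (e k i + c * w $ k * cnj (w $ i)) * (w $ k / s) = e k i * (w $ k / s) + c * w $ i / s * (w $ k * cnj (w $ k))" for k
      by (simp add: ccj ce algebra_simps add_divide_distrib)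
    then have "(\<Sum>k\<in>UNIV. cnj (e k i + c * w $ k * cnj (w $ i)) * (w $ k / s))
       = (\<Sum>k\<in>UNIV. e k i * (w $ k / s)) + c * w $ i / s * N"
      unfolding N_def sum_distrib_left sum.distrib[symmetric] by presburger
    also have "\<dots> = w $ i / s * (1 + c * N)"
      unfolding d1 by (simp add: algebra_simps add_divide_distrib)
    finally show ?thesis by (simp add: c1 power2_eq_square)
  qed
  have ns: "(\<Sum>k\<in>UNIV. cnj (w $ k / s) * (e k i + c * w $ k * cnj (w $ i))) = cnj (w $ i) / s\<^sup>2" for i
    using arg_cong[OF sn[of i], of cnj] by (simp add: cs ccj ce mult_ac)
  have ss: "(\<Sum>k\<in>UNIV. cnj (e k i + c * w $ k * cnj (w $ i)) * (e k j + c * w $ k * cnj (w $ j)))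
     = e i j + w $ i * cnj (w $ j) / s\<^sup>2" for i j
  proof -
    have "cnj (e k i + c * w $ k * cnj (w $ i)) * (e k j + c * w $ k * cnj (w $ j))
       = e k i * (e k j + c * w $ k * cnj (w $ j)) + e k j * (c * cnj (w $ k) * w $ i)
         + c * c * w $ i * cnj (w $ j) * (w $ k * cnj (w $ k))" for k
      by (simp add: ccj ce algebra_simps)
    then have "(\<Sum>k\<in>UNIV. cnj (e k i + c * w $ k * cnj (w $ i)) * (e k j + c * w $ k * cnj (w $ j)))
       = (\<Sum>k\<in>UNIV. e k i * (e k j + c * w $ k * cnj (w $ j)))
         + (\<Sum>k\<in>UNIV. e k j * (c * cnj (w $ k) * w $ i)) + c * c * w $ i * cnj (w $ j) * N"
      unfolding N_def sum_distrib_left sum.distrib[symmetric] by presburger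
    also have "\<dots> = e i j + w $ i * cnj (w $ j) * (2 * c + c * c * N)"
      unfolding d1 by (simp add: algebra_simps)
    finally show ?thesis by (simp add: c2)
  qed
  have "(conj_transpose (boost w) ** H_form ** boost w) $ i $ j = H_form $ i $ j" for i j
  proof (cases i; cases j)
    assume i: "i = None" and j: "j = None"
    show ?thesis unfolding ent i j b nn using s0 by (simp add: N H_form_def cs field_simps power2_eq_square)
  next
    fix b' assume i: "i = None" and j: "j = Some b'"
    show ?thesis unfolding ent i j b ns using s0 by (simp add: H_form_def cs power2_eq_square)
  next
    fix a assume i: "i = Some a" and j: "j = None"
    show ?thesis unfolding ent i j b sn using s0 by (simp add: H_form_def cs power2_eq_square)
  next
    fix a b' assume i: "i = Some a" and j: "j = Some b'"
    show ?thesis unfolding ent i j b ss using s0 by (simp add: e_def H_form_def cs power2_eq_square)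
  qed
  then show "boost w \<in> unitary_n1" by (simp add: unitary_n1_def vec_eq_iff)
  show "act (boost w) 0 = w"
    using s0 by (simp add: act_def aut_factor_def block_D_def block_B_def b vec_eq_iff)
qed

text \<open>Translating \<open>w\<close> to the origin, where \<open>rho\<close> is just
  \<open>gap\<close>, makes the bound \<open>rho \<le> 1\<close> and its equality case
  immediate.\<close>

lemma rho_boost:
  assumes "norm z < 1" "norm w < 1"
  shows "rho z w = gap (act (u_inv (boost w)) z)"
proof -
  note b = boost[OF assms(2)]
  have "rho z w = rho (act (boost w) (act (u_inv (boost w)) z)) (act (boost w) 0)"
    using act_u_inv[OF b(1) assms(1)] b(2) by simp
  also have "\<dots> = rho (act (u_inv (boost w)) z) 0"
    by (rule rho_act[OF b(1) act_ball[OF u_inv(3)[OF b(1)] assms(1)]]) simp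
  finally show ?thesis by (simp add: rho_0)
qed

lemma rho_le_1: "norm z < 1 \<Longrightarrow> norm w < 1 \<Longrightarrow> rho z w \<le> 1"
  by (subst rho_boost) auto

lemma rho_eq_1:
  assumes "norm z < 1" "norm w < 1" "rho z w = 1" shows "z = w"
proof -
  have "act (u_inv (boost w)) z = 0" using assms(3) unfolding rho_boost[OF assms(1,2)] by simp
  then show ?thesis using act_u_inv(2)[OF boost(1)[OF assms(2)] assms(1)] boost(2)[OF assms(2)] by metis
qed

lemma rho_self: assumes "norm z < 1" shows "rho z z = 1"
proof -
  have "act (u_inv (boost z)) z = 0"
    using boost(2)[OF assms] act_u_inv(1)[OF boost(1)[OF assms], of 0] by (metis norm_zero zero_less_one)
  then show ?thesis unfolding rho_boost[OF assms assms] by simp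
qed

subsection \<open>Linear maps preserving a quadratic form preserve Lebesgue measure\<close>

text \<open>Coordinates in an orthonormal basis carry boxes to boxes with the same side lengths.
  This transports determinant arguments from \<open>real ^ 'm\<close> to an arbitrary Euclidean
  space.\<close>

lemma lborel_coordinates:
  fixes b :: "'m::finite \<Rightarrow> 'a::euclidean_space"
  assumes b: "bij_betw b UNIV Basis"
    and T_def: "T = (\<lambda>x. \<chi> i. x \<bullet> b i)"
    and T'_def: "T' = (\<lambda>y :: real ^ 'm. \<Sum>i\<in>UNIV. y $ i *\<^sub>R b i)"
  shows "linear T" "linear T'" "\<And>x. T' (T x) = x" "\<And>y. T (T' y) = y" "\<And>x y. T x \<bullet> T y = x \<bullet> y"
    "distr lborel borel T = lborel" "distr lborel borel T' = lborel"
proof -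
  have bB: "b i \<in> Basis" for i using b by (auto simp: bij_betw_def)
  have Bb: "(Basis :: 'a set) = range b" using b by (simp add: bij_betw_def)
  have bi: "b i = b j \<longleftrightarrow> i = j" for i j using b by (auto simp: bij_betw_def inj_def)
  show lT: "linear T" unfolding T_def by (rule linearI) (simp_all add: vec_eq_iff inner_add_left)
  show lT': "linear T'" unfolding T'_def
    by (rule linearI) (simp_all add: algebra_simps sum.distrib scaleR_sum_right)
  have rep: "(\<Sum>i\<in>UNIV. f (b i)) = (\<Sum>v\<in>Basis. f v)" for f :: "'a \<Rightarrow> 'c::comm_monoid_add"
    using sum.reindex_bij_betw[OF b, of f] by simp
  show T'T: "T' (T x) = x" for x
    using rep[of "\<lambda>v. (x \<bullet> v) *\<^sub>R v"] by (simp add: T_def T'_def euclidean_representation)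
  show TT': "T (T' y) = y" for y
  proof -
    have "(\<Sum>i\<in>UNIV. y $ i *\<^sub>R b i) \<bullet> b j = y $ j" for j
    proof -
      have "(\<Sum>i\<in>UNIV. y $ i *\<^sub>R b i) \<bullet> b j = (\<Sum>i\<in>UNIV. if i = j then y $ j else 0)"
        unfolding inner_sum_left by (rule sum.cong) (auto simp: inner_Basis[OF bB bB] bi)
      then show ?thesis by simp
    qed
    then show ?thesis by (simp add: T_def T'_def vec_eq_iff)
  qed
  show inn: "T x \<bullet> T y = x \<bullet> y" for x y
    using rep[of "\<lambda>v. (x \<bullet> v) * (y \<bullet> v)"] by (simp add: T_def inner_vec_def euclidean_inner[of x y])
  have mT: "T \<in> borel_measurable borel" and mT': "T' \<in> borel_measurable borel"
    using lT lT' by (auto intro!: borel_measurable_continuous_onI linear_continuous_on simp: linear_conv_bounded_linear)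
  show d: "distr lborel borel T = lborel"
  proof (rule lborel_eqI[symmetric])
    fix l u :: "real ^ 'm::_" assume lu: "\<And>c. c \<in> Basis \<Longrightarrow> l \<bullet> c \<le> u \<bullet> c"
    have lu': "l $ i \<le> u $ i" for i using lu[of "axis i 1"] by (simp add: inner_axis axis_in_Basis_iff)
    have T'b: "T' y \<bullet> b i = y $ i" for y i using arg_cong[OF TT'[of y], of "\<lambda>v. v $ i"] by (simp add: T_def)
    have "T -` box l u = box (T' l) (T' u)"
    proof (intro Set.set_eqI)
      fix x
      have "x \<in> T -` box l u \<longleftrightarrow> (\<forall>i. l $ i < x \<bullet> b i \<and> x \<bullet> b i < u $ i)"
        by (simp add: T_def mem_box_cart)
      also have "\<dots> \<longleftrightarrow> x \<in> box (T' l) (T' u)"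
        unfolding mem_box Bb by (simp add: T'b)
      finally show "x \<in> T -` box l u \<longleftrightarrow> x \<in> box (T' l) (T' u)" .
    qed
    then have "emeasure (distr lborel borel T) (box l u) = emeasure lborel (box (T' l) (T' u))"
      using mT by (simp add: emeasure_distr)
    also have "\<dots> = (\<Prod>v\<in>Basis. (T' u - T' l) \<bullet> v)"
      using lu' by (intro emeasure_lborel_box) (auto simp: Bb T'b)
    also have "(\<Prod>v\<in>Basis. (T' u - T' l) \<bullet> v) = (\<Prod>i\<in>UNIV. (u - l) $ i)"
      using prod.reindex_bij_betw[OF b, of "\<lambda>v. (T' u - T' l) \<bullet> v"] by (simp add: inner_diff_left T'b)
    also have "\<dots> = (\<Prod>c\<in>Basis. (u - l) \<bullet> c)"
    proof -
      have Bv: "(Basis :: (real^'m) set) = (\<lambda>i. axis i 1) ` UNIV" by (auto simp: Basis_vec_def)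
      have "inj (\<lambda>i::'m. axis i (1::real))" by (simp add: inj_def axis_eq_axis)
      then show ?thesis unfolding Bv by (simp add: prod.reindex inner_axis)
    qed
    finally show "emeasure (distr lborel borel T) (box l u) = (\<Prod>c\<in>Basis. (u - l) \<bullet> c)" .
  qed simp
  have "distr lborel borel T' = distr (distr lborel borel T) borel T'" by (simp add: d)
  also have "\<dots> = distr lborel borel (T' \<circ> T)" using mT mT' by (intro distr_distr) auto
  also have "\<dots> = distr lborel lborel id" by (intro distr_cong) (auto simp: T'T)
  finally show "distr lborel borel T' = lborel" by (simp add: id_def distr_id)
qed

text \<open>The preimage of a box is its image under the inverse map, whose determinant also has
  modulus 1.\<close>

lemma lborel_linear_cart:
  fixes M :: "real ^ 'm::{finite,wellorder} \<Rightarrow> real ^ 'm::_"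
  assumes "linear M" "\<bar>det (matrix M)\<bar> = 1"
  shows "distr lborel borel M = lborel"
proof (rule lborel_eqI[symmetric])
  let ?A = "matrix M"
  have "invertible ?A" using assms(2) by (auto simp: invertible_det_nz)
  then obtain B where B: "?A ** B = mat 1" "B ** ?A = mat 1" by (auto simp: invertible_def)
  define M' where "M' = (*v) B"
  have MA: "M x = ?A *v x" for x using fun_cong[OF matrix_vector_mul(2)[OF assms(1)]] by simp
  have inv: "M (M' x) = x" "M' (M x) = x" for x
    using B by (simp_all add: M'_def MA matrix_vector_mul_assoc)
  have lM': "linear M'" by (simp add: M'_def)
  have "det ?A * det B = 1" using arg_cong[OF B(1), of det] by (simp add: det_mul)
  then have detB: "\<bar>det (matrix M')\<bar> = 1" using assms(2) unfolding M'_def matrix_of_matrix_vector_mul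
    by (metis abs_mult abs_one mult_1)
  have mM: "M \<in> borel_measurable borel"
    using assms(1) by (auto intro!: borel_measurable_continuous_onI linear_continuous_on simp: linear_conv_bounded_linear)
  fix l u :: "real ^ 'm::_" assume lu: "\<And>c. c \<in> Basis \<Longrightarrow> l \<bullet> c \<le> u \<bullet> c"
  have im: "M -` box l u = M' ` box l u" by (force simp: image_iff inv intro: bexI[of _ "M _"])
  have S: "M -` box l u \<in> sets borel" using measurable_sets[OF mM, of "box l u"] by simp
  have "M' ` box l u \<in> lmeasurable" by (rule measurable_linear_image[OF lM']) simp
  then have fin: "emeasure lebesgue (M' ` box l u) = ennreal (measure lebesgue (M' ` box l u))"
    by (simp add: emeasure_eq_measure2 fmeasurableD2)
  have "emeasure (distr lborel borel M) (box l u) = emeasure lebesgue (M' ` box l u)"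
    using mM S by (simp add: emeasure_distr im[symmetric])
  also have "\<dots> = ennreal (measure lebesgue (box l u))"
    unfolding fin using measure_linear_image[OF lM', of "box l u"] detB by simp
  also have "\<dots> = ennreal (\<Prod>c\<in>Basis. (u - l) \<bullet> c)" using lu by (simp add: measure_lborel_box_eq)
  finally show "emeasure (distr lborel borel M) (box l u) = (\<Prod>c\<in>Basis. (u - l) \<bullet> c)" .
qed simp

text \<open>The change of variables formula for linear maps is available on \<open>real ^ 'm\<close> only, so an index type \<open>'m\<close> of
  cardinality \<open>DIM('a)\<close> has to be supplied; \<open>'n bit0\<close> is one for \<open>complex ^ 'n\<close>.\<close>

lemma lborel_form_preserving:
  fixes L J :: "'a::euclidean_space \<Rightarrow> 'a"
  assumes L: "linear L" and J: "linear J" and JJ: "\<And>x. J (J x) = x"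
    and pres: "\<And>x y. L x \<bullet> J (L y) = x \<bullet> J y" and card: "CARD('m::{finite,wellorder}) = DIM('a)"
  shows "distr lborel borel L = lborel"
proof -
  obtain b :: "'m \<Rightarrow> 'a" where b: "bij_betw b UNIV Basis"
    using card finite_same_card_bij[of "UNIV :: 'm set" "Basis :: 'a set"] by auto
  define T where "T = (\<lambda>x. \<chi> i. x \<bullet> b i)"
  define T' where "T' = (\<lambda>y :: real ^ 'm::_. \<Sum>i\<in>UNIV. y $ i *\<^sub>R b i)"
  note T = lborel_coordinates[OF b T_def T'_def]
  define M where "M = T \<circ> L \<circ> T'"
  define K where "K = T \<circ> J \<circ> T'"
  have lM: "linear M" and lK: "linear K"
    unfolding M_def K_def using T L J by (auto intro!: linear_compose)
  let ?A = "matrix M" and ?K = "matrix K"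
  have AM: "?A *v x = M x" "?K *v x = K x" for x using fun_cong[OF matrix_vector_mul(2)[OF lM]] fun_cong[OF matrix_vector_mul(2)[OF lK]] by auto
  have KK: "?K ** ?K = mat 1"
    unfolding matrix_eq matrix_vector_mul_assoc[symmetric] AM by (simp add: K_def T JJ)
  \<comment> \<open>Preservation of the form x \<bullet> J y, written for the matrices of L and J in
    coordinates.\<close>
  have "transpose ?A ** ?K ** ?A = ?K"
    unfolding matrix_eq
  proof
    fix y
    have "x \<bullet> ((transpose ?A ** ?K ** ?A) *v y) = x \<bullet> (?K *v y)" for x
    proof -
      have "x \<bullet> ((transpose ?A ** ?K ** ?A) *v y) = (?A *v x) \<bullet> (?K *v (?A *v y))"
        unfolding matrix_vector_mul_assoc[symmetric] dot_lmul_matrix[symmetric] vector_transpose_matrix ..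
      also have "\<dots> = T (L (T' x)) \<bullet> T (J (L (T' y)))" unfolding AM by (simp add: M_def K_def T)
      also have "\<dots> = T (T' x) \<bullet> T (J (T' y))" unfolding T(5) pres ..
      also have "\<dots> = x \<bullet> (?K *v y)" unfolding AM by (simp add: K_def T)
      finally show ?thesis .
    qed
    then show "(transpose ?A ** ?K ** ?A) *v y = ?K *v y" using vector_eq_ldot by blast
  qed
  \<comment> \<open>\<open>?K\<close> is an involution, so its determinant is nonzero and cancels;
    this leaves the square of \<open>det ?A\<close> equal to 1.\<close>
  then have "det ?A * det ?K * det ?A = det ?K" by (metis det_mul det_transpose)
  moreover have "det ?K \<noteq> 0" using arg_cong[OF KK, of det] by (auto simp: det_mul)
  ultimately have "det ?A * det ?A = 1" by (simp add: mult_ac)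
  then have "\<bar>det ?A\<bar> = 1" by (metis abs_1 abs_mult_self_eq abs_square_eq_1 power2_eq_square)
  then have dM: "distr lborel borel M = lborel" by (rule lborel_linear_cart[OF lM])
  have m: "T \<in> borel_measurable borel" "T' \<in> borel_measurable borel" "M \<in> borel_measurable borel"
    using T(1,2) lM by (auto intro!: borel_measurable_continuous_onI linear_continuous_on simp: linear_conv_bounded_linear)
  have "distr lborel borel L = distr lborel borel (T' \<circ> (M \<circ> T))"
    by (intro distr_cong) (auto simp: M_def T)
  also have "\<dots> = distr (distr lborel borel (M \<circ> T)) borel T'"
    using m by (subst distr_distr) auto
  also have "distr lborel borel (M \<circ> T) = distr (distr lborel borel T) borel M"
    using m by (subst distr_distr) auto
  finally show ?thesis by (simp add: T dM)
qed

subsection \<open>Invariance of the hyperbolic volume\<close>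

lemma inner_eq_herm: "z \<bullet> w = Re (herm z w)"
  by (simp add: inner_vec_def herm_def inner_complex_def)

lemma linear_mat_vec: "linear (\<lambda>z::complex^'n::finite. A *v z)" for A :: "complex ^ 'n ^ 'm::finite"
proof (rule linearI)
  fix r :: real and z :: "complex^'n"
  show "A *v (r *\<^sub>R z) = r *\<^sub>R (A *v z)"
    unfolding vec_eq_iff matrix_vector_mult_def by (simp add: scaleR_sum_right)
qed (simp add: matrix_vector_right_distrib)

lemma lborel_rotate:
  assumes c: "cmod c = 1"
  shows "distr lborel borel (\<lambda>z::complex^'n::finite. c *s z) = lborel"
proof -
  have lin: "linear (\<lambda>z::complex^'n. c *s z)"
    by (rule linearI) (simp_all add: vec_eq_iff algebra_simps)
  have h: "herm (c *s x) (c *s y) = herm x y" for x y :: "complex^'n"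
  proof -
    have "c * cnj c = 1" using c by (simp add: complex_norm_square[symmetric])
    then have "c * a * cnj (c * b) = a * cnj b" for a b
      by (metis complex_cnj_mult mult.assoc mult.left_commute mult_1)
    then show ?thesis by (simp only: herm_def vector_smult_component)
  qed
  show ?thesis
    by (rule lborel_form_preserving[where 'm="'n bit0", OF lin linear_id]) (simp_all add: inner_eq_herm h)
qed

lemma nn_integral_lborel_scaleR:
  fixes f :: "'a::euclidean_space \<Rightarrow> ennreal"
  assumes [measurable]: "f \<in> borel_measurable borel" and c: "c > 0"
  shows "(\<integral>\<^sup>+z. f z \<partial>lborel) = ennreal (c ^ DIM('a)) * (\<integral>\<^sup>+z. f (c *\<^sub>R z) \<partial>lborel)"
proof -
  have "(\<integral>\<^sup>+z. f z \<partial>lborel) = (\<integral>\<^sup>+z. f z \<partial>density (distr lborel borel (\<lambda>x. 0 + c *\<^sub>R x)) (\<lambda>_. ennreal (\<bar>c\<bar>^DIM('a))))"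
    using lborel_affine[of c "0::'a"] c by auto
  also have "\<dots> = (\<integral>\<^sup>+z. ennreal (\<bar>c\<bar>^DIM('a)) * f z \<partial>distr lborel borel (\<lambda>x. 0 + c *\<^sub>R x))"
    by (subst nn_integral_density) auto
  also have "\<dots> = (\<integral>\<^sup>+z. ennreal (\<bar>c\<bar>^DIM('a)) * f (c *\<^sub>R z) \<partial>lborel)"
    by (subst nn_integral_distr) auto
  also have "\<dots> = ennreal (c^DIM('a)) * (\<integral>\<^sup>+z. f (c *\<^sub>R z) \<partial>lborel)"
    using c by (subst nn_integral_cmult) auto
  finally show ?thesis .
qed

lemma continuous_on_vsmult [continuous_intros]:
  fixes f :: "_ \<Rightarrow> complex" and g :: "_ \<Rightarrow> complex ^ 'n::finite"
  assumes "continuous_on S f" "continuous_on S g"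
  shows "continuous_on S (\<lambda>x. f x *s g x)"
  unfolding vector_scalar_mult_def using assms by (intro continuous_intros)

lemma borel_measurable_vsmult [measurable (raw)]:
  fixes f :: "_ \<Rightarrow> complex" and g :: "_ \<Rightarrow> complex ^ 'n::finite"
  assumes "f \<in> borel_measurable M" "g \<in> borel_measurable M"
  shows "(\<lambda>x. f x *s g x) \<in> borel_measurable M"
  using assms by (rule borel_measurable_continuous_Pair) (intro continuous_intros)

text \<open>Polar decomposition of \<open>t\<close>: the phase preserves Lebesgue measure, and the
  modulus scales it by a power equal to the real dimension 2n.\<close>

lemma nn_integral_lborel_vsmult:
  fixes f :: "complex ^ 'n::finite \<Rightarrow> ennreal"
  assumes [measurable]: "f \<in> borel_measurable borel" and t: "t \<noteq> 0"
  shows "(\<integral>\<^sup>+z. f z \<partial>lborel) = ennreal (cmod t ^ (2 * CARD('n))) * (\<integral>\<^sup>+z. f (t *s z) \<partial>lborel)"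
proof -
  define c where "c = t / of_real (cmod t)"
  have c: "cmod c = 1" "t = of_real (cmod t) * c" using t by (simp_all add: c_def norm_divide)
  have "t *s z = cmod t *\<^sub>R (c *s z)" for z :: "complex^'n"
    by (subst c(2)) (simp add: vec_eq_iff scaleR_conv_of_real[where 'a=complex] mult.assoc)
  then have "(\<integral>\<^sup>+z. f (t *s z) \<partial>lborel) = (\<integral>\<^sup>+z. f (cmod t *\<^sub>R z) \<partial>lborel)"
    using nn_integral_distr[of "\<lambda>z. c *s z" lborel borel "\<lambda>z. f (cmod t *\<^sub>R z)"] lborel_rotate[where 'n='n, OF c(1)] by simp
  then show ?thesis
    using nn_integral_lborel_scaleR[of f "cmod t"] t by (simp add: mult.commute)
qed

text \<open>The linear action on the cone \<open>{(z,t). |z| < |t|}\<close> preserves Lebesgue measure because it preserves a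
  nondegenerate real quadratic form. Integrating over the shell \<open>1 < |t|\<^sup>2 - |z|\<^sup>2 < 2\<close> along the fibres of
  \<open>(z,t) \<mapsto> z/t\<close> turns Lebesgue measure into a multiple of the hyperbolic volume, which is therefore
  invariant; no Jacobian has to be computed.\<close>

definition cone_map :: "'n::finite mat1 \<Rightarrow> (complex ^ 'n) \<times> complex \<Rightarrow> (complex ^ 'n) \<times> complex" where
  "cone_map M = (\<lambda>(z, t). (block_A M *v z + t *s block_B M, (\<Sum>j\<in>UNIV. block_C M $ j * z $ j) + block_D M * t))"

lemma lift_cone_map: "M *v lift (fst x) (snd x) = lift (fst (cone_map M x)) (snd (cone_map M x))"
  by (simp add: cone_map_def mult_lift split: prod.splits)

lemma linear_cone_map: "linear (cone_map M)"
proof (rule linearI)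
  show "cone_map M (x + y) = cone_map M x + cone_map M y" for x y
    by (cases x; cases y) (simp add: cone_map_def vec_eq_iff matrix_vector_right_distrib algebra_simps sum.distrib)
  show "cone_map M (r *\<^sub>R x) = r *\<^sub>R cone_map M x" for r x
    using linear_cmul[OF linear_mat_vec, of "block_A M" r]
    by (cases x) (simp add: cone_map_def vec_eq_iff algebra_simps scaleR_sum_right)
qed

lemma lborel_cone_map:
  assumes "M \<in> unitary_n1"
  shows "distr lborel borel (cone_map M) = lborel"
proof -
  \<comment> \<open>Reversing the sign of the last coordinate turns the Euclidean inner product into
    the real part of \<open>hform\<close>. The index type \<open>'a option bit0\<close> below has
    the cardinality 2(n+1) of the real dimension.\<close>
  define J where "J = (\<lambda>x :: (complex ^ 'a) \<times> complex. (fst x, - snd x))"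
  have J: "linear J" unfolding J_def by (rule linearI) auto
  have hJ: "x \<bullet> J y = Re (hform (lift (fst x) (snd x)) (lift (fst y) (snd y)))" for x y
    by (simp add: J_def hform_lift inner_prod_def inner_eq_herm inner_complex_def)
  show ?thesis
  proof (rule lborel_form_preserving[where 'm="'a option bit0", OF linear_cone_map J])
    show "cone_map M x \<bullet> J (cone_map M y) = x \<bullet> J y" for x y
      unfolding hJ lift_cone_map[symmetric] hform_unitary[OF assms] ..
  qed (simp_all add: J_def)
qed

lemma cone_map_act:
  assumes "t \<noteq> 0"
  shows "inverse (snd (cone_map M (z, t))) *s fst (cone_map M (z, t)) = act M (inverse t *s z)"
proof -
  let ?u = "inverse t *s z"
  have u: "z = t *s ?u" using assms by (simp add: vec_eq_iff)
  have 1: "snd (cone_map M (z, t)) = t * aut_factor M ?u"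
    by (subst u) (simp add: cone_map_def aut_factor_def sum_distrib_left algebra_simps)
  have 2: "fst (cone_map M (z, t)) = t *s (block_A M *v ?u + block_B M)"
    by (subst u) (simp add: cone_map_def vector_scalar_commute algebra_simps vector_add_ldistrib)
  have 3: "inverse (t * aut_factor M ?u) * t = inverse (aut_factor M ?u)" using assms by simp
  show ?thesis by (simp only: 1 2 3 act_def vector_smult_assoc)
qed

lemma cone_map_form:
  assumes "M \<in> unitary_n1"
  shows "(cmod (snd (cone_map M x)))\<^sup>2 - (norm (fst (cone_map M x)))\<^sup>2 = (cmod (snd x))\<^sup>2 - (norm (fst x))\<^sup>2"
proof -
  have *: "hform (lift z t) (lift z t) = complex_of_real ((norm z)\<^sup>2 - (cmod t)\<^sup>2)" for z :: "complex^'a" and t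
    unfolding hform_lift herm_self of_real_diff complex_norm_square ..
  have "complex_of_real ((norm (fst (cone_map M x)))\<^sup>2 - (cmod (snd (cone_map M x)))\<^sup>2)
      = complex_of_real ((norm (fst x))\<^sup>2 - (cmod (snd x))\<^sup>2)"
    using hform_unitary[OF assms, of "lift (fst x) (snd x)" "lift (fst x) (snd x)"]
    unfolding lift_cone_map * .
  then show ?thesis unfolding of_real_eq_iff by linarith
qed

lemma continuous_on_aut_factor: "continuous_on S (aut_factor M)"
  unfolding aut_factor_def by (intro continuous_intros)

lemma continuous_on_mat_vec [continuous_intros]:
  fixes A :: "complex ^ 'n::finite ^ 'm::finite"
  shows "continuous_on S f \<Longrightarrow> continuous_on S (\<lambda>x. A *v f x)"
  unfolding matrix_vector_mult_def by (intro continuous_intros)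

lemma borel_measurable_aut_factor [measurable]: "aut_factor M \<in> borel_measurable borel"
  by (rule borel_measurable_continuous_onI[OF continuous_on_aut_factor])

lemma borel_measurable_act [measurable]: "act M \<in> borel_measurable borel"
proof -
  have [measurable]: "(\<lambda>z. block_A M *v z + block_B M) \<in> borel_measurable borel"
    by (rule borel_measurable_continuous_onI) (intro continuous_intros)
  show ?thesis unfolding act_def by measurable
qed

text \<open>The full cone meets each fibre in infinite mass. Cutting it between two levels of the
  invariant quantity |t|^2 - |z|^2 keeps the invariance and makes the fibre mass finite and
  positive.\<close>

definition cone_shell :: "((complex ^ 'n::finite) \<times> complex) set" where
  "cone_shell = {x. 1 < (cmod (snd x))\<^sup>2 - (norm (fst x))\<^sup>2 \<and> (cmod (snd x))\<^sup>2 - (norm (fst x))\<^sup>2 < 2}"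

lemma sets_cone_shell [measurable]: "cone_shell \<in> sets borel"
  unfolding cone_shell_def
  by (intro borel_open open_Collect_conj open_Collect_less continuous_intros)

lemma borel_measurable_projectivize [measurable]:
  "(\<lambda>x :: (complex ^ 'n::finite) \<times> complex. inverse (snd x) *s fst x) \<in> borel_measurable borel"
proof -
  have [measurable]: "(\<lambda>x :: (complex ^ 'n) \<times> complex. snd x) \<in> borel_measurable borel"
    "(\<lambda>x :: (complex ^ 'n) \<times> complex. fst x) \<in> borel_measurable borel"
    by (auto intro!: borel_measurable_continuous_onI continuous_intros)
  show ?thesis by measurable
qed

lemma sets_unit_ball [measurable]: "unit_ball \<in> sets borel"
  by simp

lemma borel_measurable_ball_weight [measurable]:
  "(\<lambda>z :: complex ^ 'n::finite. ennreal (1 / gap z ^ m)) \<in> borel_measurable borel"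
  by measurable

text \<open>The weighted fibre mass over the origin of the ball. It enters as a common factor to be
  cancelled, so only its being neither 0 nor infinite is established.\<close>

definition shell_const :: "'n::finite itself \<Rightarrow> ennreal" where
  "shell_const _ = (\<integral>\<^sup>+s. indicator {s :: complex. 1 < (cmod s)\<^sup>2 \<and> (cmod s)\<^sup>2 < 2} s * ennreal (cmod s ^ (2 * CARD('n))) \<partial>lborel)"

lemma shell_const: "shell_const TYPE('n::finite) \<noteq> 0" "shell_const TYPE('n) \<noteq> \<infinity>"
proof -
  let ?f = "\<lambda>s::complex. indicator {s. 1 < (cmod s)\<^sup>2 \<and> (cmod s)\<^sup>2 < 2} s * ennreal (cmod s ^ (2 * CARD('n)))"
  have "ennreal 1 * emeasure lborel (ball (6/5 :: complex) (1/10)) = (\<integral>\<^sup>+s. ennreal 1 * indicator (ball (6/5 :: complex) (1/10)) s \<partial>lborel)"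
    by (subst nn_integral_cmult_indicator) auto
  also have "\<dots> \<le> (\<integral>\<^sup>+s. ?f s \<partial>lborel)"
  proof (rule nn_integral_mono)
    fix s :: complex
    show "ennreal 1 * indicator (ball (6/5) (1/10)) s \<le> ?f s"
    proof (cases "s \<in> ball (6/5) (1/10)")
      case True
      then have "cmod (6/5 - s) < 1/10" by (simp add: dist_norm)
      moreover have "cmod (6/5) \<le> cmod (6/5 - s) + cmod s" "cmod s \<le> cmod (6/5 - s) + cmod (6/5)"
        using norm_triangle_ineq[of "6/5 - s" s] norm_triangle_ineq4[of "6/5" "6/5 - s"] by (simp_all add: add.commute)
      ultimately have s: "cmod s > 11/10" "cmod s < 13/10" by simp_all
      have "(cmod s)\<^sup>2 > 1" using s by (simp add: one_less_power)
      moreover have "(cmod s)\<^sup>2 < (13/10)\<^sup>2" by (rule power_strict_mono) (use s in auto)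
      moreover have "ennreal 1 \<le> ennreal (cmod s ^ (2 * CARD('n)))"
        by (rule ennreal_leI, rule one_le_power) (use s in simp)
      ultimately show ?thesis using True by (simp add: power2_eq_square)
    qed simp
  qed
  finally have "emeasure lborel (ball (6/5 :: complex) (1/10)) \<le> shell_const TYPE('n)" by (simp add: shell_const_def)
  moreover have "emeasure lborel (ball (6/5 :: complex) (1/10)) > 0"
    by (simp add: emeasure_lborel_ball_finite emeasure_ball)
  ultimately show "shell_const TYPE('n::finite) \<noteq> 0" by auto
  have "(\<integral>\<^sup>+s. ?f s \<partial>lborel) \<le> (\<integral>\<^sup>+s. ennreal (2 ^ CARD('n)) * indicator (cball (0::complex) 2) s \<partial>lborel)"
  proof (rule nn_integral_mono)
    fix s :: complex
    show "?f s \<le> ennreal (2 ^ CARD('n)) * indicator (cball 0 2) s"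
    proof (cases "(cmod s)\<^sup>2 < 2")
      case True
      then have "(cmod s)\<^sup>2 < 2\<^sup>2" by simp
      then have "cmod s < 2" by (rule power_less_imp_less_base) simp
      moreover have "cmod s ^ (2 * CARD('n)) \<le> 2 ^ CARD('n)"
        unfolding power_mult by (rule power_mono) (use True in auto)
      ultimately show ?thesis by (auto simp: ennreal_leI split: split_indicator)
    qed simp
  qed
  also have "\<dots> = ennreal (2 ^ CARD('n)) * emeasure lborel (cball (0::complex) 2)"
    by (subst nn_integral_cmult_indicator) auto
  also have "\<dots> < \<infinity>" using emeasure_bounded_finite[of "cball (0::complex) 2"] by (simp add: ennreal_mult_less_top)
  finally show "shell_const TYPE('n) \<noteq> \<infinity>" by (simp add: shell_const_def)
qed

abbreviation hyp_density :: "complex ^ 'n::finite \<Rightarrow> ennreal" where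
  "hyp_density z \<equiv> indicator unit_ball z * ennreal (1 / gap z ^ (CARD('n) + 1))"

text \<open>For fixed t, the substitution z = tu produces |t|^(2n). For fixed u, rescaling t by
  \<open>1 / sqrt (gap u)\<close> produces one factor \<open>1 / gap u\<close> from the area element
  of t and n more from |t|^(2n): together exactly the density of the hyperbolic volume.\<close>

lemma cone_integral:
  fixes \<phi> :: "complex ^ 'n::finite \<Rightarrow> ennreal"
  assumes [measurable]: "\<phi> \<in> borel_measurable borel"
  shows "(\<integral>\<^sup>+x. indicator cone_shell x * \<phi> (inverse (snd x) *s fst x) \<partial>lborel)
    = shell_const TYPE('n) * (\<integral>\<^sup>+z. hyp_density z * \<phi> z \<partial>lborel)"
proof -
  let ?n = "CARD('n)"
  let ?S = "{s :: complex. 1 < (cmod s)\<^sup>2 \<and> (cmod s)\<^sup>2 < 2}"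
  have [measurable]: "?S \<in> sets borel" by measurable
  let ?h = "\<lambda>(u::complex^'n) (t::complex). indicator cone_shell (t *s u, t) * ennreal (cmod t ^ (2 * ?n)) :: ennreal"
  have "(\<integral>\<^sup>+x. indicator cone_shell x * \<phi> (inverse (snd x) *s fst x) \<partial>lborel)
     = (\<integral>\<^sup>+t. \<integral>\<^sup>+z. indicator cone_shell (z, t) * \<phi> (inverse t *s z) \<partial>lborel \<partial>lborel)"
    unfolding lborel_prod[symmetric]
    by (subst lborel_pair.nn_integral_snd[symmetric]) (auto simp: lborel_prod)
  also have "\<dots> = (\<integral>\<^sup>+t. \<integral>\<^sup>+u. ?h u t * \<phi> u \<partial>lborel \<partial>lborel)"
  proof (rule nn_integral_cong)
    fix t :: complex
    show "(\<integral>\<^sup>+z. indicator cone_shell (z, t) * \<phi> (inverse t *s z) \<partial>lborel) = (\<integral>\<^sup>+u. ?h u t * \<phi> u \<partial>lborel)"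
    proof (cases "t = 0")
      case True
      have "(z, 0) \<notin> cone_shell" for z :: "complex^'n"
        by (auto simp: cone_shell_def dest: order.strict_trans1[OF zero_le_power2])
      then show ?thesis using True by simp
    next
      case False
      have "(\<integral>\<^sup>+z. indicator cone_shell (z, t) * \<phi> (inverse t *s z) \<partial>lborel)
         = ennreal (cmod t ^ (2 * ?n)) * (\<integral>\<^sup>+u. indicator cone_shell (t *s u, t) * \<phi> (inverse t *s (t *s u)) \<partial>lborel)"
        by (rule nn_integral_lborel_vsmult[OF _ False]) measurable
      also have "\<dots> = (\<integral>\<^sup>+u. ennreal (cmod t ^ (2 * ?n)) * (indicator cone_shell (t *s u, t) * \<phi> (inverse t *s (t *s u))) \<partial>lborel)"
        by (subst nn_integral_cmult) auto
      also have "\<dots> = (\<integral>\<^sup>+u. ?h u t * \<phi> u \<partial>lborel)"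
        using False by (intro nn_integral_cong) (simp add: mult_ac)
      finally show ?thesis .
    qed
  qed
  also have "\<dots> = (\<integral>\<^sup>+u. \<integral>\<^sup>+t. ?h u t * \<phi> u \<partial>lborel \<partial>lborel)"
    by (rule lborel_pair.Fubini') (auto simp: lborel_prod borel_prod[symmetric])
  also have "\<dots> = (\<integral>\<^sup>+u. shell_const TYPE('n) * (indicator unit_ball u * ennreal (1 / gap u ^ (?n + 1)) * \<phi> u) \<partial>lborel)"
  proof (rule nn_integral_cong)
    fix u :: "complex ^ 'n"
    have ns: "(norm (t *s u))\<^sup>2 = (cmod t)\<^sup>2 * (norm u)\<^sup>2" for t
      unfolding cmod_power2_sum by (simp add: sum_distrib_left norm_mult power_mult_distrib)
    have mem: "(t *s u, t) \<in> cone_shell \<longleftrightarrow> 1 < (cmod t)\<^sup>2 * gap u \<and> (cmod t)\<^sup>2 * gap u < 2" for t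
      by (simp add: cone_shell_def ns algebra_simps)
    show "(\<integral>\<^sup>+t. ?h u t * \<phi> u \<partial>lborel) = shell_const TYPE('n) * (indicator unit_ball u * ennreal (1 / gap u ^ (?n + 1)) * \<phi> u)"
    proof (cases "norm u < 1")
      case False
      then have "gap u \<le> 0" by (simp add: one_le_power)
      then have "(cmod t)\<^sup>2 * gap u \<le> 0" for t by (simp add: mult_nonneg_nonpos)
      then have "(t *s u, t) \<notin> cone_shell" for t unfolding mem by (metis not_less order.trans zero_le_one)
      then show ?thesis using False by simp
    next
      case True
      define r where "r = gap u"
      have r: "r > 0" using one_minus_norm_sq_pos[OF True] by (simp add: r_def)
      \<comment> \<open>The fibre over u consists of the t with 1 < |t|^2 r < 2; scaling by c
        carries the annulus over the origin onto it.\<close>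
      define c where "c = 1 / sqrt r"
      have c: "c > 0" "c\<^sup>2 = 1 / r" using r by (simp_all add: c_def power_divide)
      have "(\<integral>\<^sup>+t. ?h u t \<partial>lborel) = ennreal (c ^ DIM(complex)) * (\<integral>\<^sup>+t. ?h u (c *\<^sub>R t) \<partial>lborel)"
        by (rule nn_integral_lborel_scaleR[OF _ c(1)]) measurable
      also have "(\<integral>\<^sup>+t. ?h u (c *\<^sub>R t) \<partial>lborel) = (\<integral>\<^sup>+t. ennreal (c ^ (2 * ?n)) * (indicator ?S t * ennreal (cmod t ^ (2 * ?n))) \<partial>lborel)"
      proof (rule nn_integral_cong)
        fix t :: complex
        have "(cmod (c *\<^sub>R t))\<^sup>2 * r = (cmod t)\<^sup>2" using c r by (simp add: power_mult_distrib)
        then have "(c *\<^sub>R t *s u, c *\<^sub>R t) \<in> cone_shell \<longleftrightarrow> t \<in> ?S" unfolding mem r_def[symmetric] by simp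
        moreover have "ennreal (cmod (c *\<^sub>R t) ^ (2 * ?n)) = ennreal (c ^ (2 * ?n)) * ennreal (cmod t ^ (2 * ?n))"
          using c by (simp add: power_mult_distrib ennreal_mult)
        ultimately show "?h u (c *\<^sub>R t) = ennreal (c ^ (2 * ?n)) * (indicator ?S t * ennreal (cmod t ^ (2 * ?n)))"
          by (simp add: indicator_def)
      qed
      also have "\<dots> = ennreal (c ^ (2 * ?n)) * shell_const TYPE('n)"
        unfolding shell_const_def by (subst nn_integral_cmult) auto
      finally have "(\<integral>\<^sup>+t. ?h u t \<partial>lborel) = ennreal (c ^ 2) * ennreal (c ^ (2 * ?n)) * shell_const TYPE('n)"
        by (simp add: mult.assoc)
      also have "ennreal (c ^ 2) * ennreal (c ^ (2 * ?n)) = ennreal (1 / r ^ (?n + 1))"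
        using c r unfolding power_mult c(2) by (simp add: ennreal_mult[symmetric] power_divide)
      finally have e: "(\<integral>\<^sup>+t. ?h u t \<partial>lborel) = ennreal (1 / r ^ (?n + 1)) * shell_const TYPE('n)" .
      have "(\<integral>\<^sup>+t. ?h u t * \<phi> u \<partial>lborel) = (\<integral>\<^sup>+t. ?h u t \<partial>lborel) * \<phi> u"
        by (rule nn_integral_multc) measurable
      then show ?thesis using True unfolding e r_def by (simp add: mult_ac)
    qed
  qed
  also have "\<dots> = shell_const TYPE('n) * (\<integral>\<^sup>+z. indicator unit_ball z * ennreal (1 / gap z ^ (?n + 1)) * \<phi> z \<partial>lborel)"
    by (subst nn_integral_cmult) auto
  finally show ?thesis .
qed

text \<open>After multiplication by \<open>shell_const\<close>, the two sides become integrals over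
  the cone shell that differ by the measure-preserving substitution
  \<open>cone_map M\<close>.\<close>

lemma nn_integral_ball_act:
  fixes \<phi> :: "complex ^ 'n::finite \<Rightarrow> ennreal"
  assumes [measurable]: "\<phi> \<in> borel_measurable borel" and M: "M \<in> unitary_n1"
  shows "(\<integral>\<^sup>+z. hyp_density z * \<phi> (act M z) \<partial>lborel)
    = (\<integral>\<^sup>+z. hyp_density z * \<phi> z \<partial>lborel)"
    (is "?l = ?r")
proof -
  let ?G = "\<lambda>x. indicator cone_shell x * \<phi> (inverse (snd x) *s fst x)"
  have [measurable]: "cone_map M \<in> borel_measurable borel"
    using linear_cone_map[of M] by (auto intro!: borel_measurable_continuous_onI linear_continuous_on simp: linear_conv_bounded_linear)
  have [measurable]: "?G \<in> borel_measurable borel" by measurable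
  have "shell_const TYPE('n) * ?l = (\<integral>\<^sup>+x. indicator cone_shell x * \<phi> (act M (inverse (snd x) *s fst x)) \<partial>lborel)"
    by (rule cone_integral[symmetric]) measurable
  also have "\<dots> = (\<integral>\<^sup>+x. ?G (cone_map M x) \<partial>lborel)"
  proof (rule nn_integral_cong)
    fix x :: "(complex ^ 'n) \<times> complex"
    have "cone_map M x \<in> cone_shell \<longleftrightarrow> x \<in> cone_shell" unfolding cone_shell_def mem_Collect_eq cone_map_form[OF M] ..
    moreover have "snd x \<noteq> 0" if "x \<in> cone_shell"
    proof -
      have "(cmod (snd x))\<^sup>2 > 1"
        using that zero_le_power2[of "norm (fst x)"] unfolding cone_shell_def mem_Collect_eq by linarith
      then show ?thesis by auto
    qed
    ultimately show "indicator cone_shell x * \<phi> (act M (inverse (snd x) *s fst x)) = ?G (cone_map M x)"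
      using cone_map_act[of "snd x" M "fst x"] by (auto split: split_indicator)
  qed
  also have "\<dots> = (\<integral>\<^sup>+x. ?G x \<partial>distr lborel borel (cone_map M))" by (rule nn_integral_distr[symmetric]) simp_all
  also have "\<dots> = (\<integral>\<^sup>+x. ?G x \<partial>lborel)" by (simp add: lborel_cone_map[OF M])
  also have "\<dots> = shell_const TYPE('n) * ?r" by (rule cone_integral) measurable
  finally show ?thesis using shell_const[where 'n='n] by (simp add: ennreal_mult_cancel_left)
qed

section \<open>The hyperbolic volume as an invariant measure\<close>

lemma nn_integral_hyp_vol:
  fixes \<phi> :: "complex ^ 'n::finite \<Rightarrow> ennreal"
  assumes [measurable]: "\<phi> \<in> borel_measurable borel"
  shows "(\<integral>\<^sup>+z. \<phi> z \<partial>hyp_vol) = ennreal (4 ^ CARD('n)) *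
    (\<integral>\<^sup>+z. hyp_density z * \<phi> z \<partial>lborel)"
proof -
  have d: "ennreal (indicator unit_ball z * Re (det (hyp_metric z)))
     = ennreal (4 ^ CARD('n)) * (indicator unit_ball z * ennreal (1 / gap z ^ (CARD('n) + 1)))" for z :: "complex^'n"
  proof (cases "norm z < 1")
    case True
    then show ?thesis using one_minus_norm_sq_pos[OF True]
      by (simp only: det_hyp_metric[OF True] Re_complex_of_real) (simp add: ennreal_mult[symmetric])
  qed simp
  have [measurable]: "(\<lambda>z::complex^'n. ennreal (indicator unit_ball z * Re (det (hyp_metric z)))) \<in> borel_measurable lborel"
    unfolding d measurable_lborel1 by measurable
  show ?thesis unfolding hyp_vol_def
    by (subst nn_integral_density) (auto simp: d mult.assoc nn_integral_cmult)
qed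

lemma sets_hyp_vol [simp, measurable_cong]: "sets hyp_vol = sets borel"
  by (simp add: hyp_vol_def)

lemma space_hyp_vol [simp]: "space hyp_vol = UNIV"
  by (simp add: hyp_vol_def)

lemma nn_integral_hyp_vol_act:
  fixes \<phi> :: "complex ^ 'n::finite \<Rightarrow> ennreal"
  assumes [measurable]: "\<phi> \<in> borel_measurable borel" and M: "M \<in> unitary_n1"
  shows "(\<integral>\<^sup>+z. \<phi> (act M z) \<partial>hyp_vol) = (\<integral>\<^sup>+z. \<phi> z \<partial>hyp_vol)"
  unfolding nn_integral_hyp_vol[OF assms(1)] using nn_integral_ball_act[OF assms]
  by (subst nn_integral_hyp_vol) auto

lemma distr_hyp_vol_act:
  assumes M: "M \<in> unitary_n1"
  shows "distr hyp_vol borel (act M) = hyp_vol"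
proof (rule measure_eqI)
  fix A assume "A \<in> sets (distr hyp_vol borel (act M))"
  then have A[measurable]: "A \<in> sets borel" by simp
  have "emeasure (distr hyp_vol borel (act M)) A = (\<integral>\<^sup>+z. indicator A z \<partial>distr hyp_vol borel (act M))" by simp
  also have "\<dots> = (\<integral>\<^sup>+z. indicator A (act M z) \<partial>hyp_vol)" by (rule nn_integral_distr) measurable
  also have "\<dots> = (\<integral>\<^sup>+z. indicator A z \<partial>hyp_vol)" by (rule nn_integral_hyp_vol_act[OF _ M]) measurable
  also have "\<dots> = emeasure hyp_vol A" by simp
  finally show "emeasure (distr hyp_vol borel (act M)) A = emeasure hyp_vol A" .
qed simp

subsection \<open>Bounds on matrix entries and distances\<close>

lemma unitary_col_form:
  assumes "M \<in> unitary_n1"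
  shows "(\<Sum>k\<in>UNIV. (cmod (M $ Some k $ i))\<^sup>2) - (cmod (M $ None $ i))\<^sup>2 = (if i = None then -1 else 1)"
proof -
  have "complex_of_real ((\<Sum>k\<in>UNIV. (cmod (M $ Some k $ i))\<^sup>2) - (cmod (M $ None $ i))\<^sup>2)
     = (\<Sum>k\<in>UNIV. cnj (M $ k $ i) * (H_form ** M) $ k $ i)"
    by (simp only: H_form_mult sum_option of_real_diff of_real_sum complex_norm_square) (simp add: mult.commute)
  also have "\<dots> = (conj_transpose M ** (H_form ** M)) $ i $ i"
    by (subst (2) matrix_matrix_mult_def) (simp add: conj_transpose_def)
  also have "\<dots> = H_form $ i $ i"
    using assms by (simp add: unitary_n1_def matrix_mul_assoc)
  also have "\<dots> = complex_of_real (if i = None then -1 else 1)" by (simp add: H_form_def)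
  finally show ?thesis using of_real_eq_iff by blast
qed

lemma u_inv_nth: "u_inv M $ i $ j = (if i = None then -1 else 1) * (if j = None then -1 else 1) * cnj (M $ j $ i)"
proof -
  have "(A ** H_form) $ i $ j = A $ i $ j * (if j = None then -1 else 1)" for A :: "'a mat1"
  proof -
    have "(A ** H_form) $ i $ j = (\<Sum>k\<in>UNIV. if k = j then A $ i $ j * (if j = None then -1 else 1) else 0)"
      unfolding matrix_matrix_mult_def H_form_def vec_lambda_beta by (rule sum.cong) auto
    then show ?thesis by simp
  qed
  then show ?thesis by (simp add: u_inv_def H_form_mult conj_transpose_def)
qed

lemma u_inv_u_inv: "u_inv (u_inv M) = M"
  by (simp add: vec_eq_iff u_inv_nth)

text \<open>The column relation for the inverse matrix is a row relation for
  \<open>M\<close>.\<close>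

lemma unitary_C_norm:
  assumes "M \<in> unitary_n1"
  shows "(norm (block_C M))\<^sup>2 = (cmod (block_D M))\<^sup>2 - 1"
  using unitary_col_form[OF u_inv(3)[OF assms], of None]
  by (simp add: u_inv_nth cmod_power2_sum block_C_def block_D_def)

text \<open>The row relation bounds the last row by |D|, and the column relations bound the other
  entries by the last row. So the single number |D|, which equals cosh(d(0, M0)/2) for the
  hyperbolic distance d, controls the whole matrix.\<close>

lemma unitary_entry_le:
  assumes "M \<in> unitary_n1"
  shows "cmod (M $ i $ j) \<le> cmod (block_D M)"
proof -
  have C: "(cmod (M $ None $ Some b))\<^sup>2 \<le> (cmod (block_D M))\<^sup>2 - 1" for b
    unfolding unitary_C_norm[OF assms, symmetric] cmod_power2_sum
    using member_le_sum[of b UNIV "\<lambda>i. (cmod (block_C M $ i))\<^sup>2"] by (simp add: block_C_def)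
  have mem: "(cmod (M $ Some a $ j))\<^sup>2 \<le> (\<Sum>k\<in>UNIV. (cmod (M $ Some k $ j))\<^sup>2)" for a
    using member_le_sum[of a UNIV "\<lambda>k. (cmod (M $ Some k $ j))\<^sup>2"] by simp
  have "(cmod (M $ i $ j))\<^sup>2 \<le> (cmod (block_D M))\<^sup>2"
  proof (cases i)
    case None
    show ?thesis
    proof (cases j)
      case (Some b)
      show ?thesis unfolding None Some using C[of b] by linarith
    qed (simp add: None block_D_def)
  next
    case (Some a)
    show ?thesis
    proof (cases j)
      case None
      have "(\<Sum>k\<in>UNIV. (cmod (M $ Some k $ j))\<^sup>2) - (cmod (block_D M))\<^sup>2 = -1"
        using unitary_col_form[OF assms, of None] by (simp add: None block_D_def)
      then show ?thesis using mem[of a] unfolding Some by linarith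
    next
      case (Some b)
      have "(\<Sum>k\<in>UNIV. (cmod (M $ Some k $ j))\<^sup>2) - (cmod (M $ None $ Some b))\<^sup>2 = 1"
        using unitary_col_form[OF assms, of j] by (simp add: Some)
      then show ?thesis using mem[of a] C[of b] unfolding \<open>i = Some a\<close> by linarith
    qed
  qed
  then show ?thesis by (rule power2_le_imp_le) simp
qed

text \<open>Since |C| \<le> |D|, the triangle inequality gives |Cz + D| \<ge> |D|(1 - |z|). A bound
  on the automorphy factor at one interior point thereby bounds all matrix entries.\<close>

lemma block_D_le_aut_factor:
  assumes "M \<in> unitary_n1" "norm z \<le> 1"
  shows "cmod (block_D M) * (1 - norm z) \<le> cmod (aut_factor M z)"
proof -
  have "norm (block_C M) \<le> cmod (block_D M)"
    by (rule power2_le_imp_le) (use unitary_C_norm[OF assms(1)] in auto)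
  then have "norm (block_C M) * norm z \<le> cmod (block_D M) * norm z" by (simp add: mult_right_mono)
  moreover have "cmod (\<Sum>j\<in>UNIV. block_C M $ j * z $ j) \<le> norm (block_C M) * norm z"
  proof -
    have "cmod (\<Sum>j\<in>UNIV. block_C M $ j * z $ j) \<le> (\<Sum>i\<in>UNIV. \<bar>cmod (block_C M $ i)\<bar> * \<bar>cmod (z $ i)\<bar>)"
      by (rule sum_norm_le) (simp add: norm_mult)
    also have "\<dots> \<le> norm (block_C M) * norm z" unfolding norm_vec_def by (rule L2_set_mult_ineq)
    finally show ?thesis .
  qed
  moreover have "cmod (block_D M) \<le> cmod (aut_factor M z) + cmod (\<Sum>j\<in>UNIV. block_C M $ j * z $ j)"
    using norm_triangle_ineq4[of "aut_factor M z" "\<Sum>j\<in>UNIV. block_C M $ j * z $ j"] by (simp add: aut_factor_def)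
  ultimately show ?thesis by (simp add: algebra_simps)
qed

section \<open>Continuity of \<open>rho\<close> and comparison inequalities\<close>

lemma continuous_on_act: "M \<in> unitary_n1 \<Longrightarrow> continuous_on unit_ball (act M)"
  unfolding act_def
  by (intro continuous_intros continuous_on_aut_factor) (auto simp: aut_factor_nz)

lemma continuous_on_rho:
  assumes "continuous_on S f" "continuous_on S g" "\<And>x. x \<in> S \<Longrightarrow> norm (f x) < 1" "\<And>x. x \<in> S \<Longrightarrow> norm (g x) < 1"
  shows "continuous_on S (\<lambda>x. rho (f x) (g x))"
  unfolding rho_def
proof (intro continuous_intros assms)
  show "continuous_on S (\<lambda>x. Q_ker (f x) (g x))"
    unfolding Q_ker_def herm_def by (intro continuous_intros assms)
  show "\<forall>x\<in>S. (cmod (Q_ker (f x) (g x)))\<^sup>2 \<noteq> 0" using Q_ker_nz assms(3,4) by auto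
qed

lemma continuous_on_Q_ker: "continuous_on S (\<lambda>x. Q_ker x w)"
  unfolding Q_ker_def herm_def by (intro continuous_intros)

lemma borel_measurable_Q_ker [measurable]: "(\<lambda>x. Q_ker x w) \<in> borel_measurable borel"
  by (rule borel_measurable_continuous_onI[OF continuous_on_Q_ker])

lemma borel_measurable_rho [measurable]: "(\<lambda>x. rho x w) \<in> borel_measurable borel"
  unfolding rho_def by measurable

text \<open>The hyperbolic triangle inequality through \<open>u\<close>, in terms of
  \<open>rho\<close>: if d = 1/cosh(r/2)^2 then cosh r = 2 cosh(r/2)^2 - 1 = (2-d)/d, so points
  within distance r of \<open>u\<close> are at most 2r apart. In the proof \<open>u\<close> is moved
  to the origin.\<close>

lemma rho_quasi_triangle:
  assumes "norm u < 1" "norm a < 1" "norm b < 1" "rho a u > d" "rho b u > d" "d > 0"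
  shows "rho a b \<ge> (d / (2 - d))\<^sup>2"
proof -
  define N where "N = u_inv (boost u)"
  have N: "N \<in> unitary_n1" using boost(1)[OF assms(1)] u_inv(3) by (auto simp: N_def)
  define a' b' where "a' = act N a" and "b' = act N b"
  have n: "norm a' < 1" "norm b' < 1" using act_ball[OF N] assms by (auto simp: a'_def b'_def)
  have da: "gap a' > d" "gap b' > d"
    using assms(4,5) unfolding rho_boost[OF assms(2,1)] rho_boost[OF assms(3,1)] by (auto simp: a'_def b'_def N_def)
  have "2 * (norm a' * norm b') \<le> (norm a')\<^sup>2 + (norm b')\<^sup>2"
    using sum_squares_bound[of "norm a'" "norm b'"] by simp
  then have "norm a' * norm b' \<le> 1 - d" using da by linarith
  then have Q: "cmod (Q_ker a' b') \<le> 2 - d" using Q_ker_norm_le[of a' b'] by linarith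
  have Qp: "cmod (Q_ker a' b') > 0" using Q_ker_nz[OF n] by simp
  have "(d / (2 - d))\<^sup>2 = d * d / (2 - d)\<^sup>2" by (simp add: power2_eq_square)
  also have "\<dots> \<le> gap a' * gap b' / (cmod (Q_ker a' b'))\<^sup>2"
    using da assms(6) Q Qp by (intro frac_le mult_mono power_mono mult_nonneg_nonneg) auto
  also have "\<dots> = rho a b" unfolding rho_def[symmetric] a'_def b'_def by (rule rho_act[OF N assms(2,3)])
  finally show ?thesis .
qed

text \<open>A Harnack-type inequality: moving a point by a bounded hyperbolic distance changes
  \<open>rho _ w\<close> by at most a constant factor, uniformly in \<open>w\<close>. With
  \<open>z\<close> at the origin the 4 is the square of the trivial bound 2 for
  \<open>Q_ker\<close>.\<close>

lemma rho_compare: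
  assumes "norm u < 1" "norm z < 1" "norm w < 1" "rho u z > d" "d > 0"
  shows "rho u w \<ge> d / 4 * rho z w"
proof -
  define N where "N = u_inv (boost z)"
  have N: "N \<in> unitary_n1" using boost(1)[OF assms(2)] u_inv(3) by (auto simp: N_def)
  define u' w' where "u' = act N u" and "w' = act N w"
  have n: "norm u' < 1" "norm w' < 1" using act_ball[OF N] assms by (auto simp: u'_def w'_def)
  have z0: "act N z = 0"
    using boost(2)[OF assms(2)] act_u_inv(1)[OF boost(1)[OF assms(2)], of 0] unfolding N_def by (metis norm_zero zero_less_one)
  have du: "gap u' > d" using assms(4) unfolding rho_boost[OF assms(1,2)] by (simp add: u'_def N_def)
  have Q: "cmod (Q_ker u' w') \<le> 2" using Q_ker_norm_le[of u' w'] norm_prod_less_1[OF n] by linarith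
  have Qp: "cmod (Q_ker u' w') > 0" using Q_ker_nz[OF n] by simp
  have "d / 4 * rho z w = d / 2\<^sup>2 * rho 0 w'" using rho_act[OF N assms(2,3)] by (simp add: z0 w'_def)
  also have "\<dots> = d * gap w' / 2\<^sup>2" by (simp add: rho_0)
  also have "\<dots> \<le> gap u' * gap w' / (cmod (Q_ker u' w'))\<^sup>2"
    using du assms(5) Q Qp one_minus_norm_sq_pos[OF n(2)]
    by (intro frac_le mult_mono power_mono mult_nonneg_nonneg) auto
  also have "\<dots> = rho u w" unfolding rho_def[symmetric] u'_def w'_def by (rule rho_act[OF N assms(1,3)])
  finally show ?thesis .
qed

section \<open>Integrals of \<open>rho\<close> and volumes of hyperbolic balls\<close>

lemma AE_hyp_vol_ball: "AE z in hyp_vol. norm z < 1"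
proof -
  have "emeasure hyp_vol (- unit_ball :: (complex^'a) set) = (\<integral>\<^sup>+z. indicator (- unit_ball :: (complex^'a) set) z \<partial>hyp_vol)"
    by simp
  also have "\<dots> = 0" by (subst nn_integral_hyp_vol) (auto simp: nn_integral_0_iff_AE split: split_indicator)
  finally show ?thesis by (intro AE_I[of _ _ "- unit_ball"]) auto
qed

lemma nn_integral_rho:
  fixes w :: "complex ^ 'n::finite"
  assumes "norm w < 1"
  shows "(\<integral>\<^sup>+u. ennreal (rho u w ^ m) \<partial>hyp_vol) = (\<integral>\<^sup>+u. ennreal (gap (u :: complex ^ 'n) ^ m) \<partial>hyp_vol)"
proof -
  note b = boost[OF assms]
  have "(\<integral>\<^sup>+u. ennreal (rho u w ^ m) \<partial>hyp_vol) = (\<integral>\<^sup>+v. ennreal (rho (act (boost w) v) w ^ m) \<partial>hyp_vol)"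
    by (rule nn_integral_hyp_vol_act[OF _ b(1), symmetric]) measurable
  also have "\<dots> = (\<integral>\<^sup>+u. ennreal (gap (u :: complex ^ 'n) ^ m) \<partial>hyp_vol)"
  proof (rule nn_integral_cong_AE, use AE_hyp_vol_ball in eventually_elim)
    fix v :: "complex ^ 'n" assume v: "norm v < 1"
    have "rho (act (boost w) v) (act (boost w) 0) = rho v 0" by (rule rho_act[OF b(1) v]) simp
    then show "ennreal (rho (act (boost w) v) w ^ m) = ennreal (gap v ^ m)"
      by (simp add: b(2) rho_0)
  qed
  finally show ?thesis .
qed

text \<open>At exponent n+1 the weight cancels the density of the hyperbolic volume and the
  integrand becomes bounded on the ball. This is the origin of the power n+1 in the lattice
  sums.\<close>

lemma nn_integral_weight_finite:
  assumes "m \<ge> CARD('n) + 1"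
  shows "(\<integral>\<^sup>+u. ennreal (gap (u :: complex ^ 'n::finite) ^ m) \<partial>hyp_vol) < \<infinity>"
proof -
  have "(\<integral>\<^sup>+z. indicator unit_ball z * ennreal (1 / gap (z :: complex ^ 'n) ^ (CARD('n) + 1)) * ennreal (gap z ^ m) \<partial>lborel)
     \<le> (\<integral>\<^sup>+z. indicator (unit_ball :: (complex ^ 'n) set) z \<partial>lborel)"
  proof (rule nn_integral_mono)
    fix z :: "complex ^ 'n"
    show "hyp_density z * ennreal (gap z ^ m) \<le> indicator unit_ball z"
    proof (cases "norm z < 1")
      case True
      define r where "r = gap z"
      have r: "0 < r" "r \<le> 1" using one_minus_norm_sq_pos[OF True] by (auto simp: r_def)
      have "r ^ m \<le> r ^ (CARD('n) + 1)" using r assms by (intro power_decreasing) auto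
      then have "1 / r ^ (CARD('n) + 1) * r ^ m \<le> 1" using r by (simp add: divide_le_eq)
      then have "ennreal (1 / r ^ (CARD('n) + 1)) * ennreal (r ^ m) \<le> 1"
        using r by (simp add: ennreal_mult[symmetric] ennreal_le_1 del: power_Suc)
      then show ?thesis using True by (simp add: r_def)
    qed simp
  qed
  also have "\<dots> = emeasure lborel (unit_ball :: (complex ^ 'n) set)" by simp
  also have "\<dots> < \<infinity>" using emeasure_bounded_finite[of "unit_ball :: (complex ^ 'n) set"] by simp
  finally show ?thesis by (subst nn_integral_hyp_vol) (auto simp: ennreal_mult_less_top)
qed

text \<open>A hyperbolic ball around \<open>z\<close>, since \<open>rho\<close> decreases with the
  distance; a larger \<open>d\<close> means a smaller ball.\<close>

definition rho_nbhd :: "real \<Rightarrow> complex ^ 'n \<Rightarrow> (complex ^ 'n::finite) set" where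
  "rho_nbhd d z = {u \<in> unit_ball. rho u z > d}"

lemma sets_rho_nbhd [measurable]: "rho_nbhd d z \<in> sets borel"
proof -
  have "rho_nbhd d z = unit_ball \<inter> {u. rho u z > d}" by (auto simp: rho_nbhd_def)
  also have "\<dots> \<in> sets borel" by measurable
  finally show ?thesis .
qed

lemma emeasure_rho_nbhd:
  fixes z :: "complex ^ 'n::finite"
  assumes "norm z < 1"
  shows "emeasure hyp_vol (rho_nbhd d z) = emeasure hyp_vol (rho_nbhd d (0 :: complex ^ 'n::finite))"
proof -
  note b = boost[OF assms]
  have "emeasure hyp_vol (rho_nbhd d z) = (\<integral>\<^sup>+u. indicator (rho_nbhd d z) u \<partial>hyp_vol)" by simp
  also have "\<dots> = (\<integral>\<^sup>+u. indicator (rho_nbhd d z) (act (boost z) u) \<partial>hyp_vol)"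
    by (rule nn_integral_hyp_vol_act[OF _ b(1), symmetric]) measurable
  also have "\<dots> = (\<integral>\<^sup>+u. indicator (rho_nbhd d (0 :: complex ^ 'n)) u \<partial>hyp_vol)"
  proof (rule nn_integral_cong_AE, use AE_hyp_vol_ball in eventually_elim)
    fix v :: "complex ^ 'n" assume v: "norm v < 1"
    have "rho (act (boost z) v) (act (boost z) 0) = rho v 0" by (rule rho_act[OF b(1) v]) simp
    then show "indicator (rho_nbhd d z) (act (boost z) v) = (indicator (rho_nbhd d 0) v :: ennreal)"
      using v act_ball[OF b(1) v] by (simp add: b(2) rho_nbhd_def indicator_def)
  qed
  finally show ?thesis by simp
qed

lemma emeasure_rho_nbhd_0:
  assumes "0 < d" "d < 1"
  shows "emeasure hyp_vol (rho_nbhd d (0 :: complex ^ 'n::finite)) > 0" "emeasure hyp_vol (rho_nbhd d (0 :: complex ^ 'n)) < \<infinity>"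
proof -
  let ?V = "rho_nbhd d (0 :: complex ^ 'n)" and ?m = "CARD('n) + 1"
  have V: "?V = ball 0 (sqrt (1 - d))"
  proof (intro Set.set_eqI)
    fix u :: "complex ^ 'n"
    have "norm u < sqrt (1 - d) \<longleftrightarrow> (norm u)\<^sup>2 < 1 - d"
      using real_less_lsqrt[of "norm u"] assms by (metis abs_norm_cancel real_sqrt_abs real_sqrt_less_iff)
    moreover have "(norm u)\<^sup>2 < 1 - d \<Longrightarrow> norm u < 1"
      using assms abs_square_less_1[of "norm u"] by simp
    ultimately show "u \<in> ?V \<longleftrightarrow> u \<in> ball 0 (sqrt (1 - d))"
      by (auto simp: rho_nbhd_def rho_0)
  qed
  have "0 < emeasure lborel ?V" unfolding V using assms by (simp add: emeasure_ball)
  also have "emeasure lborel ?V = (\<integral>\<^sup>+z. indicator ?V z \<partial>lborel)" by simp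
  also have "\<dots> \<le> (\<integral>\<^sup>+z. indicator unit_ball z * ennreal (1 / gap z ^ ?m) * indicator ?V z \<partial>lborel)"
  proof (rule nn_integral_mono)
    fix z :: "complex ^ 'n"
    show "indicator ?V z \<le> indicator unit_ball z * ennreal (1 / gap z ^ ?m) * (indicator ?V z :: ennreal)"
    proof (cases "z \<in> ?V")
      case True
      then have z: "norm z < 1" by (simp add: rho_nbhd_def)
      have "gap z ^ ?m \<le> 1" using one_minus_norm_sq_pos[OF z] by (intro power_le_one) auto
      then have "1 \<le> 1 / gap z ^ ?m" using one_minus_norm_sq_pos[OF z] by (simp add: le_divide_eq del: power_Suc)
      then have "1 \<le> ennreal (1 / gap z ^ ?m)" by (metis ennreal_1 ennreal_leI)
      then show ?thesis using True z by simp
    qed simp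
  qed
  finally show "emeasure hyp_vol ?V > 0"
    using nn_integral_hyp_vol[of "indicator ?V"] by (simp add: ennreal_zero_less_mult_iff)
  have "ennreal (d ^ ?m) * emeasure hyp_vol ?V = (\<integral>\<^sup>+z. ennreal (d ^ ?m) * indicator ?V z \<partial>hyp_vol)"
    by (subst nn_integral_cmult_indicator) auto
  also have "\<dots> \<le> (\<integral>\<^sup>+u. ennreal (gap (u :: complex ^ 'n) ^ ?m) \<partial>hyp_vol)"
    using assms by (intro nn_integral_mono)
      (auto simp: rho_nbhd_def rho_0 split: split_indicator intro!: ennreal_leI power_mono simp del: power_Suc)
  also have "\<dots> < \<infinity>" by (rule nn_integral_weight_finite) simp
  finally show "emeasure hyp_vol ?V < \<infinity>" using assms by (auto simp: ennreal_mult_less_top simp del: power_Suc)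
qed

subsection \<open>Cocompact torsion-free lattices\<close>

locale cocompact_lattice =
  fixes \<Gamma> :: "'n::finite mat1 set"
  assumes subgroup: "subgroup \<Gamma> SU_n1" and discrete: "discrete \<Gamma>"
    and torsion_free: "torsion_free \<Gamma>" and cocompact: "compact_space (ball_quotient \<Gamma>)"
begin

lemma Gamma_unitary: "\<gamma> \<in> \<Gamma> \<Longrightarrow> \<gamma> \<in> unitary_n1"
  using subgroup.subset[OF subgroup] SU_subset_unitary by blast

lemma Gamma_one: "mat 1 \<in> \<Gamma>"
  using subgroup.one_closed[OF subgroup] by (simp add: SU_n1_def)

lemma Gamma_mult: "\<gamma> \<in> \<Gamma> \<Longrightarrow> \<delta> \<in> \<Gamma> \<Longrightarrow> \<gamma> ** \<delta> \<in> \<Gamma>"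
  using subgroup.m_closed[OF subgroup] by (simp add: SU_n1_def)

lemma Gamma_inv: assumes "\<gamma> \<in> \<Gamma>" shows "u_inv \<gamma> \<in> \<Gamma>"
proof -
  have c: "\<gamma> \<in> carrier SU_n1" using subgroup.subset[OF subgroup] assms by blast
  note u = u_inv[OF Gamma_unitary[OF assms]]
  have "det (u_inv \<gamma>) = 1"
    using arg_cong[OF u(1), of det] c by (simp add: det_mul SU_n1_def)
  then have c': "u_inv \<gamma> \<in> carrier SU_n1" using u(3) by (simp add: SU_n1_def unitary_n1_def)
  have "inv\<^bsub>SU_n1\<^esub> \<gamma> = u_inv \<gamma>"
    by (rule group.inv_equality[OF group_SU_n1 _ c c']) (use u(1) in \<open>simp add: SU_n1_def\<close>)
  then show ?thesis using subgroup.m_inv_closed[OF subgroup assms] by simp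
qed

lemma Gamma_bij: assumes "\<delta> \<in> \<Gamma>" shows "bij_betw (\<lambda>\<gamma>. \<gamma> ** \<delta>) \<Gamma> \<Gamma>"
  by (rule bij_betw_byWitness[where f' = "\<lambda>\<gamma>. \<gamma> ** u_inv \<delta>"])
     (use u_inv[OF Gamma_unitary[OF assms]] Gamma_inv[OF assms] assms in
       \<open>auto simp: matrix_mul_assoc[symmetric] intro!: Gamma_mult\<close>)

text \<open>Discreteness in the form used below. A bound on |D| bounds all entries, so an infinite
  set of such elements would accumulate somewhere in \<open>unitary_n1\<close>.\<close>

lemma finite_block_D_le: "finite {\<gamma> \<in> \<Gamma>. cmod (block_D \<gamma>) \<le> R}" (is "finite ?S")
proof (rule ccontr)
  assume inf: "infinite ?S"
  have bd: "norm M \<le> (\<Sum>i\<in>(UNIV::'n option set). \<Sum>j\<in>(UNIV::'n option set). R)" if "M \<in> ?S" for M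
  proof -
    have "norm M \<le> (\<Sum>i\<in>UNIV. norm (M $ i))" unfolding norm_vec_def by (rule L2_set_le_sum) simp
    also have "\<dots> \<le> (\<Sum>i\<in>UNIV. \<Sum>j\<in>UNIV. cmod (M $ i $ j))"
      by (rule sum_mono) (simp add: norm_vec_def L2_set_le_sum)
    also have "\<dots> \<le> (\<Sum>i\<in>(UNIV::'n option set). \<Sum>j\<in>(UNIV::'n option set). R)"
      using that unitary_entry_le[OF Gamma_unitary] by (intro sum_mono) (auto intro: order.trans)
    finally show ?thesis .
  qed
  then have "bounded ?S" unfolding bounded_iff by blast
  then obtain x where x: "x islimpt ?S" using bounded_infinite_imp_islimpt[OF subset_refl _ inf] by blast
  have cont_ct: "continuous_on S f \<Longrightarrow> continuous_on S (\<lambda>x. conj_transpose (f x) :: 'n mat1)" for S and f :: "'x::topological_space \<Rightarrow> 'n mat1"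
    unfolding conj_transpose_def by (intro continuous_intros)
  have cont_mm: "continuous_on S f \<Longrightarrow> continuous_on S g \<Longrightarrow> continuous_on S (\<lambda>x. f x ** g x :: 'n mat1)" for S and f g :: "'x::topological_space \<Rightarrow> 'n mat1"
    unfolding matrix_matrix_mult_def by (intro continuous_intros)
  have "closed (unitary_n1 :: 'n mat1 set)"
    unfolding unitary_n1_def by (intro closed_Collect_eq cont_mm cont_ct continuous_intros)
  moreover have "x islimpt unitary_n1" using x by (rule islimpt_subset) (auto simp: Gamma_unitary)
  ultimately have xu: "x \<in> unitary_n1" by (simp add: closed_limpt)
  obtain e where e: "e > 0" "\<And>\<gamma>. \<gamma> \<in> \<Gamma> \<Longrightarrow> dist (mat 1) \<gamma> < e \<Longrightarrow> \<gamma> = mat 1"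
    using discreteD[OF discrete Gamma_one] unfolding isolated_in_dist_Ex_iff by blast
  \<comment> \<open>The limit point \<open>x\<close> is not known to lie in \<Gamma>, so isolation
    is applied at the identity: two distinct lattice elements \<open>a\<close>, \<open>b\<close>
    close to \<open>x\<close> have a quotient \<open>u_inv a ** b\<close> close to the identity,
    which forces \<open>a = b\<close>.\<close>
  define P where "P = (\<lambda>p :: 'n mat1 \<times> 'n mat1. u_inv (fst p) ** snd p)"
  have "continuous_on UNIV P"
    unfolding P_def u_inv_def by (intro cont_mm cont_ct continuous_intros)
  then have "open (P -` ball (mat 1) e)" by (intro open_vimage) auto
  moreover have "(x, x) \<in> P -` ball (mat 1) e" using u_inv[OF xu] e by (simp add: P_def)
  ultimately obtain A B where AB: "open A" "open B" "(x, x) \<in> A \<times> B" "A \<times> B \<subseteq> P -` ball (mat 1) e"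
    by (rule open_prod_elim)
  have "open (A \<inter> B)" "x \<in> A \<inter> B" using AB by auto
  then obtain r where r: "r > 0" "ball x r \<subseteq> A \<inter> B" by (meson openE)
  have infr: "infinite (?S \<inter> ball x r)" using x r(1) unfolding islimpt_eq_infinite_ball by blast
  then obtain a where a: "a \<in> ?S \<inter> ball x r" using infinite_imp_nonempty by blast
  have "infinite (?S \<inter> ball x r - {a})" using infr by simp
  then obtain b where b: "b \<in> ?S \<inter> ball x r" "b \<noteq> a" using infinite_imp_nonempty by blast
  have "P (a, b) \<in> ball (mat 1) e" using a b r AB by blast
  then have "u_inv a ** b = mat 1"
    using e(2)[of "u_inv a ** b"] a b by (auto simp: P_def intro!: Gamma_mult Gamma_inv)
  moreover have "b = a ** (u_inv a ** b)"
    using u_inv(2)[OF Gamma_unitary, of a] a by (simp add: matrix_mul_assoc)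
  ultimately have "b = a" by simp
  then show False using b by simp
qed

lemma countable_Gamma: "countable \<Gamma>"
proof -
  have "\<Gamma> = (\<Union>m::nat. {\<gamma> \<in> \<Gamma>. cmod (block_D \<gamma>) \<le> real m})"
    using real_arch_simple by (force)
  moreover have "countable (\<Union>m::nat. {\<gamma> \<in> \<Gamma>. cmod (block_D \<gamma>) \<le> real m})"
    by (rule countable_UN[OF countableI_type]) (rule countable_finite[OF finite_block_D_le])
  ultimately show ?thesis by argo
qed

text \<open>The orbits meeting the ball of radius \<open>r m\<close> form an open subset of the
  quotient, and these increasing sets cover it. By compactness one radius R < 1 serves all orbits,
  so the closed ball of radius R acts as a compact core.\<close>

lemma cocompact_radius:
  obtains R where "0 < R" "R < 1" "\<And>z. norm z < 1 \<Longrightarrow> \<exists>\<gamma>\<in>\<Gamma>. norm (act \<gamma> z) \<le> R"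
proof -
  define r where "r m = 1 - 1 / (real m + 2)" for m :: nat
  define U where "U m = {X \<in> orbit \<Gamma> ` unit_ball. \<exists>u\<in>X. norm u < r m}" for m
  have r1: "0 < r m" "r m < 1" for m by (auto simp: r_def field_simps)
  have rmono: "r m \<le> r m'" if "m \<le> m'" for m m' using that by (simp add: r_def frac_le)
  have op: "openin (ball_quotient \<Gamma>) (U m)" for m
  proof -
    have "{z \<in> unit_ball. orbit \<Gamma> z \<in> U m} = (\<Union>\<gamma>\<in>\<Gamma>. {z \<in> unit_ball. norm (act \<gamma> z) < r m})"
      by (auto simp: U_def orbit_def)
    moreover have "open {z \<in> unit_ball. norm (act \<gamma> z) < r m}" if "\<gamma> \<in> \<Gamma>" for \<gamma>
    proof -
      have "open (unit_ball \<inter> act \<gamma> -` ball 0 (r m))"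
        using continuous_on_open_vimage[of unit_ball "act \<gamma>"] continuous_on_act[OF Gamma_unitary[OF that]]
        by (simp add: Int_commute)
      moreover have "unit_ball \<inter> act \<gamma> -` ball 0 (r m) = {z \<in> unit_ball. norm (act \<gamma> z) < r m}" by auto
      ultimately show ?thesis by simp
    qed
    ultimately show ?thesis unfolding openin_ball_quotient by (auto simp: U_def intro!: open_UN)
  qed
  have "topspace (ball_quotient \<Gamma>) \<subseteq> \<Union>(range U)"
  proof
    fix X assume "X \<in> topspace (ball_quotient \<Gamma>)"
    then obtain z where z: "norm z < 1" "X = orbit \<Gamma> z" by (auto simp: topspace_ball_quotient)
    have zO: "z \<in> X" using Gamma_one by (auto simp: z orbit_def image_iff intro!: bexI[of _ "mat 1"])
    have "(\<lambda>m. 1 - 1 / (real m + 2)) \<longlonglongrightarrow> 1 - 0"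
      by (intro tendsto_intros LIMSEQ_ignore_initial_segment) real_asymp
    then have "eventually (\<lambda>m. r m > norm z) sequentially" using z unfolding r_def
      by (intro order_tendstoD) auto
    then obtain m where "norm z < r m" by (meson eventually_happens sequentially_bot)
    then show "X \<in> \<Union>(range U)" using z zO by (auto simp: U_def)
  qed
  then obtain F where F: "finite F" "F \<subseteq> range U" "topspace (ball_quotient \<Gamma>) \<subseteq> \<Union>F"
    using cocompact op unfolding compact_space_alt by (metis (no_types, lifting) imageE)
  obtain I where I: "finite I" "F = U ` I" using F(1,2) finite_subset_image[OF F(1,2)] by auto
  define N where "N = Max (insert 0 I)"
  show ?thesis
  proof (rule that[of "r N"])
    fix z :: "complex ^ 'n" assume z: "norm z < 1"
    then have "orbit \<Gamma> z \<in> topspace (ball_quotient \<Gamma>)" by (auto simp: topspace_ball_quotient)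
    then obtain m where m: "m \<in> I" "orbit \<Gamma> z \<in> U m" using F I by auto
    then obtain \<gamma> where g: "\<gamma> \<in> \<Gamma>" "norm (act \<gamma> z) < r m" by (auto simp: U_def orbit_def)
    have "m \<le> N" using I m by (simp add: N_def)
    then show "\<exists>\<gamma>\<in>\<Gamma>. norm (act \<gamma> z) \<le> r N" using g rmono by (meson less_eq_real_def order_trans)
  qed (use r1 in auto)
qed

text \<open>All powers of \<gamma> fix z, so their automorphy factors at z have modulus 1 and their
  entries are bounded. Discreteness leaves finitely many powers, two of them coincide, and \<gamma>
  is torsion.\<close>

lemma Gamma_fixed_point_free:
  assumes "\<gamma> \<in> \<Gamma>" "norm z < 1" "act \<gamma> z = z"
  shows "\<gamma> = mat 1"
proof -
  interpret SU: group "SU_n1 :: 'n mat1 monoid" by (rule group_SU_n1)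
  have c: "\<gamma> \<in> carrier SU_n1" using subgroup.subset[OF subgroup] assms by blast
  define p where "p m = \<gamma> [^]\<^bsub>SU_n1\<^esub> (m::nat)" for m
  have p: "p m \<in> \<Gamma>" "act (p m) z = z" for m
  proof (induction m)
    case 0
    show "p 0 \<in> \<Gamma>" "act (p 0) z = z" using Gamma_one by (auto simp: p_def SU_n1_def)
  next
    case (Suc m)
    have s: "p (Suc m) = p m ** \<gamma>" by (simp add: p_def SU_n1_def)
    show "p (Suc m) \<in> \<Gamma>" unfolding s using Suc assms by (auto intro: Gamma_mult)
    show "act (p (Suc m)) z = z" unfolding s
      using act_aut_mult(1)[OF Gamma_unitary[OF Suc(1)] Gamma_unitary[OF assms(1)] assms(2)] Suc assms by simp
  qed
  have "cmod (block_D (p m)) \<le> 1 / (1 - norm z)" for m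
  proof -
    have "gap z * (cmod (aut_factor (p m) z))\<^sup>2 = gap z"
      using one_minus_norm_act[OF Gamma_unitary[OF p(1)[of m]] assms(2)] by (simp add: p)
    then have "(cmod (aut_factor (p m) z))\<^sup>2 = 1" using one_minus_norm_sq_pos[OF assms(2)] by simp
    then have "cmod (aut_factor (p m) z) = 1" by (simp add: abs_square_eq_1)
    then show ?thesis using block_D_le_aut_factor[OF Gamma_unitary[OF p(1)[of m]], of z] assms(2) by (simp add: field_simps)
  qed
  then have "range p \<subseteq> {\<gamma> \<in> \<Gamma>. cmod (block_D \<gamma>) \<le> 1 / (1 - norm z)}" using p by auto
  then have "finite (range p)" using finite_block_D_le finite_subset by blast
  then have "\<not> inj p" using finite_imageD infinite_UNIV_nat by blast
  then obtain a b where ab: "a < b" "p a = p b" by (metis inj_def linorder_neqE_nat)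
  have "p a \<otimes>\<^bsub>SU_n1\<^esub> p (b - a) = p b" unfolding p_def using ab SU.nat_pow_mult[OF c, of a "b - a"] by simp
  then have "p a \<otimes>\<^bsub>SU_n1\<^esub> p (b - a) = p a \<otimes>\<^bsub>SU_n1\<^esub> \<one>\<^bsub>SU_n1\<^esub>" using ab c by (simp add: p_def)
  then have "p (b - a) = \<one>\<^bsub>SU_n1\<^esub>" using c by (simp add: p_def)
  then have "\<gamma> = \<one>\<^bsub>SU_n1\<^esub>" using torsion_free assms(1) ab unfolding torsion_free_def p_def
    by (metis Suc_leI One_nat_def zero_less_diff)
  then show ?thesis by (simp add: SU_n1_def)
qed

text \<open>A uniform positive lower bound for the displacement. On the compact core, all but
  finitely many elements move points far; each remaining one attains its maximal \<open>rho\<close>,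
  which is below 1 because it has no fixed point. Conjugation extends the bound from the core to the
  ball.\<close>

lemma displacement:
  obtains \<delta> where "0 < \<delta>" "\<delta> < 1"
    "\<And>\<gamma> z. \<gamma> \<in> \<Gamma> \<Longrightarrow> \<gamma> \<noteq> mat 1 \<Longrightarrow> norm z < 1 \<Longrightarrow> rho (act \<gamma> z) z \<le> \<delta>"
proof -
  obtain R where R: "0 < R" "R < 1" "\<And>z. norm z < 1 \<Longrightarrow> \<exists>\<gamma>\<in>\<Gamma>. norm (act \<gamma> z) \<le> R"
    using cocompact_radius by blast
  \<comment> \<open>If \<open>rho (act \<gamma> z) z > 1/2\<close> on the core, then
    \<open>gap (act \<gamma> z)\<close> exceeds (1-R)^2/2. This bounds the automorphy factor by
    2/(1-R), and passing from it to |D| costs another factor 1-R.\<close>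
  define B where "B = 2 / (1 - R)\<^sup>2"
  define T where "T = {\<gamma> \<in> \<Gamma>. cmod (block_D \<gamma>) \<le> B} - {mat 1}"
  have T: "finite T" using finite_block_D_le by (simp add: T_def)
  have far: "rho (act \<gamma> z) z \<le> 1/2" if "\<gamma> \<in> \<Gamma>" "\<gamma> \<noteq> mat 1" "\<gamma> \<notin> T" "norm z \<le> R" for \<gamma> z
  proof (rule ccontr)
    assume h: "\<not> rho (act \<gamma> z) z \<le> 1/2"
    note u = Gamma_unitary[OF that(1)]
    have z: "norm z < 1" using that R by simp
    have az: "norm (act \<gamma> z) < 1" using act_ball[OF u z] .
    define q where "q = gap (act \<gamma> z)"
    have q: "q > 0" using one_minus_norm_sq_pos[OF az] by (simp add: q_def)
    have Q: "cmod (Q_ker (act \<gamma> z) z) \<ge> 1 - R"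
    proof -
      have "norm (act \<gamma> z) * norm z \<le> 1 * R" using az that(4) by (intro mult_mono) auto
      then show ?thesis using Q_ker_norm_ge[of "act \<gamma> z" z] by simp
    qed
    have "1/2 < q * gap z / (cmod (Q_ker (act \<gamma> z) z))\<^sup>2" using h by (simp add: rho_def q_def)
    also have "\<dots> \<le> q * 1 / (1 - R)\<^sup>2"
      using q Q R one_minus_norm_sq_pos[OF z] by (intro frac_le mult_mono power_mono mult_nonneg_nonneg) auto
    finally have q2: "q > (1 - R)\<^sup>2 / 2" using R by (simp add: field_simps)
    have "q * (cmod (aut_factor \<gamma> z))\<^sup>2 = gap z" using one_minus_norm_act[OF u z] by (simp add: q_def)
    then have "q * (cmod (aut_factor \<gamma> z))\<^sup>2 \<le> 1" by simp
    moreover have "(1 - R)\<^sup>2 / 2 * (cmod (aut_factor \<gamma> z))\<^sup>2 \<le> q * (cmod (aut_factor \<gamma> z))\<^sup>2"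
      using q2 by (intro mult_right_mono) auto
    ultimately have "(1 - R)\<^sup>2 / 2 * (cmod (aut_factor \<gamma> z))\<^sup>2 \<le> 1" by linarith
    then have "((1 - R) * cmod (aut_factor \<gamma> z))\<^sup>2 \<le> 2\<^sup>2" by (simp add: power_mult_distrib)
    then have a: "(1 - R) * cmod (aut_factor \<gamma> z) \<le> 2" by (rule power2_le_imp_le) simp
    have "cmod (block_D \<gamma>) * (1 - R) \<le> cmod (block_D \<gamma>) * (1 - norm z)" using that by (intro mult_left_mono) auto
    also have "\<dots> \<le> cmod (aut_factor \<gamma> z)" using block_D_le_aut_factor[OF u] z by simp
    finally have "(1 - R) * (cmod (block_D \<gamma>) * (1 - R)) \<le> (1 - R) * cmod (aut_factor \<gamma> z)"
      using R by (intro mult_left_mono) auto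
    then have "cmod (block_D \<gamma>) * (1 - R)\<^sup>2 \<le> 2" using a by (simp add: power2_eq_square mult_ac)
    then have "cmod (block_D \<gamma>) \<le> B" using R by (simp add: B_def field_simps)
    then show False using that by (simp add: T_def)
  qed
  have near: "\<exists>s<1. \<forall>z\<in>cball 0 R. rho (act \<gamma> z) z \<le> s" if "\<gamma> \<in> T" for \<gamma>
  proof -
    have g: "\<gamma> \<in> \<Gamma>" "\<gamma> \<noteq> mat 1" using that by (auto simp: T_def)
    have sub: "cball 0 R \<subseteq> (unit_ball :: (complex^'n) set)" using R by auto
    have "continuous_on (cball 0 R) (\<lambda>z. rho (act \<gamma> z) z)"
      using act_ball[OF Gamma_unitary[OF g(1)]] R
      by (intro continuous_on_rho continuous_on_subset[OF continuous_on_act[OF Gamma_unitary[OF g(1)]] sub] continuous_on_id) auto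
    then obtain x where x: "x \<in> cball 0 R" "\<And>z. z \<in> cball 0 R \<Longrightarrow> rho (act \<gamma> z) z \<le> rho (act \<gamma> x) x"
      using continuous_attains_sup[OF compact_cball, of "0::complex^'n" R] R by fastforce
    have x1: "norm x < 1" "norm (act \<gamma> x) < 1" using x(1) R act_ball[OF Gamma_unitary[OF g(1)]] by auto
    have "rho (act \<gamma> x) x \<noteq> 1" using rho_eq_1[OF x1(2,1)] Gamma_fixed_point_free[OF g(1) x1(1)] g(2) by auto
    then have "rho (act \<gamma> x) x < 1" using rho_le_1[OF x1(2,1)] by simp
    then show ?thesis using x by blast
  qed
  then obtain s where s: "\<And>\<gamma>. \<gamma> \<in> T \<Longrightarrow> s \<gamma> < 1 \<and> (\<forall>z\<in>cball 0 R. rho (act \<gamma> z) z \<le> s \<gamma>)" by metis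
  define \<delta> where "\<delta> = Max (insert (1/2) (s ` T))"
  have "1/2 \<le> \<delta>" unfolding \<delta>_def using T by (intro Max_ge) auto
  moreover have "\<delta> < 1" using T s by (auto simp: \<delta>_def)
  moreover have "s \<gamma> \<le> \<delta>" if "\<gamma> \<in> T" for \<gamma> unfolding \<delta>_def using T that by (intro Max_ge) auto
  ultimately have d: "1/2 \<le> \<delta>" "\<delta> < 1" "\<And>\<gamma>. \<gamma> \<in> T \<Longrightarrow> s \<gamma> \<le> \<delta>" by auto
  have K: "rho (act \<gamma> z) z \<le> \<delta>" if "\<gamma> \<in> \<Gamma>" "\<gamma> \<noteq> mat 1" "norm z \<le> R" for \<gamma> z
    using far[OF that(1,2) _ that(3)] s[of \<gamma>] d that(3) by (cases "\<gamma> \<in> T") force+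
  show ?thesis
  proof (rule that[of \<delta>])
    fix \<gamma> and z :: "complex ^ 'n" assume g: "\<gamma> \<in> \<Gamma>" "\<gamma> \<noteq> mat 1" and z: "norm z < 1"
    obtain \<sigma> where \<sigma>: "\<sigma> \<in> \<Gamma>" "norm (act \<sigma> z) \<le> R" using R(3)[OF z] by blast
    note us = Gamma_unitary[OF \<sigma>(1)] and ug = Gamma_unitary[OF g(1)]
    \<comment> \<open>Translating z into the core by \<sigma> replaces \<gamma> by its conjugate
      \<tau>, without changing the displacement.\<close>
    define \<tau> where "\<tau> = \<sigma> ** \<gamma> ** u_inv \<sigma>"
    have t: "\<tau> \<in> \<Gamma>" unfolding \<tau>_def using \<sigma> g by (intro Gamma_mult Gamma_inv)
    have "\<tau> \<noteq> mat 1"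
    proof
      assume "\<tau> = mat 1"
      then have "u_inv \<sigma> ** \<tau> ** \<sigma> = mat 1" using u_inv(1)[OF us] by simp
      moreover have "u_inv \<sigma> ** \<tau> ** \<sigma> = (u_inv \<sigma> ** \<sigma>) ** \<gamma> ** (u_inv \<sigma> ** \<sigma>)" by (simp add: \<tau>_def matrix_mul_assoc)
      ultimately show False using g u_inv(1)[OF us] by simp
    qed
    then have "rho (act \<tau> (act \<sigma> z)) (act \<sigma> z) \<le> \<delta>" using K[OF t _ \<sigma>(2)] by blast
    moreover have "act \<tau> (act \<sigma> z) = act \<sigma> (act \<gamma> z)"
    proof -
      have "act \<tau> (act \<sigma> z) = act (\<tau> ** \<sigma>) z" using act_aut_mult(1)[OF Gamma_unitary[OF t] us z] by simp
      also have "\<tau> ** \<sigma> = \<sigma> ** \<gamma>" using u_inv(1)[OF us] by (simp add: \<tau>_def matrix_mul_assoc[symmetric])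
      finally show ?thesis using act_aut_mult(1)[OF us ug z] by simp
    qed
    ultimately show "rho (act \<gamma> z) z \<le> \<delta>" using rho_act[OF us act_ball[OF ug z] z] by simp
  qed (use d in auto)
qed

text \<open>The neighbourhoods \<open>rho_nbhd d (act \<gamma> z)\<close> are disjoint and of equal volume, and on each of them
  \<open>rho _ w\<close> is comparable to its value at \<open>act \<gamma> z\<close>; so the sum is dominated by an integral over the ball.\<close>

lemma rho_sum_bound:
  obtains C where "0 < C"
    "\<And>T z w. finite T \<Longrightarrow> T \<subseteq> \<Gamma> \<Longrightarrow> norm z < 1 \<Longrightarrow> norm w < 1 \<Longrightarrow> (\<Sum>\<gamma>\<in>T. rho (act \<gamma> z) w ^ (CARD('n) + 1)) \<le> C"
proof -
  let ?m = "CARD('n) + 1"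
  obtain \<delta> where \<delta>: "0 < \<delta>" "\<delta> < 1"
    "\<And>\<gamma> z. \<gamma> \<in> \<Gamma> \<Longrightarrow> \<gamma> \<noteq> mat 1 \<Longrightarrow> norm z < 1 \<Longrightarrow> rho (act \<gamma> z) z \<le> \<delta>" using displacement by blast
  \<comment> \<open>Any s < 1 whose square exceeds \<delta> would do. The value of \<open>d\<close>
    solves d/(2-d) = s, so two overlapping neighbourhoods would have centres with \<open>rho\<close>
    at least s^2 > \<delta>, against the displacement bound.\<close>
  define s where "s = sqrt ((1 + \<delta>) / 2)"
  have s: "0 < s" "s < 1" "s\<^sup>2 > \<delta>" using \<delta> by (auto simp: s_def)
  define d where "d = 2 * s / (1 + s)"
  have d: "0 < d" "d < 1" "d / (2 - d) = s" using s by (auto simp: d_def field_simps)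
  define J where "J = (\<integral>\<^sup>+u. ennreal (gap (u :: complex ^ 'n) ^ ?m) \<partial>hyp_vol)"
  have J: "J < \<infinity>" unfolding J_def by (rule nn_integral_weight_finite) simp
  define v where "v = emeasure hyp_vol (rho_nbhd d (0 :: complex ^ 'n))"
  have v: "0 < v" "v < \<infinity>" using emeasure_rho_nbhd_0[OF d(1,2)] by (auto simp: v_def)
  define C where "C = (4 / d) ^ ?m * enn2real J / enn2real v + 1"
  have v': "enn2real v > 0" using v by (simp add: enn2real_positive_iff)
  show ?thesis
  proof (rule that[of C])
    show "C > 0" using d v' by (auto simp: C_def intro!: add_nonneg_pos)
    fix T z w assume T: "finite T" "T \<subseteq> \<Gamma>" and z: "norm (z :: complex ^ 'n) < 1" and w: "norm (w :: complex ^ 'n) < 1"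
    let ?V = "\<lambda>\<gamma>. rho_nbhd d (act \<gamma> z)"
    have az: "norm (act \<gamma> z) < 1" if "\<gamma> \<in> T" for \<gamma> using act_ball[OF Gamma_unitary z] that T by auto
    have disj: "disjoint_family_on ?V T"
      unfolding disjoint_family_on_def
    proof (intro ballI impI)
      fix a b assume ab: "a \<in> T" "b \<in> T" "a \<noteq> b"
      then have abG: "a \<in> \<Gamma>" "b \<in> \<Gamma>" using T by auto
      note ua = Gamma_unitary[OF abG(1)] and ub = Gamma_unitary[OF abG(2)]
      show "?V a \<inter> ?V b = {}"
      proof (rule ccontr)
        assume "?V a \<inter> ?V b \<noteq> {}"
        then obtain u where u: "norm u < 1" "rho u (act a z) > d" "rho u (act b z) > d" by (auto simp: rho_nbhd_def)
        then have "rho (act a z) (act b z) \<ge> s\<^sup>2"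
          using rho_quasi_triangle[OF u(1) az[OF ab(1)] az[OF ab(2)] _ _ d(1)] d(3) by (simp add: rho_sym)
        moreover have "rho (act a z) (act b z) \<le> \<delta>"
        proof -
          define \<tau> where "\<tau> = u_inv b ** a"
          have t: "\<tau> \<in> \<Gamma>" unfolding \<tau>_def using abG by (intro Gamma_mult Gamma_inv)
          have "\<tau> \<noteq> mat 1" 
          proof
            assume t1: "\<tau> = mat 1"
            have "b ** \<tau> = a" unfolding \<tau>_def using u_inv(2)[OF ub] by (simp add: matrix_mul_assoc)
            then show False using t1 ab(3) by simp
          qed
          then have "rho (act \<tau> z) z \<le> \<delta>" using \<delta>(3)[OF t _ z] by blast
          moreover have "act b (act \<tau> z) = act a z"
            unfolding \<tau>_def using act_aut_mult(1)[OF u_inv(3)[OF ub] ua z] act_u_inv(2)[OF ub az[OF ab(1)]] by simp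
          ultimately show ?thesis using rho_act[OF ub act_ball[OF Gamma_unitary[OF t] z] z] by simp
        qed
        ultimately show False using s by linarith
      qed
    qed
    have each: "ennreal (rho (act \<gamma> z) w ^ ?m) * v \<le> ennreal ((4 / d) ^ ?m) * (\<integral>\<^sup>+u. indicator (?V \<gamma>) u * ennreal (rho u w ^ ?m) \<partial>hyp_vol)" if "\<gamma> \<in> T" for \<gamma>
    proof -
      have "ennreal (rho (act \<gamma> z) w ^ ?m) * v = (\<integral>\<^sup>+u. ennreal (rho (act \<gamma> z) w ^ ?m) * indicator (?V \<gamma>) u \<partial>hyp_vol)"
        by (subst nn_integral_cmult_indicator) (auto simp: v_def emeasure_rho_nbhd[OF az[OF that]])
      also have "\<dots> \<le> (\<integral>\<^sup>+u. ennreal ((4 / d) ^ ?m) * (indicator (?V \<gamma>) u * ennreal (rho u w ^ ?m)) \<partial>hyp_vol)"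
      proof (rule nn_integral_mono)
        fix u :: "complex ^ 'n"
        show "ennreal (rho (act \<gamma> z) w ^ ?m) * indicator (?V \<gamma>) u \<le> ennreal ((4 / d) ^ ?m) * (indicator (?V \<gamma>) u * ennreal (rho u w ^ ?m))"
        proof (cases "u \<in> ?V \<gamma>")
          case True
          then have u: "norm u < 1" "rho u (act \<gamma> z) > d" by (auto simp: rho_nbhd_def)
          have "rho (act \<gamma> z) w \<le> 4 / d * rho u w"
            using rho_compare[OF u(1) az[OF that] w u(2) d(1)] d by (simp add: field_simps)
          then have "rho (act \<gamma> z) w ^ ?m \<le> (4 / d * rho u w) ^ ?m"
            using rho_pos[OF az[OF that] w] by (intro power_mono) auto
          then show ?thesis using True rho_pos[OF u(1) w] d
            by (simp add: ennreal_mult[symmetric] power_mult_distrib[symmetric] ennreal_leI del: power_Suc)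
        qed simp
      qed
      also have "\<dots> = ennreal ((4 / d) ^ ?m) * (\<integral>\<^sup>+u. indicator (?V \<gamma>) u * ennreal (rho u w ^ ?m) \<partial>hyp_vol)"
        by (rule nn_integral_cmult) measurable
      finally show ?thesis .
    qed
    have "ennreal (\<Sum>\<gamma>\<in>T. rho (act \<gamma> z) w ^ ?m) * v = (\<Sum>\<gamma>\<in>T. ennreal (rho (act \<gamma> z) w ^ ?m) * v)"
      unfolding sum_distrib_right[symmetric] by (subst sum_ennreal) (use rho_pos[OF az w] in \<open>auto intro: zero_le_power less_imp_le\<close>)
    also have "\<dots> \<le> (\<Sum>\<gamma>\<in>T. ennreal ((4 / d) ^ ?m) * (\<integral>\<^sup>+u. indicator (?V \<gamma>) u * ennreal (rho u w ^ ?m) \<partial>hyp_vol))"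
      by (rule sum_mono) (rule each)
    also have "\<dots> = ennreal ((4 / d) ^ ?m) * (\<integral>\<^sup>+u. (\<Sum>\<gamma>\<in>T. indicator (?V \<gamma>) u * ennreal (rho u w ^ ?m)) \<partial>hyp_vol)"
      by (subst nn_integral_sum) (auto simp: sum_distrib_left)
    also have "\<dots> \<le> ennreal ((4 / d) ^ ?m) * (\<integral>\<^sup>+u. ennreal (rho u w ^ ?m) \<partial>hyp_vol)"
    proof (intro mult_left_mono nn_integral_mono)
      fix u :: "complex ^ 'n"
      have "(\<Sum>\<gamma>\<in>T. indicator (?V \<gamma>) u) = (indicator (\<Union>\<gamma>\<in>T. ?V \<gamma>) u :: ennreal)"
        by (rule indicator_UN_disjoint[OF T(1) disj, symmetric])
      then have "(\<Sum>\<gamma>\<in>T. indicator (?V \<gamma>) u * ennreal (rho u w ^ ?m)) = indicator (\<Union>\<gamma>\<in>T. ?V \<gamma>) u * ennreal (rho u w ^ ?m)"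
        by (simp add: sum_distrib_right[symmetric])
      then show "(\<Sum>\<gamma>\<in>T. indicator (?V \<gamma>) u * ennreal (rho u w ^ ?m)) \<le> ennreal (rho u w ^ ?m)"
        by (simp add: indicator_def)
    qed simp
    also have "\<dots> = ennreal ((4 / d) ^ ?m) * J" by (simp only: nn_integral_rho[OF w] J_def)
    also have "\<dots> = ennreal ((4 / d) ^ ?m) * ennreal (enn2real J)" using J by simp
    also have "\<dots> = ennreal ((4 / d) ^ ?m * enn2real J)" using d by (intro ennreal_mult[symmetric]) auto
    also have "\<dots> = ennreal ((4 / d) ^ ?m * enn2real J / enn2real v) * v"
    proof -
      have vv: "v = ennreal (enn2real v)" using v by simp
      have "ennreal ((4 / d) ^ ?m * enn2real J / enn2real v) * ennreal (enn2real v)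
         = ennreal ((4 / d) ^ ?m * enn2real J / enn2real v * enn2real v)"
        using v' d by (intro ennreal_mult[symmetric]) auto
      also have "\<dots> = ennreal ((4 / d) ^ ?m * enn2real J)" using v' by simp
      finally show ?thesis using vv by argo
    qed
    finally have "ennreal (\<Sum>\<gamma>\<in>T. rho (act \<gamma> z) w ^ ?m) \<le> ennreal ((4 / d) ^ ?m * enn2real J / enn2real v)"
      using v by (simp add: ennreal_mult_le_mult_iff mult.commute[of _ v])
    then have "(\<Sum>\<gamma>\<in>T. rho (act \<gamma> z) w ^ ?m) \<le> (4 / d) ^ ?m * enn2real J / enn2real v"
      using d v' by (subst (asm) ennreal_le_iff) auto
    then show "(\<Sum>\<gamma>\<in>T. rho (act \<gamma> z) w ^ ?m) \<le> C" by (simp add: C_def)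
  qed
qed

end

subsection \<open>Weighted volumes and the mean value property\<close>

text \<open>Layer cake: (1-a)^m is the integral of m(1-s)^(m-1) over s from a to 1. With a = |z|^2,
  exchanging integrals leaves the volume of the ball of radius sqrt s, proportional to s^n, and
  hence a Beta integral.\<close>

lemma nn_integral_ball_power:
  assumes "m \<ge> 2"
  shows "(\<integral>\<^sup>+z. indicator (unit_ball :: (complex ^ 'n::finite) set) z * ennreal (gap z ^ m) \<partial>lborel)
    = ennreal (pi ^ CARD('n) * fact m / fact (m + CARD('n)))"
proof -
  let ?n = "CARD('n)"
  let ?d = "\<lambda>s. ennreal (real m * (1 - s) ^ (m - 1)) * indicator {0..1} s"
  define V where "V = unit_ball_vol (real (2 * ?n))"
  have V: "V = pi ^ ?n / fact ?n" unfolding V_def by (rule unit_ball_vol_even)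
  have inner: "(\<integral>\<^sup>+s. ?d s * indicator {s. (norm z)\<^sup>2 < s} s \<partial>lborel) = indicator (unit_ball :: (complex ^ 'n) set) z * ennreal (gap z ^ m)" for z :: "complex ^ 'n"
  proof (cases "norm z < 1")
    case True
    define a where "a = (norm z)\<^sup>2"
    have a: "0 \<le> a" "a < 1" using one_minus_norm_sq_pos[OF True] by (auto simp: a_def)
    have "(\<integral>\<^sup>+s. ?d s * indicator {s. a < s} s \<partial>lborel) = (\<integral>\<^sup>+s. ennreal (real m * (1 - s) ^ (m - 1)) * indicator {a..1} s \<partial>lborel)"
    proof (rule nn_integral_cong_AE)
      have "AE s in lborel. s \<noteq> a" by (rule AE_lborel_singleton)
      then show "AE s in lborel. ?d s * indicator {s. a < s} s = ennreal (real m * (1 - s) ^ (m - 1)) * indicator {a..1} s"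
        by eventually_elim (use a in \<open>auto split: split_indicator\<close>)
    qed
    also have "\<dots> = ennreal (- ((1 - 1) ^ m) - - ((1 - a) ^ m))"
      using a assms by (intro nn_integral_FTC_Icc) (auto intro!: derivative_eq_intros)
    finally show ?thesis using True assms by (simp add: a_def power_0_left)
  next
    case False
    then have "1 \<le> (norm z)\<^sup>2" by simp
    then have *: "?d s * indicator {s. (norm z)\<^sup>2 < s} s = 0" for s by (auto split: split_indicator)
    show ?thesis unfolding * using False by simp
  qed
  have "(\<integral>\<^sup>+z. indicator (unit_ball :: (complex ^ 'n) set) z * ennreal (gap z ^ m) \<partial>lborel)
     = (\<integral>\<^sup>+z. \<integral>\<^sup>+s. ?d s * indicator {x. (norm (fst x))\<^sup>2 < snd x} (z :: complex ^ 'n, s) \<partial>lborel \<partial>lborel)"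
    unfolding inner[symmetric] by (simp add: indicator_def)
  also have "\<dots> = (\<integral>\<^sup>+s. \<integral>\<^sup>+z. ?d s * indicator {x. (norm (fst x))\<^sup>2 < snd x} (z :: complex ^ 'n, s) \<partial>lborel \<partial>lborel)"
  proof (rule lborel_pair.Fubini'[symmetric])
    have [measurable]: "{x. (norm (fst x))\<^sup>2 < snd x} \<in> sets (borel :: ((complex ^ 'n) \<times> real) measure)"
      by (intro borel_open open_Collect_less continuous_intros)
    have "{x. (norm (fst x))\<^sup>2 < snd x} \<in> sets (lborel \<Otimes>\<^sub>M lborel :: ((complex ^ 'n) \<times> real) measure)"
      by (subst lborel_prod) simp
    then show "(\<lambda>(z :: complex ^ 'n, s). ?d s * indicator {x. (norm (fst x))\<^sup>2 < snd x} (z, s)) \<in> borel_measurable (lborel \<Otimes>\<^sub>M lborel)"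
      by measurable
  qed
  also have "\<dots> = (\<integral>\<^sup>+s. ennreal (V * real m * (s ^ ?n * (1 - s) ^ (m - 1))) * indicator {0..1} s \<partial>lborel)"
  proof (rule nn_integral_cong)
    fix s :: real
    show "(\<integral>\<^sup>+z. ?d s * indicator {x. (norm (fst x))\<^sup>2 < snd x} (z :: complex ^ 'n, s) \<partial>lborel) = ennreal (V * real m * (s ^ ?n * (1 - s) ^ (m - 1))) * indicator {0..1} s"
    proof (cases "s \<in> {0..1}")
      case True
      have "indicator {x. (norm (fst x))\<^sup>2 < snd x} (z, s) = (indicator (ball 0 (sqrt s)) z :: ennreal)" for z :: "complex ^ 'n"
      proof -
        have "(norm z)\<^sup>2 < s \<longleftrightarrow> norm z < sqrt s" using True by (metis abs_norm_cancel real_sqrt_abs real_sqrt_less_iff)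
        then show ?thesis by (simp add: indicator_def)
      qed
      then have "(\<integral>\<^sup>+z. ?d s * indicator {x. (norm (fst x))\<^sup>2 < snd x} (z :: complex ^ 'n, s) \<partial>lborel) = ?d s * emeasure lborel (ball (0 :: complex ^ 'n) (sqrt s))"
        by (simp add: nn_integral_cmult_indicator)
      also have "emeasure lborel (ball (0 :: complex ^ 'n) (sqrt s)) = ennreal (V * s ^ ?n)"
        using True by (simp add: emeasure_ball V_def power_mult mult.commute[of "?n" 2])
      also have "?d s * ennreal (V * s ^ ?n) = ennreal (real m * (1 - s) ^ (m - 1)) * ennreal (V * s ^ ?n)" using True by simp
      also have "\<dots> = ennreal (real m * (1 - s) ^ (m - 1) * (V * s ^ ?n))"
        using True by (intro ennreal_mult[symmetric]) (auto simp: V)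
      finally show ?thesis using True by (simp add: mult_ac)
    qed simp
  qed
  also have "\<dots> = ennreal (V * real m * Beta (real (?n + 1)) (real m))"
  proof -
    have "((\<lambda>t. t powr (real (?n + 1) - 1) * (1 - t) powr (real m - 1)) has_integral Beta (real (?n + 1)) (real m)) {0..1}"
      by (rule has_integral_Beta_real) (use assms in auto)
    then have "((\<lambda>t. t ^ ?n * (1 - t) ^ (m - 1)) has_integral Beta (real (?n + 1)) (real m)) {0..1}"
    proof (rule has_integral_cong[THEN iffD1, rotated])
      fix t :: real assume t: "t \<in> {0..1}"
      have "t powr (real (?n + 1) - 1) = t ^ ?n" using t by (cases "t = 0") (auto simp: powr_realpow)
      moreover have "(1 - t) powr (real m - 1) = (1 - t) ^ (m - 1)"
      proof (cases "t = 1")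
        case False
        have m1: "real m - 1 = real (m - 1)" using assms by simp
        show ?thesis unfolding m1 by (rule powr_realpow) (use t False in auto)
      qed (use assms in auto)
      ultimately show "t powr (real (?n + 1) - 1) * (1 - t) powr (real m - 1) = t ^ ?n * (1 - t) ^ (m - 1)" by simp
    qed
    then have "((\<lambda>t. V * real m * (t ^ ?n * (1 - t) ^ (m - 1))) has_integral (V * real m * Beta (real (?n + 1)) (real m))) {0..1}"
      by (rule has_integral_mult_right)
    then show ?thesis
      by (subst nn_integral_has_integral_lebesgue[symmetric, rotated])
        (auto simp: V mult.commute indicator_mult_ennreal intro!: nn_integral_cong split: split_indicator)
  qed
  also have "V * real m * Beta (real (?n + 1)) (real m) = pi ^ ?n * fact m / fact (m + ?n)"
  proof -
    have 1: "Gamma (real (?n + 1)) = fact ?n" using Gamma_fact[of ?n, where 'a=real] by (simp add: add.commute)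
    have 2: "Gamma (real m) = fact (m - 1)" using Gamma_fact[of "m - 1", where 'a=real] assms by simp
    have 3: "Gamma (real (?n + 1) + real m) = fact (m + ?n)"
      using Gamma_fact[of "m + ?n", where 'a=real] by (simp add: add_ac)
    have 4: "(fact m :: real) = real m * fact (m - 1)" using assms by (simp add: fact_reduce)
    show ?thesis unfolding Beta_def 1 2 3 4 V by (simp add: field_simps)
  qed
  finally show ?thesis .
qed

text \<open>The factor \<open>4 ^ CARD('n)\<close> stems from the determinant of the metric. For k
  \<le> n the natural subtraction truncates, so the expression is positive for every k, while it is
  identified with the integral for large k only.\<close>

definition weight_mass :: "'n::finite itself \<Rightarrow> nat \<Rightarrow> real" where
  "weight_mass _ k = (4 * pi) ^ CARD('n) * fact (k - CARD('n) - 1) / fact (k - 1)"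

lemma weight_mass_pos: "weight_mass TYPE('n::finite) k > 0"
  by (simp add: weight_mass_def)

lemma nn_integral_weight:
  assumes "k \<ge> CARD('n) + 3"
  shows "(\<integral>\<^sup>+u. ennreal (gap (u :: complex ^ 'n::finite) ^ k) \<partial>hyp_vol) = ennreal (weight_mass TYPE('n) k)"
proof -
  let ?n = "CARD('n)" and ?m = "k - CARD('n) - 1"
  have "(\<integral>\<^sup>+z. indicator unit_ball z * ennreal (1 / gap (z :: complex ^ 'n) ^ (?n + 1)) * ennreal (gap z ^ k) \<partial>lborel)
     = (\<integral>\<^sup>+z. indicator (unit_ball :: (complex ^ 'n::finite) set) z * ennreal (gap z ^ ?m) \<partial>lborel)"
  proof (rule nn_integral_cong)
    fix z :: "complex ^ 'n"
    show "indicator unit_ball z * ennreal (1 / gap z ^ (?n + 1)) * ennreal (gap z ^ k) = indicator unit_ball z * ennreal (gap z ^ ?m)"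
    proof (cases "norm z < 1")
      case True
      define r where "r = gap z"
      have r: "r > 0" using one_minus_norm_sq_pos[OF True] by (simp add: r_def)
      have "r ^ k = r ^ (?n + 1) * r ^ ?m" using assms by (simp add: power_add[symmetric] del: power_Suc)
      then have "1 / r ^ (?n + 1) * r ^ k = r ^ ?m" using r by simp
      then have "ennreal (1 / r ^ (?n + 1)) * ennreal (r ^ k) = ennreal (r ^ ?m)"
        using r by (subst ennreal_mult[symmetric]) (auto simp del: power_Suc)
      then show ?thesis using True by (simp add: r_def del: power_Suc)
    qed simp
  qed
  also have "\<dots> = ennreal (pi ^ ?n * fact ?m / fact (?m + ?n))" using assms by (intro nn_integral_ball_power) auto
  also have "?m + ?n = k - 1" using assms by simp
  finally have "(\<integral>\<^sup>+u. ennreal (gap (u :: complex ^ 'n) ^ k) \<partial>hyp_vol) = ennreal (4 ^ ?n) * ennreal (pi ^ ?n * fact ?m / fact (k - 1))"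
    by (subst nn_integral_hyp_vol) (auto simp del: power_Suc)
  also have "\<dots> = ennreal (weight_mass TYPE('n) k)"
    by (subst ennreal_mult[symmetric]) (auto simp: weight_mass_def power_mult_distrib)
  finally show ?thesis .
qed

text \<open>Raising n by one multiplies the expression by k/(k-n-1), which tends to 1. The factorial
  recursion holds once k is large enough for the subtractions not to truncate.\<close>

lemma power_fact_quotient_tendsto: "(\<lambda>k. real k ^ n * fact (k - n - 1) / fact (k - 1)) \<longlonglongrightarrow> 1"
proof (induction n)
  case 0
  have "(\<lambda>k. 1 :: real) \<longlonglongrightarrow> 1" by simp
  then show ?case by simp
next
  case (Suc n)
  have "(\<lambda>k. real k / (real k - real n - 1)) \<longlonglongrightarrow> 1" by real_asymp
  with Suc have "(\<lambda>k. real k ^ n * fact (k - n - 1) / fact (k - 1) * (real k / (real k - real n - 1))) \<longlonglongrightarrow> 1 * 1"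
    by (rule tendsto_mult)
  then have "(\<lambda>k. real k ^ n * fact (k - n - 1) / fact (k - 1) * (real k / (real k - real n - 1))) \<longlonglongrightarrow> 1" by simp
  then show ?case
  proof (rule Lim_transform_eventually)
    show "eventually (\<lambda>k. real k ^ n * fact (k - n - 1) / fact (k - 1) * (real k / (real k - real n - 1))
        = real k ^ Suc n * fact (k - Suc n - 1) / fact (k - 1)) sequentially"
      using eventually_gt_at_top[of "n + 2"]
    proof eventually_elim
      case (elim k)
      define a where "a = real k - real n - 1"
      define X where "X = (fact (k - Suc n - 1) :: real)"
      have a: "a \<noteq> 0" using elim unfolding a_def by linarith
      have "(fact (k - n - 1) :: real) = real (k - n - 1) * fact (k - n - 1 - 1)"
        using elim by (intro fact_reduce) auto
      also have "real (k - n - 1) = a" using elim by (simp add: a_def)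
      also have "fact (k - n - 1 - 1) = X" by (simp add: X_def)
      finally show ?case using a unfolding a_def[symmetric] X_def[symmetric] by simp
    qed
  qed
qed

lemma weight_mass_asymp:
  "(\<lambda>k. 1 / real k ^ CARD('n) * (1 / weight_mass TYPE('n::finite) k)) \<longlonglongrightarrow> 1 / (4 * pi) ^ CARD('n)"
proof -
  have "(\<lambda>k. 1 / (4 * pi) ^ CARD('n) * (1 / (real k ^ CARD('n) * fact (k - CARD('n) - 1) / fact (k - 1)))) \<longlonglongrightarrow> 1 / (4 * pi) ^ CARD('n) * (1 / 1)"
    by (intro tendsto_intros power_fact_quotient_tendsto) auto
  then show ?thesis by (simp add: weight_mass_def mult_ac)
qed

section \<open>The mean value property for weighted integrals over the ball\<close>

lemma holomorphic_ball_continuous: "holomorphic_ball f \<Longrightarrow> continuous_on unit_ball f"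
  unfolding holomorphic_ball_def by (meson continuous_at_imp_continuous_on has_derivative_continuous)

lemma holomorphic_ball_measurable:
  assumes "holomorphic_ball f" "\<And>z. z \<notin> unit_ball \<Longrightarrow> f z = 0"
  shows "f \<in> borel_measurable borel"
proof -
  have "(\<lambda>z. indicator unit_ball z *\<^sub>R f z) \<in> borel_measurable borel"
    by (rule borel_measurable_continuous_on_indicator[OF _ holomorphic_ball_continuous[OF assms(1)]]) simp
  also have "(\<lambda>z. indicator unit_ball z *\<^sub>R f z) = f" using assms(2) by (auto simp: fun_eq_iff indicator_def)
  finally show ?thesis .
qed

lemma has_derivative_vsmult_left:
  "((\<lambda>c. c *s z) has_derivative (\<lambda>h. h *s z)) (at (c::complex))" for z :: "complex ^ 'n::finite"
proof -
  have "linear (\<lambda>c. c *s z)" by (rule linearI) (simp_all add: vec_eq_iff algebra_simps)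
  then show ?thesis by (simp add: linear_conv_bounded_linear bounded_linear_imp_has_derivative)
qed

lemma norm_vsmult: "norm (c *s z) = cmod c * norm z" for z :: "complex ^ 'n::finite"
proof -
  have "(norm (c *s z))\<^sup>2 = (cmod c * norm z)\<^sup>2"
    unfolding power_mult_distrib cmod_power2_sum by (simp add: sum_distrib_left norm_mult power_mult_distrib)
  then show ?thesis by (metis norm_ge_zero power2_eq_iff_nonneg mult_nonneg_nonneg)
qed

text \<open>Cauchy's formula on the unit circle for the restriction of \<open>g\<close> to the
  complex line through \<open>z\<close>; the closed unit disc of that line, scaled by
  \<open>z\<close>, lies inside the ball.\<close>

lemma circle_mean:
  fixes z :: "complex ^ 'n::finite"
  assumes "holomorphic_ball g" "norm z < 1"
  shows "(LINT t|lborel. indicator {0..1} t *\<^sub>R g (exp (2 * of_real pi * \<i> * of_real t) *s z)) = g 0"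
proof -
  define F where "F \<zeta> = g (\<zeta> *s z)" for \<zeta>
  have hol: "F holomorphic_on cball 0 1"
    unfolding holomorphic_on_def
  proof
    fix \<zeta> :: complex assume "\<zeta> \<in> cball 0 1"
    then have "norm (\<zeta> *s z) < 1" using assms(2) unfolding norm_vsmult
      by (metis mem_cball_0 mult_left_le_one_le norm_ge_zero order_le_less_trans)
    then have "\<zeta> *s z \<in> unit_ball" by simp
    then obtain g' where g': "(g has_derivative g') (at (\<zeta> *s z))" "\<And>c v. g' (c *s v) = c * g' v"
      using assms(1) unfolding holomorphic_ball_def by blast
    have "(F has_derivative (\<lambda>h. g' (h *s z))) (at \<zeta>)"
      unfolding F_def by (rule has_derivative_compose[OF has_derivative_vsmult_left g'(1)])
    then have "(F has_field_derivative g' z) (at \<zeta>)"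
      unfolding has_field_derivative_def g'(2) by (metis (no_types, lifting) ext mult.commute)
    then show "F field_differentiable at \<zeta> within cball 0 1"
      using field_differentiable_def field_differentiable_at_within by blast
  qed
  have cancel: "inverse (2 * of_real pi * \<i>) * (2 * of_real pi * \<i> * x) = x" for x :: complex
    by (simp add: field_simps)
  have "((\<lambda>u. F u / (u - 0)) has_contour_integral (2 * of_real pi * \<i> * F 0)) (circlepath 0 1)"
    by (rule Cauchy_integral_circlepath_simple[OF hol]) simp
  then have "((\<lambda>x. F (circlepath 0 1 x) / circlepath 0 1 x * vector_derivative (circlepath 0 1) (at x within {0..1}))
      has_integral (2 * of_real pi * \<i> * F 0)) {0..1}"
    by (simp add: has_contour_integral_def)
  then have "((\<lambda>x. (2 * of_real pi * \<i>) * F (exp (2 * of_real pi * \<i> * of_real x))) has_integral (2 * of_real pi * \<i> * F 0)) {0..1}"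
    by (rule has_integral_cong[THEN iffD1, rotated]) (subst vector_derivative_circlepath01, auto simp: circlepath)
  then have "((\<lambda>x. inverse (2 * of_real pi * \<i>) * ((2 * of_real pi * \<i>) * F (exp (2 * of_real pi * \<i> * of_real x))))
      has_integral (inverse (2 * of_real pi * \<i>) * (2 * of_real pi * \<i> * F 0))) {0..1}"
    by (rule has_integral_mult_right)
  then have hi: "((\<lambda>x. F (exp (2 * of_real pi * \<i> * of_real x))) has_integral F 0) {0..1}"
    unfolding cancel .
  have "continuous_on {0..1::real} (\<lambda>x. F (exp (2 * of_real pi * \<i> * of_real x)))"
    by (rule continuous_on_compose2[OF holomorphic_on_imp_continuous_on[OF hol]]) (auto intro!: continuous_intros)
  then have si: "set_integrable lborel {0..1::real} (\<lambda>x. F (exp (2 * of_real pi * \<i> * of_real x)))"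
    by (rule borel_integrable_atLeastAtMost')
  have "(LINT t:{0..1}|lborel. F (exp (2 * of_real pi * \<i> * of_real t))) = F 0"
    using set_borel_integral_eq_integral(2)[OF si] integral_unique[OF hi] by simp
  then show ?thesis by (simp add: set_lebesgue_integral_def F_def)
qed

text \<open>The weight and Lebesgue measure are invariant under z \<mapsto> cz with |c| = 1, so the
  integral may be averaged over the circle. By Fubini the averaging is done at each point
  separately, where \<open>circle_mean\<close> replaces \<open>g\<close> by \<open>g 0\<close>. The
  bound \<open>bd\<close> makes the double integral absolutely convergent.\<close>

lemma mean_value_lborel:
  fixes g :: "complex ^ 'n::finite \<Rightarrow> complex"
  assumes hol: "holomorphic_ball g" and out: "\<And>z. z \<notin> unit_ball \<Longrightarrow> g z = 0"
    and bd: "\<And>z. norm z < 1 \<Longrightarrow> (gap z) ^ p * cmod (g z) \<le> C"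
  shows "integrable lborel (\<lambda>z. of_real (gap z ^ p) * g z)"
    "(LINT z|lborel. of_real (gap z ^ p) * g z)
      = g 0 * of_real (LINT z|lborel. indicator (unit_ball :: (complex ^ 'n) set) z * gap z ^ p)"
proof -
  let ?B = "unit_ball :: (complex ^ 'n) set"
  define h where "h z = complex_of_real (gap z ^ p) * g z" for z :: "complex ^ 'n"
  have [measurable]: "g \<in> borel_measurable borel" by (rule holomorphic_ball_measurable[OF hol out])
  have mh[measurable]: "h \<in> borel_measurable borel" unfolding h_def by measurable
  have C0: "C \<ge> 0" using bd[of 0] norm_ge_zero[of "g 0"] by (simp del: norm_ge_zero)
  have hb: "cmod (h z) \<le> C * indicator ?B z" for z
  proof (cases "norm z < 1")
    case True
    have "cmod (h z) = gap z ^ p * cmod (g z)"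
      using one_minus_norm_sq_pos[OF True] by (simp add: h_def norm_mult norm_power flip: of_real_power of_real_diff)
    then show ?thesis using bd[OF True] True by simp
  qed (use out in \<open>simp add: h_def\<close>)
  have iB: "integrable lborel (indicator ?B :: _ \<Rightarrow> real)"
    using emeasure_bounded_finite[of ?B] by (simp add: integrable_indicator_iff)
  show ih: "integrable lborel (\<lambda>z. of_real (gap z ^ p) * g z)"
    unfolding h_def[symmetric]
    by (rule Bochner_Integration.integrable_bound[of _ "\<lambda>z. C * indicator ?B z"]) (use iB hb C0 in auto)
  let ?e = "\<lambda>t. exp (2 * of_real pi * \<i> * complex_of_real t)"
  have e1: "cmod (?e t) = 1" for t by simp
  define f where "f z t = indicator {0..1::real} t *\<^sub>R h (?e t *s z)" for z t
  have rot: "(LINT z|lborel. h (?e t *s z)) = (LINT z|lborel. h z)" for t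
  proof -
    have "(LINT z|lborel. h z) = (LINT z|distr lborel borel (\<lambda>z. ?e t *s z). h z)" by (simp add: lborel_rotate)
    also have "\<dots> = (LINT z|lborel. h (?e t *s z))" by (rule integral_distr) measurable
    finally show ?thesis by simp
  qed
  have mf: "case_prod f \<in> borel_measurable (lborel \<Otimes>\<^sub>M lborel)"
  proof -
    have c1: "(\<lambda>x :: (complex ^ 'n) \<times> real. ?e (snd x) *s fst x) \<in> borel_measurable borel"
      by (rule borel_measurable_continuous_onI) (intro continuous_intros)
    have c2: "(\<lambda>x :: (complex ^ 'n) \<times> real. indicator {0..1} (snd x) :: real) \<in> borel_measurable borel"
      by (rule measurable_compose[of snd _ borel]) (auto intro!: borel_measurable_continuous_onI continuous_intros)
    have "(\<lambda>x :: (complex ^ 'n) \<times> real. indicator {0..1} (snd x) *\<^sub>R h (?e (snd x) *s fst x)) \<in> borel_measurable borel"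
      by (intro borel_measurable_scaleR c2 measurable_compose[OF c1 mh])
    then show ?thesis by (simp add: lborel_prod f_def case_prod_beta')
  qed
  have int: "integrable (lborel \<Otimes>\<^sub>M lborel) (case_prod f)"
  proof (rule Bochner_Integration.integrable_bound[of _ "\<lambda>x. C * indicator (?B \<times> {0..1::real}) x"])
    have "emeasure (lborel \<Otimes>\<^sub>M lborel) (?B \<times> {0..1::real}) = emeasure lborel ?B * emeasure lborel {0..1::real}"
      by (rule lborel.emeasure_pair_measure_Times) auto
    also have "\<dots> < \<infinity>" using emeasure_bounded_finite[of ?B] by (simp add: ennreal_mult_less_top)
    finally show "integrable (lborel \<Otimes>\<^sub>M lborel) (\<lambda>x. C * indicator (?B \<times> {0..1::real}) x)"
      by (intro integrable_mult_right integrable_real_indicator) auto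
    show "AE x in lborel \<Otimes>\<^sub>M lborel. norm (case_prod f x) \<le> norm (C * indicator (?B \<times> {0..1}) x)"
    proof (rule AE_I2)
      fix x :: "(complex ^ 'n) \<times> real"
      obtain z t where x: "x = (z, t)" by (cases x)
      show "norm (case_prod f x) \<le> norm (C * indicator (?B \<times> {0..1}) x)"
        using hb[of "?e t *s z"] C0 by (auto simp: x f_def norm_vsmult indicator_def split: if_splits)
    qed
  qed (rule mf)
  have "(LINT z|lborel. h z) = (LINT t|lborel. indicator {0..1::real} t *\<^sub>R (LINT z|lborel. h z))"
    by simp
  also have "\<dots> = (LINT t|lborel. LINT z|lborel. f z t)" by (simp add: f_def rot)
  also have "\<dots> = (LINT z|lborel. LINT t|lborel. f z t)" by (rule lborel_pair.Fubini_integral[OF int])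
  also have "\<dots> = (LINT z|lborel. g 0 * of_real (indicator ?B z * gap z ^ p))"
  proof (rule Bochner_Integration.integral_cong[OF refl])
    fix z :: "complex ^ 'n"
    show "(LINT t|lborel. f z t) = g 0 * of_real (indicator ?B z * gap z ^ p)"
    proof (cases "norm z < 1")
      case True
      have "(LINT t|lborel. f z t) = (LINT t|lborel. complex_of_real (gap z ^ p) * (indicator {0..1::real} t *\<^sub>R g (?e t *s z)))"
        by (simp add: f_def h_def norm_vsmult)
      also have "\<dots> = complex_of_real (gap z ^ p) * g 0"
        by (subst integral_mult_right_zero) (simp only: circle_mean[OF hol True])
      finally show ?thesis using True by (simp add: mult.commute)
    next
      case False
      then have "f z t = 0" for t using out[of "?e t *s z"] by (simp add: f_def h_def norm_vsmult)
      then show ?thesis using False by simp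
    qed
  qed
  also have "\<dots> = g 0 * of_real (LINT z|lborel. indicator ?B z * gap z ^ p)"
    by (subst integral_mult_right_zero) (simp only: integral_complex_of_real)
  finally show "(LINT z|lborel. of_real (gap z ^ p) * g z)
      = g 0 * of_real (LINT z|lborel. indicator ?B z * gap z ^ p)" by (simp add: h_def)
qed

subsection \<open>Poincare series\<close>

lemma holomorphic_ball_cong:
  assumes "holomorphic_ball f" and eq: "\<And>z. z \<in> unit_ball \<Longrightarrow> f z = g z"
  shows "holomorphic_ball g"
  unfolding holomorphic_ball_def
proof
  fix z :: "complex ^ 'a" assume z: "z \<in> unit_ball"
  then obtain f' where f': "(f has_derivative f') (at z)" "\<forall>c v. f' (c *s v) = c * f' v"
    using assms(1) unfolding holomorphic_ball_def by blast
  have "(g has_derivative f') (at z)"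
    by (rule has_derivative_transform_within_open[OF f'(1) open_ball z eq])
  then show "\<exists>f'. (g has_derivative f') (at z) \<and> (\<forall>c v. f' (c *s v) = c * f' v)" using f'(2) by blast
qed

text \<open>A Weierstrass test on derivatives: the bounds \<open>b\<close> make the differentiated
  series converge uniformly near each point, and complex linearity of the derivative passes to the
  sum.\<close>

lemma holomorphic_series:
  fixes f :: "nat \<Rightarrow> complex ^ 'n::finite \<Rightarrow> complex"
  assumes loc: "\<And>z. norm z < 1 \<Longrightarrow> \<exists>r>0. \<exists>b. ball z r \<subseteq> unit_ball \<and> summable b \<and>
      (\<forall>m. \<forall>u\<in>ball z r. (f m has_derivative f' m u) (at u) \<and> (\<forall>h. cmod (f' m u h) \<le> b m * norm h))"
    and lin: "\<And>m u c v. norm u < 1 \<Longrightarrow> f' m u (c *s v) = c * f' m u v"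
    and summ: "\<And>z. norm z < 1 \<Longrightarrow> summable (\<lambda>m. f m z)"
  shows "holomorphic_ball (\<lambda>z. \<Sum>m. f m z)"
  unfolding holomorphic_ball_def
proof
  fix z :: "complex ^ 'n" assume "z \<in> unit_ball"
  then have z: "norm z < 1" by simp
  then obtain r b where r: "r > 0" "ball z r \<subseteq> unit_ball" and b: "summable b"
    and f': "\<And>m u. u \<in> ball z r \<Longrightarrow> (f m has_derivative f' m u) (at u)"
    and bd: "\<And>m u h. u \<in> ball z r \<Longrightarrow> cmod (f' m u h) \<le> b m * norm h" using loc[OF z] by blast
  define g' where "g' u h = (\<Sum>m. f' m u h)" for u h
  have sf: "summable (\<lambda>m. f' m u h)" if "u \<in> ball z r" for u h
    by (rule summable_comparison_test'[OF summable_mult2[OF b, of "norm h"]]) (use bd[OF that] in auto)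
  obtain y where "norm (y :: complex ^ 'n) = 1" using vector_choose_size[of 1] by auto
  then have b0: "b m \<ge> 0" for m using order.trans[OF norm_ge_zero bd[of z m y]] r by simp
  have "\<exists>g. \<forall>x\<in>ball z r. (\<lambda>m. f m x) sums (g x) \<and> (g has_derivative g' x) (at x within ball z r)"
  proof (rule has_derivative_series[where x = z and l = "\<Sum>m. f m z"])
    fix e :: real assume e: "e > 0"
    have "(\<lambda>n. \<Sum>i. b (i + n)) \<longlonglongrightarrow> 0" by (rule suminf_exist_split2[OF b])
    then have "eventually (\<lambda>n. (\<Sum>i. b (i + n)) < e) sequentially" using e by (rule order_tendstoD)
    then show "\<forall>\<^sub>F n in sequentially. \<forall>x\<in>ball z r. \<forall>h. cmod ((\<Sum>i<n. f' i x h) - g' x h) \<le> e * norm h"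
    proof eventually_elim
      case (elim n)
      show ?case
      proof (intro ballI allI)
        fix x h :: "complex ^ 'n" assume x: "x \<in> ball z r"
        have s1: "summable (\<lambda>i. b (i + n) * norm h)" using b by (intro summable_mult2) (simp add: summable_iff_shift)
        have "g' x h = (\<Sum>i. f' (i + n) x h) + (\<Sum>i<n. f' i x h)"
          unfolding g'_def by (rule suminf_split_initial_segment[OF sf[OF x]])
        then have "cmod ((\<Sum>i<n. f' i x h) - g' x h) = cmod (\<Sum>i. f' (i + n) x h)" by (simp add: norm_minus_commute)
        also have "\<dots> \<le> (\<Sum>i. b (i + n) * norm h)"
          by (rule norm_suminf_le[OF _ s1]) (rule bd[OF x])
        also have "\<dots> = (\<Sum>i. b (i + n)) * norm h" using b by (intro suminf_mult2[symmetric]) (simp add: summable_iff_shift)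
        also have "\<dots> \<le> e * norm h" using elim by (intro mult_right_mono) auto
        finally show "cmod ((\<Sum>i<n. f' i x h) - g' x h) \<le> e * norm h" .
      qed
    qed
  qed (use r f' summ[OF z] in \<open>auto intro: has_derivative_at_withinI\<close>)
  then obtain g where g: "\<And>x. x \<in> ball z r \<Longrightarrow> (\<lambda>m. f m x) sums (g x)"
    "\<And>x. x \<in> ball z r \<Longrightarrow> (g has_derivative g' x) (at x within ball z r)" by blast
  have zr: "z \<in> ball z r" using r by simp
  have "(g has_derivative g' z) (at z)" using g(2)[OF zr] at_within_open[OF zr] by simp
  then have "((\<lambda>z. \<Sum>m. f m z) has_derivative g' z) (at z)"
    by (rule has_derivative_transform_within_open[OF _ open_ball zr]) (use g(1) sums_unique in blast)
  moreover have "g' z (c *s v) = c * g' z v" for c v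
    unfolding g'_def lin[OF z] by (rule suminf_mult[OF sf[OF zr]])
  ultimately show "\<exists>f'. ((\<lambda>z. \<Sum>m. f m z) has_derivative f') (at z) \<and> (\<forall>c v. f' (c *s v) = c * f' v)" by blast
qed

text \<open>The denominator \<open>j(\<gamma>,z) (1 - \<langle>\<gamma>z,w\<rangle>)\<close> of the Poincare series, written as an affine function of \<open>z\<close>.\<close>

definition ell :: "'n::finite mat1 \<Rightarrow> complex ^ 'n \<Rightarrow> complex ^ 'n \<Rightarrow> complex" where
  "ell M w z = aut_factor M z - herm (block_A M *v z + block_B M) w"

definition ell_lin :: "'n::finite mat1 \<Rightarrow> complex ^ 'n \<Rightarrow> complex ^ 'n \<Rightarrow> complex" where
  "ell_lin M w h = (\<Sum>j\<in>UNIV. block_C M $ j * h $ j) - herm (block_A M *v h) w"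

lemma herm_add_left: "herm (x + y) w = herm x w + herm y w"
  by (simp add: herm_def algebra_simps sum.distrib)

lemma herm_scale_left: "herm (c *s x) w = c * herm x w"
  by (simp add: herm_def sum_distrib_left mult.assoc)

lemma ell_eq:
  assumes "aut_factor M z \<noteq> 0"
  shows "ell M w z = aut_factor M z * Q_ker (act M z) w"
  unfolding ell_def Q_ker_def act_def herm_scale_left using assms by (simp add: right_diff_distrib)

lemma ell_nz:
  assumes "M \<in> unitary_n1" "norm z < 1" "norm w < 1"
  shows "ell M w z \<noteq> 0"
  using aut_factor_nz[OF assms(1,2)] Q_ker_nz[OF act_ball[OF assms(1,2)] assms(3)] by (simp add: ell_eq)

lemma ell_add: "ell M w (z + h) = ell M w z + ell_lin M w h"
  by (simp add: ell_def ell_lin_def aut_factor_def herm_add_left matrix_vector_right_distrib algebra_simps sum.distrib)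

lemma ell_lin_scale: "ell_lin M w (c *s h) = c * ell_lin M w h"
  by (simp add: ell_lin_def vector_scalar_commute herm_scale_left sum_distrib_left algebra_simps)

lemma linear_ell_lin: "linear (ell_lin M w)"
proof (rule linearI)
  show "ell_lin M w (x + y) = ell_lin M w x + ell_lin M w y" for x y
    by (simp add: ell_lin_def herm_add_left matrix_vector_right_distrib algebra_simps sum.distrib)
  show "ell_lin M w (r *\<^sub>R x) = r *\<^sub>R ell_lin M w x" for r x
  proof -
    have "r *\<^sub>R x = complex_of_real r *s x" by (simp add: vec_eq_iff scaleR_conv_of_real[where 'a=complex])
    then show ?thesis by (simp add: ell_lin_scale scaleR_conv_of_real)
  qed
qed

lemma ell_has_derivative: "(ell M w has_derivative ell_lin M w) (at z)"
proof -
  have "ell M w = (\<lambda>z. ell M w 0 + ell_lin M w z)" by (rule ext) (subst ell_add[symmetric], simp)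
  moreover have "((\<lambda>z. ell M w 0 + ell_lin M w z) has_derivative ell_lin M w) (at z)"
    using bounded_linear_imp_has_derivative[of "ell_lin M w"] linear_ell_lin[of M w]
    by (auto simp: linear_conv_bounded_linear intro!: derivative_eq_intros)
  ultimately show ?thesis by metis
qed

text \<open>An affine function without zeros in the ball has a controlled logarithmic derivative.\<close>

lemma ell_lin_bound:
  assumes "M \<in> unitary_n1" "norm z < 1" "norm w < 1"
  shows "cmod (ell_lin M w h) * (1 - norm z) \<le> cmod (ell M w z) * norm h"
proof (rule ccontr)
  assume c: "\<not> ?thesis"
  \<comment> \<open>The affine function vanishes at \<open>z + s *s h\<close>. If the bound failed,
    this zero would lie in the ball.\<close>
  define s where "s = - ell M w z / ell_lin M w h"
  have l0: "ell_lin M w h \<noteq> 0" using c by (auto simp: not_le mult_less_0_iff)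
  have "cmod s * norm h < 1 - norm z"
    using c l0 by (simp add: s_def norm_divide field_simps)
  then have "norm (z + s *s h) < 1" using norm_triangle_ineq[of z "s *s h"] by (simp add: norm_vsmult)
  moreover have "ell M w (z + s *s h) = 0" unfolding ell_add ell_lin_scale s_def using l0 by simp
  ultimately show False using ell_nz[OF assms(1) _ assms(3)] by blast
qed

text \<open>The identity |\<open>ell\<close>|^2 = \<open>gap z * gap w / rho (act M z) w\<close>:
  apart from factors independent of the matrix, the size of a term depends only on the distance from
  \<open>act M z\<close> to \<open>w\<close>.\<close>

lemma cmod_ell:
  assumes "M \<in> unitary_n1" "norm z < 1" "norm w < 1"
  shows "cmod (inverse (ell M w z ^ k)) = (sqrt (rho (act M z) w) / sqrt (gap z * (gap w))) ^ k"
proof -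
  define q where "q = gap (act M z)"
  have q: "q > 0" using one_minus_norm_sq_pos[OF act_ball[OF assms(1,2)]] by (simp add: q_def)
  define W where "W = gap w"
  have w: "W > 0" using one_minus_norm_sq_pos[OF assms(3)] by (simp add: W_def)
  have z: "gap z = q * (cmod (aut_factor M z))\<^sup>2" using one_minus_norm_act[OF assms(1,2)] by (simp add: q_def)
  have a0: "aut_factor M z \<noteq> 0" by (rule aut_factor_nz[OF assms(1,2)])
  have eq: "rho (act M z) w / (gap z * (gap w)) = (1 / cmod (ell M w z))\<^sup>2"
    unfolding rho_def z q_def[symmetric] W_def[symmetric] ell_eq[OF a0] norm_mult using q w
    by (simp add: power_divide power_mult_distrib)
  have "sqrt (rho (act M z) w) / sqrt (gap z * (gap w)) = 1 / cmod (ell M w z)"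
    unfolding real_sqrt_divide[symmetric] eq real_sqrt_abs by simp
  then show ?thesis by (simp add: norm_inverse norm_power inverse_eq_divide norm_divide power_divide)
qed

lemma sqrt_power_le:
  assumes "0 \<le> x" "x \<le> 1" "k \<ge> 2 * m"
  shows "sqrt x ^ k \<le> x ^ m"
proof -
  have "sqrt x ^ k \<le> sqrt x ^ (2 * m)" using assms by (intro power_decreasing) auto
  also have "\<dots> = x ^ m" using assms by (simp add: power_mult)
  finally show ?thesis .
qed

text \<open>Of the k factors \<open>sqrt (rho (act M z) w)\<close>, each at most 1, only 2n+2 are
  kept: enough for summability over the lattice.\<close>

lemma cmod_ell_le:
  fixes z :: "complex ^ 'n::finite"
  assumes "M \<in> unitary_n1" "norm z < 1" "norm w < 1" "k \<ge> 2 * CARD('n) + 2"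
  shows "cmod (inverse (ell M w z ^ k)) \<le> rho (act M z) w ^ (CARD('n) + 1) * (1 / sqrt (gap z * (gap w))) ^ k"
proof -
  have "sqrt (rho (act M z) w) ^ k \<le> rho (act M z) w ^ (CARD('n) + 1)"
    using rho_pos[OF act_ball[OF assms(1,2)] assms(3)] rho_le_1[OF act_ball[OF assms(1,2)] assms(3)] assms(4)
    by (intro sqrt_power_le) auto
  then have "sqrt (rho (act M z) w) ^ k * (1 / sqrt (gap z * (gap w))) ^ k
     \<le> rho (act M z) w ^ (CARD('n) + 1) * (1 / sqrt (gap z * (gap w))) ^ k"
    using one_minus_norm_sq_pos[OF assms(2)] one_minus_norm_sq_pos[OF assms(3)] by (intro mult_right_mono) auto
  then show ?thesis unfolding cmod_ell[OF assms(1-3)] by (simp add: power_divide)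
qed

section \<open>Convergence, holomorphy and automorphy of the Poincare series\<close>

context cocompact_lattice
begin

text \<open>Finitely many translates of the compact core would cover the open ball and make it
  compact. Infinitude allows \<Gamma> to be enumerated bijectively by the natural numbers, so that
  theorems on ordinary series apply.\<close>

lemma infinite_Gamma: "infinite \<Gamma>"
proof
  assume fin: "finite \<Gamma>"
  obtain R where R: "0 < R" "R < 1" "\<And>z. norm z < 1 \<Longrightarrow> \<exists>\<gamma>\<in>\<Gamma>. norm (act \<gamma> z) \<le> R" using cocompact_radius by blast
  have sub: "cball 0 R \<subseteq> (unit_ball :: (complex^'n) set)" using R by auto
  have "unit_ball = (\<Union>\<gamma>\<in>\<Gamma>. act \<gamma> ` cball 0 R)"
  proof (intro equalityI subsetI)
    fix z :: "complex ^ 'n" assume "z \<in> unit_ball"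
    then have z: "norm z < 1" by simp
    then obtain \<gamma> where g: "\<gamma> \<in> \<Gamma>" "norm (act \<gamma> z) \<le> R" using R by blast
    have "z = act (u_inv \<gamma>) (act \<gamma> z)" using act_u_inv(1)[OF Gamma_unitary[OF g(1)] z] by simp
    then show "z \<in> (\<Union>\<gamma>\<in>\<Gamma>. act \<gamma> ` cball 0 R)" using Gamma_inv[OF g(1)] g(2) by (intro UN_I[of "u_inv \<gamma>"] image_eqI) auto
  next
    fix z :: "complex ^ 'n" assume "z \<in> (\<Union>\<gamma>\<in>\<Gamma>. act \<gamma> ` cball 0 R)"
    then show "z \<in> unit_ball" using act_ball[OF Gamma_unitary] R by auto
  qed
  moreover have "compact (\<Union>\<gamma>\<in>\<Gamma>. act \<gamma> ` cball 0 R)"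
    using fin by (intro compact_UN compact_continuous_image continuous_on_subset[OF continuous_on_act sub]) (auto simp: Gamma_unitary)
  ultimately have "closed (unit_ball :: (complex ^ 'n) set)" using compact_imp_closed by metis
  then have cl: "(unit_ball :: (complex ^ 'n) set) = {} \<or> unit_ball = (UNIV :: (complex ^ 'n) set)" using clopen[of "unit_ball :: (complex ^ 'n) set"] open_ball by blast
  obtain y where "norm (y :: complex ^ 'n) = 1" using vector_choose_size[of 1] by auto
  then have "y \<notin> unit_ball" "(0 :: complex ^ 'n) \<in> unit_ball" by auto
  then show False using cl by blast
qed

lemma rho_summable:
  assumes "norm z < 1" "norm w < 1"
  shows "(\<lambda>\<gamma>. rho (act \<gamma> z) w ^ (CARD('n) + 1)) summable_on \<Gamma>"
proof (rule nonneg_bdd_above_summable_on)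
  show "0 \<le> rho (act \<gamma> z) w ^ (CARD('n) + 1)" if "\<gamma> \<in> \<Gamma>" for \<gamma>
    using rho_pos[OF act_ball[OF Gamma_unitary[OF that] assms(1)] assms(2)] by simp
  obtain C where "0 < C" "\<And>T z w. finite T \<Longrightarrow> T \<subseteq> \<Gamma> \<Longrightarrow> norm z < 1 \<Longrightarrow> norm w < 1 \<Longrightarrow> (\<Sum>\<gamma>\<in>T. rho (act \<gamma> z) w ^ (CARD('n) + 1)) \<le> C"
    by (rule rho_sum_bound) (rule that, assumption, presburger)
  then show "bdd_above (sum (\<lambda>\<gamma>. rho (act \<gamma> z) w ^ (CARD('n) + 1)) ` {F. F \<subseteq> \<Gamma> \<and> finite F})"
    using assms by (intro bdd_aboveI2[of _ _ C]) auto
qed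

lemma ell_abs_summable:
  assumes "norm z < 1" "norm w < 1" "k \<ge> 2 * CARD('n) + 2"
  shows "(\<lambda>\<gamma>. cmod (inverse (ell \<gamma> w z ^ k))) summable_on \<Gamma>"
  by (rule Infinite_Sum.abs_summable_on_comparison_test'[OF summable_on_cmult_left[OF rho_summable[OF assms(1,2)]]])
     (rule cmod_ell_le[OF Gamma_unitary assms])

text \<open>The unordered sum can be reindexed by translations of \<Gamma> directly. The value 0
  outside the ball follows the convention for cusp forms.\<close>

definition poincare :: "nat \<Rightarrow> complex ^ 'n \<Rightarrow> complex ^ 'n \<Rightarrow> complex" where
  "poincare k w z = (if norm z < 1 then infsum (\<lambda>\<gamma>. inverse (ell \<gamma> w z ^ k)) \<Gamma> else 0)"

lemma poincare_sums:
  assumes e: "bij_betw e (UNIV :: nat set) \<Gamma>" and "norm z < 1" "norm w < 1" "k \<ge> 2 * CARD('n) + 2"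
  shows "(\<lambda>m. inverse (ell (e m) w z ^ k)) sums poincare k w z" "summable (\<lambda>m. cmod (inverse (ell (e m) w z ^ k)))"
proof -
  have "((\<lambda>\<gamma>. inverse (ell \<gamma> w z ^ k)) has_sum poincare k w z) \<Gamma>"
    using abs_summable_summable[OF ell_abs_summable[OF assms(2-)]] assms(2) by (simp add: poincare_def)
  then show "(\<lambda>m. inverse (ell (e m) w z ^ k)) sums poincare k w z"
    using has_sum_reindex_bij_betw[OF e, of "\<lambda>\<gamma>. inverse (ell \<gamma> w z ^ k)"] has_sum_imp_sums by blast
  show "summable (\<lambda>m. cmod (inverse (ell (e m) w z ^ k)))"
    using summable_on_reindex_bij_betw[OF e, of "\<lambda>\<gamma>. cmod (inverse (ell \<gamma> w z ^ k))"] ell_abs_summable[OF assms(2-)]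
      summable_on_imp_summable by blast
qed

lemma enumeration: "bij_betw (from_nat_into \<Gamma>) UNIV \<Gamma>"
  by (rule bij_betw_from_nat_into[OF countable_Gamma infinite_Gamma])

lemma poincare_holomorphic:
  assumes w: "norm w < 1" and k: "k \<ge> 2 * CARD('n) + 2"
  shows "holomorphic_ball (poincare k w)"
proof -
  define e where "e = from_nat_into \<Gamma>"
  have e: "bij_betw e UNIV \<Gamma>" using enumeration by (simp add: e_def)
  have eG: "e m \<in> \<Gamma>" for m using e by (auto simp: bij_betw_def)
  have eU: "e m \<in> unitary_n1" for m using Gamma_unitary[OF eG] .
  define D where "D x = - (of_nat k * x ^ (k - 1)) / (x ^ k)\<^sup>2" for x :: complex
  have D: "((\<lambda>x. inverse (x ^ k)) has_field_derivative D x) (at x)" if "x \<noteq> 0" for x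
    unfolding D_def using that
    by (auto intro!: derivative_eq_intros simp: power2_eq_square field_simps)
  have Dn: "cmod (D x) * cmod x = real k * cmod (inverse (x ^ k))" if "x \<noteq> 0" for x
  proof -
    have "k = Suc (k - 1)" using k by simp
    then have "x ^ k = x * x ^ (k - 1)" by (metis power_Suc)
    then have "D x * x = - (of_nat k * inverse (x ^ k))" using that
      by (simp add: D_def power2_eq_square field_simps)
    then show ?thesis by (metis norm_mult norm_minus_cancel norm_of_nat)
  qed
  define f' where "f' m u h = D (ell (e m) w u) * ell_lin (e m) w h" for m u h
  have "holomorphic_ball (\<lambda>z. \<Sum>m. inverse (ell (e m) w z ^ k))"
  proof (rule holomorphic_series[where f' = f'])
    show "f' m u (c *s v) = c * f' m u v" for m u c v by (simp add: f'_def ell_lin_scale mult_ac)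
    show "summable (\<lambda>m. inverse (ell (e m) w z ^ k))" if "norm z < 1" for z
      using poincare_sums(1)[OF e that w k] by (simp add: sums_iff)
    fix z :: "complex ^ 'n" assume z: "norm z < 1"
    define s where "s = (1 + norm z) / 2"
    have s: "norm z < s" "s < 1" using z by (auto simp: s_def)
    have s0: "0 < s" using s(1) norm_ge_zero[of z] by linarith
    define V where "V = {u \<in> unit_ball. rho u z > 1/2}"
    have "open V"
    proof -
      have "continuous_on unit_ball (\<lambda>u. rho u z)" using z by (intro continuous_on_rho continuous_intros) auto
      then have "open (unit_ball \<inter> (\<lambda>u. rho u z) -` {1/2<..})"
        using continuous_on_open_vimage[of "unit_ball :: (complex ^ 'n) set" "\<lambda>u. rho u z"] by (simp add: Int_commute)
      moreover have "unit_ball \<inter> (\<lambda>u. rho u z) -` {1/2<..} = V" by (auto simp: V_def)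
      ultimately show ?thesis by simp
    qed
    then have "open (V \<inter> ball 0 s)" using open_Int open_ball by blast
    moreover have "z \<in> V \<inter> ball 0 s" using z s rho_self[OF z] by (simp add: V_def)
    ultimately obtain r where r: "r > 0" "ball z r \<subseteq> V \<inter> ball 0 s" by (meson openE)
    define a where "a = 1 / sqrt ((1 - s\<^sup>2) * (gap w))"
    \<comment> \<open>A majorant for the derivatives on \<open>ball z r\<close>: k/(1-s) comes from
      the logarithmic derivative of the affine denominator, 8 = 4/(1/2) from comparing
      \<open>rho\<close> at u and z with \<open>rho u z > 1/2\<close>, and \<open>a ^ k\<close>
      bounds the power of the gaps, as |u| < s.\<close>
    define b where "b m = real k / (1 - s) * (8 ^ (CARD('n) + 1) * a ^ k) * rho (act (e m) z) w ^ (CARD('n) + 1)" for m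
    have "summable (\<lambda>m. rho (act (e m) z) w ^ (CARD('n) + 1))"
      using rho_summable[OF z w] summable_on_reindex_bij_betw[OF e, of "\<lambda>\<gamma>. rho (act \<gamma> z) w ^ (CARD('n) + 1)"]
        summable_on_imp_summable by blast
    then have "summable b" unfolding b_def by (rule summable_mult)
    moreover have "((\<lambda>z. inverse (ell (e m) w z ^ k)) has_derivative f' m u) (at u) \<and> (\<forall>h. cmod (f' m u h) \<le> b m * norm h)"
      if "u \<in> ball z r" for m u
    proof -
      have u: "norm u < 1" "rho u z > 1/2" "norm u < s" using that r by (auto simp: V_def)
      let ?x = "ell (e m) w u"
      have x0: "?x \<noteq> 0" by (rule ell_nz[OF eU u(1) w])
      have fe: "f' m u = (\<lambda>h. D ?x * ell_lin (e m) w h)" by (simp add: f'_def fun_eq_iff)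
      have "((\<lambda>z. inverse (ell (e m) w z ^ k)) has_derivative f' m u) (at u)" unfolding fe
        by (rule has_derivative_compose[OF ell_has_derivative D[OF x0, unfolded has_field_derivative_def]])
      moreover have "cmod (f' m u h) \<le> b m * norm h" for h
      proof -
        have s2: "s\<^sup>2 < 1" using s s0 by (simp add: abs_square_less_1)
        have us: "1 - s\<^sup>2 \<le> gap u" using u(3) s0 by (simp add: power_mono)
        have "rho (act (e m) z) (act (e m) u) = rho u z" using rho_act[OF eU z u(1)] by (simp add: rho_sym)
        then have "rho (act (e m) z) w \<ge> (1/2) / 4 * rho (act (e m) u) w"
          using u(2) by (intro rho_compare[OF act_ball[OF eU z] act_ball[OF eU u(1)] w]) auto
        then have "rho (act (e m) u) w ^ (CARD('n) + 1) \<le> (8 * rho (act (e m) z) w) ^ (CARD('n) + 1)"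
          using rho_pos[OF act_ball[OF eU[of m] u(1)] w] by (intro power_mono) auto
        moreover have "(1 / sqrt (gap u * (gap w))) ^ k \<le> a ^ k"
          unfolding a_def using s2 us one_minus_norm_sq_pos[OF w] 
          by (intro power_mono divide_left_mono real_sqrt_le_mono mult_right_mono mult_pos_pos real_sqrt_gt_zero) auto
        ultimately have "rho (act (e m) u) w ^ (CARD('n) + 1) * (1 / sqrt (gap u * (gap w))) ^ k
            \<le> (8 * rho (act (e m) z) w) ^ (CARD('n) + 1) * a ^ k"
          using rho_pos[OF act_ball[OF eU[of m] z] w] us s2 one_minus_norm_sq_pos[OF w] by (intro mult_mono) auto
        then have B: "cmod (inverse (?x ^ k)) \<le> (8 * rho (act (e m) z) w) ^ (CARD('n) + 1) * a ^ k"
          by (rule order.trans[OF cmod_ell_le[OF eU u(1) w k]])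
        have "cmod (ell_lin (e m) w h) * (1 - s) \<le> cmod (ell_lin (e m) w h) * (1 - norm u)"
          using u(3) by (intro mult_left_mono) auto
        also have "\<dots> \<le> cmod ?x * norm h" by (rule ell_lin_bound[OF eU u(1) w])
        finally have "cmod (D ?x) * (cmod (ell_lin (e m) w h) * (1 - s)) \<le> cmod (D ?x) * (cmod ?x * norm h)"
          by (intro mult_left_mono) auto
        also have "\<dots> = real k * cmod (inverse (?x ^ k)) * norm h" using Dn[OF x0] by (simp add: mult.assoc[symmetric])
        also have "\<dots> \<le> real k * ((8 * rho (act (e m) z) w) ^ (CARD('n) + 1) * a ^ k) * norm h"
          using B by (intro mult_right_mono mult_left_mono) auto
        finally have "cmod (f' m u h) * (1 - s) \<le> real k * ((8 * rho (act (e m) z) w) ^ (CARD('n) + 1) * a ^ k) * norm h"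
          by (simp add: f'_def norm_mult mult.assoc)
        then have "cmod (f' m u h) \<le> real k * ((8 * rho (act (e m) z) w) ^ (CARD('n) + 1) * a ^ k) * norm h / (1 - s)"
          using s by (simp add: pos_le_divide_eq)
        also have "\<dots> = b m * norm h" by (simp add: b_def power_mult_distrib mult_ac)
        finally show ?thesis .
      qed
      ultimately show ?thesis by blast
    qed
    moreover have "ball z r \<subseteq> unit_ball" using r by (auto simp: V_def)
    ultimately show "\<exists>r>0. \<exists>b. ball z r \<subseteq> unit_ball \<and> summable b \<and>
      (\<forall>m. \<forall>u\<in>ball z r. ((\<lambda>z. inverse (ell (e m) w z ^ k)) has_derivative f' m u) (at u) \<and> (\<forall>h. cmod (f' m u h) \<le> b m * norm h))"
      using r(1) by blast
  qed
  moreover have eq: "(\<Sum>m. inverse (ell (e m) w z ^ k)) = poincare k w z" if "z \<in> unit_ball" for z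
    using poincare_sums(1)[OF e _ w k, of z] that by (simp add: sums_iff)
  ultimately show ?thesis by (rule holomorphic_ball_cong)
qed

text \<open>The cocycle rule gives \<open>ell (\<gamma> ** \<delta>) w z = ell \<gamma> w (act
  \<delta> z) * aut_factor \<delta> z\<close>; automorphy is the reindexing of \<Gamma> by right
  multiplication with \<delta>.\<close>

lemma poincare_cusp_form:
  assumes w: "norm w < 1" and k: "k \<ge> 2 * CARD('n) + 2"
  shows "poincare k w \<in> cusp_forms \<Gamma> k"
proof -
  have "poincare k w (act \<delta> z) = aut_factor \<delta> z ^ k * poincare k w z" if d: "\<delta> \<in> \<Gamma>" and z: "norm z < 1" for \<delta> z
  proof -
    note ud = Gamma_unitary[OF d]
    have a: "aut_factor \<delta> z \<noteq> 0" by (rule aut_factor_nz[OF ud z])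
    have "inverse (ell \<gamma> w (act \<delta> z) ^ k) = aut_factor \<delta> z ^ k * inverse (ell (\<gamma> ** \<delta>) w z ^ k)" if "\<gamma> \<in> \<Gamma>" for \<gamma>
    proof -
      note ug = Gamma_unitary[OF that]
      have "ell (\<gamma> ** \<delta>) w z = ell \<gamma> w (act \<delta> z) * aut_factor \<delta> z"
        using act_aut_mult[OF ug ud z] aut_factor_nz[OF unitary_mult[OF ug ud] z] aut_factor_nz[OF ug act_ball[OF ud z]]
        by (simp add: ell_eq mult_ac)
      then show ?thesis using a by (simp add: power_mult_distrib)
    qed
    then have "poincare k w (act \<delta> z) = infsum (\<lambda>\<gamma>. aut_factor \<delta> z ^ k * inverse (ell (\<gamma> ** \<delta>) w z ^ k)) \<Gamma>"
      using act_ball[OF ud z] by (simp add: poincare_def cong: infsum_cong)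
    also have "\<dots> = aut_factor \<delta> z ^ k * infsum (\<lambda>\<gamma>. inverse (ell (\<gamma> ** \<delta>) w z ^ k)) \<Gamma>"
      using a by (intro infsum_cmult_right') 
    also have "infsum (\<lambda>\<gamma>. inverse (ell (\<gamma> ** \<delta>) w z ^ k)) \<Gamma> = infsum (\<lambda>\<gamma>. inverse (ell \<gamma> w z ^ k)) \<Gamma>"
      by (rule infsum_reindex_bij_betw[OF Gamma_bij[OF d], of "\<lambda>\<gamma>. inverse (ell \<gamma> w z ^ k)"])
    finally show ?thesis using z by (simp add: poincare_def)
  qed
  then show ?thesis using poincare_holomorphic[OF assms] by (auto simp: cusp_forms_def poincare_def)
qed

text \<open>The function \<open>gap z ^ k * (cmod (f z))\<^sup>2\<close> is continuous and invariant
  under \<Gamma>, so its maximum over the compact core bounds it on the whole ball.\<close>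

lemma cusp_form_bounded:
  assumes f: "f \<in> cusp_forms \<Gamma> k"
  obtains C where "C \<ge> 0" "\<And>z. norm z < 1 \<Longrightarrow> (gap z) ^ k * (cmod (f z))\<^sup>2 \<le> C"
proof -
  obtain R where R: "0 < R" "R < 1" "\<And>z. norm z < 1 \<Longrightarrow> \<exists>\<gamma>\<in>\<Gamma>. norm (act \<gamma> z) \<le> R" using cocompact_radius by blast
  have sub: "cball 0 R \<subseteq> (unit_ball :: (complex^'n) set)" using R by auto
  have hol: "holomorphic_ball f" using f by (simp add: cusp_forms_def)
  define N where "N z = gap z ^ k * (cmod (f z))\<^sup>2" for z
  have inv: "N (act \<gamma> z) = N z" if "\<gamma> \<in> \<Gamma>" "norm z < 1" for \<gamma> z
  proof -
    have "f (act \<gamma> z) = aut_factor \<gamma> z ^ k * f z" using f that by (auto simp: cusp_forms_def)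
    then have "N (act \<gamma> z) = (gap (act \<gamma> z) * (cmod (aut_factor \<gamma> z))\<^sup>2) ^ k * (cmod (f z))\<^sup>2"
      by (simp add: N_def norm_mult norm_power power_mult_distrib power_mult[symmetric] mult.commute)
    then show ?thesis using one_minus_norm_act[OF Gamma_unitary[OF that(1)] that(2)] by (simp add: N_def)
  qed
  have "continuous_on (cball 0 R) N" unfolding N_def
    by (intro continuous_intros continuous_on_subset[OF holomorphic_ball_continuous[OF hol] sub])
  then obtain x where x: "x \<in> cball 0 R" "\<And>z. z \<in> cball 0 R \<Longrightarrow> N z \<le> N x"
    using continuous_attains_sup[OF compact_cball, of "0::complex^'n" R] R by fastforce
  show ?thesis
  proof (rule that[of "N x"])
    have "norm x < 1" using x R by simp
    then show "0 \<le> N x" using one_minus_norm_sq_pos[of x] by (simp add: N_def)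
    fix z :: "complex ^ 'n" assume z: "norm z < 1"
    then obtain \<gamma> where "\<gamma> \<in> \<Gamma>" "norm (act \<gamma> z) \<le> R" using R by blast
    then show "gap z ^ k * (cmod (f z))\<^sup>2 \<le> N x" using x(2)[of "act \<gamma> z"] inv[OF _ z, of \<gamma>] by (simp add: N_def)
  qed
qed

end

subsection \<open>Unfolding and the reproducing property\<close>

lemma borel_measurable_cnj [measurable (raw)]: "f \<in> borel_measurable M \<Longrightarrow> (\<lambda>x. cnj (f x)) \<in> borel_measurable M"
  by (rule measurable_compose[of f _ borel]) (auto intro!: borel_measurable_continuous_onI continuous_intros)

lemma integral_hyp_vol:
  fixes h :: "complex ^ 'n::finite \<Rightarrow> complex"
  assumes [measurable]: "h \<in> borel_measurable borel"
  shows "(LINT z|hyp_vol. h z) = (LINT z|lborel. (indicator unit_ball z * (4 ^ CARD('n) / gap z ^ (CARD('n) + 1))) *\<^sub>R h z)"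
    and "integrable hyp_vol h \<longleftrightarrow> integrable lborel (\<lambda>z. (indicator unit_ball z * (4 ^ CARD('n) / gap z ^ (CARD('n) + 1))) *\<^sub>R h z)"
proof -
  let ?d = "\<lambda>z :: complex ^ 'n. indicator unit_ball z * (4 ^ CARD('n) / gap z ^ (CARD('n) + 1)) :: real"
  have d: "indicator unit_ball z * Re (det (hyp_metric z)) = ?d z" for z :: "complex ^ 'n"
  proof (cases "norm z < 1")
    case True
    then show ?thesis by (simp only: det_hyp_metric[OF True] Re_complex_of_real)
  qed simp
  have hv: "hyp_vol = density lborel (\<lambda>z. ennreal (?d z))" unfolding hyp_vol_def d ..
  have [measurable]: "?d \<in> borel_measurable borel" by measurable
  have nn: "AE z in lborel. 0 \<le> ?d z"
  proof (rule AE_I2)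
    fix z :: "complex ^ 'n"
    show "0 \<le> ?d z" using one_minus_norm_sq_pos[of z] by (cases "norm z < 1") auto
  qed
  show "(LINT z|hyp_vol. h z) = (LINT z|lborel. ?d z *\<^sub>R h z)"
    unfolding hv by (rule integral_density) (use nn in auto)
  show "integrable hyp_vol h \<longleftrightarrow> integrable lborel (\<lambda>z. ?d z *\<^sub>R h z)"
    unfolding hv by (rule integrable_density) (use nn in auto)
qed

lemma mean_value_hyp:
  fixes g :: "complex ^ 'n::finite \<Rightarrow> complex"
  assumes hol: "holomorphic_ball g" and out: "\<And>z. z \<notin> unit_ball \<Longrightarrow> g z = 0"
    and k: "k \<ge> 2 * CARD('n) + 2"
    and bd: "\<And>z. norm z < 1 \<Longrightarrow> (gap z) ^ k * (cmod (g z))\<^sup>2 \<le> C"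
  shows "integrable hyp_vol (\<lambda>z. of_real (gap z ^ k) * g z)"
    and "(LINT z|hyp_vol. of_real (gap z ^ k) * g z) = of_real (weight_mass TYPE('n) k) * g 0"
proof -
  let ?n = "CARD('n)"
  \<comment> \<open>The exponent left after the density of the hyperbolic volume is divided out. The
    given bound controls \<open>gap ^ (k/2) * |g|\<close>, and it controls
    \<open>gap ^ p * |g|\<close> too because 2p \<ge> k, which is equivalent to k \<ge>
    2n+2.\<close>
  define p where "p = k - ?n - 1"
  have n1: "?n \<ge> 1" by (simp add: Suc_leI)
  have p: "k = p + (?n + 1)" "2 * p \<ge> k" "p \<ge> 2 \<or> p = 1" "p + ?n = k - 1" using k n1 by (auto simp: p_def)
  have [measurable]: "g \<in> borel_measurable borel" by (rule holomorphic_ball_measurable[OF hol out])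
  have bd': "gap z ^ p * cmod (g z) \<le> sqrt C" if z: "norm z < 1" for z
  proof -
    define r where "r = gap z"
    have r: "0 < r" "r \<le> 1" using one_minus_norm_sq_pos[OF z] by (auto simp: r_def)
    have "(r ^ p * cmod (g z))\<^sup>2 = r ^ (2 * p) * (cmod (g z))\<^sup>2" by (simp add: power_mult_distrib power_mult mult.commute[of 2])
    also have "\<dots> \<le> r ^ k * (cmod (g z))\<^sup>2" using r p(2) by (intro mult_right_mono power_decreasing) auto
    also have "\<dots> \<le> C" using bd[OF z] by (simp add: r_def)
    finally show ?thesis unfolding r_def using real_le_rsqrt by blast
  qed
  have mv: "integrable lborel (\<lambda>z. of_real (gap z ^ p) * g z)"
    "(LINT z|lborel. of_real (gap z ^ p) * g z)
      = g 0 * of_real (LINT z|lborel. indicator (unit_ball :: (complex ^ 'n) set) z * gap z ^ p)"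
    by (rule mean_value_lborel[OF hol]; rule out bd'; assumption)+
  have eq: "(indicator unit_ball z * (4 ^ ?n / gap z ^ (?n + 1))) *\<^sub>R (complex_of_real (gap z ^ k) * g z)
     = 4 ^ ?n * (of_real (gap z ^ p) * g z)" for z
  proof (cases "norm z < 1")
    case True
    define r where "r = gap z"
    have r: "r > 0" using one_minus_norm_sq_pos[OF True] by (simp add: r_def)
    have "4 ^ ?n / r ^ (?n + 1) * r ^ k = 4 ^ ?n * r ^ p" unfolding p(1) power_add using r by simp
    then have "complex_of_real (4 ^ ?n / r ^ (?n + 1)) * complex_of_real (r ^ k) = complex_of_real (4 ^ ?n * r ^ p)"
      unfolding of_real_mult[symmetric] by simp
    then show ?thesis using True unfolding r_def[symmetric] by (simp add: scaleR_conv_of_real mult.assoc[symmetric])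
  qed (use out in simp)
  show "integrable hyp_vol (\<lambda>z. of_real (gap z ^ k) * g z)"
    by (subst integral_hyp_vol(2)) (auto simp only: eq intro!: integrable_mult_right mv(1), measurable)
  have mass: "(LINT z|lborel. indicator (unit_ball :: (complex ^ 'n) set) z * gap z ^ p) = weight_mass TYPE('n) k / 4 ^ ?n"
  proof -
    have nn: "0 \<le> indicator (unit_ball :: (complex ^ 'n) set) z * gap z ^ p" for z
      using one_minus_norm_sq_pos[of z] by (cases "norm z < 1") auto
    have "ennreal (4 ^ ?n) * (\<integral>\<^sup>+z. ennreal (indicator (unit_ball :: (complex ^ 'n) set) z * gap z ^ p) \<partial>lborel)
       = (\<integral>\<^sup>+u. ennreal (gap (u :: complex ^ 'n) ^ k) \<partial>hyp_vol)"
    proof (subst nn_integral_hyp_vol)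
      have "ennreal (indicator (unit_ball :: (complex ^ 'n) set) z * gap z ^ p)
        = indicator unit_ball z * ennreal (1 / gap z ^ (?n + 1)) * ennreal (gap z ^ k)" for z
      proof (cases "norm z < 1")
        case True
        define r where "r = gap z"
        have r: "r > 0" using one_minus_norm_sq_pos[OF True] by (simp add: r_def)
        have "1 / r ^ (?n + 1) * r ^ k = r ^ p" unfolding p(1) power_add using r by simp
        then have "ennreal (1 / r ^ (?n + 1)) * ennreal (r ^ k) = ennreal (r ^ p)"
          using r by (subst ennreal_mult[symmetric]) (auto simp del: power_Suc)
        then show ?thesis using True by (simp add: r_def del: power_Suc)
      qed simp
      then show "ennreal (4 ^ ?n) * (\<integral>\<^sup>+z. ennreal (indicator (unit_ball :: (complex ^ 'n) set) z * gap z ^ p) \<partial>lborel)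
        = ennreal (4 ^ ?n) * (\<integral>\<^sup>+z. indicator (unit_ball :: (complex ^ 'n) set) z * ennreal (1 / gap z ^ (?n + 1)) * ennreal (gap z ^ k) \<partial>lborel)"
        by presburger
    qed measurable
    also have "\<dots> = ennreal (weight_mass TYPE('n) k)" using k n1 by (intro nn_integral_weight) linarith
    also have "\<dots> = ennreal (4 ^ ?n) * ennreal (weight_mass TYPE('n) k / 4 ^ ?n)"
      using weight_mass_pos[where 'n='n, of k] by (subst ennreal_mult[symmetric]) auto
    finally have "(\<integral>\<^sup>+z. ennreal (indicator (unit_ball :: (complex ^ 'n) set) z * gap z ^ p) \<partial>lborel) = ennreal (weight_mass TYPE('n) k / 4 ^ ?n)"
      by (simp add: ennreal_mult_cancel_left)
    then show ?thesis using weight_mass_pos[where 'n='n, of k] nn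
      by (subst integral_eq_nn_integral) auto
  qed
  have "(LINT z|hyp_vol. of_real (gap z ^ k) * g z) = (LINT z|lborel. 4 ^ ?n * (of_real (gap z ^ p) * g z))"
    by (subst integral_hyp_vol(1)) (simp_all only: eq, measurable)
  also have "\<dots> = 4 ^ ?n * (g 0 * of_real (weight_mass TYPE('n) k / 4 ^ ?n))"
    unfolding integral_mult_right_zero mv(2) mass ..
  also have "\<dots> = of_real (weight_mass TYPE('n) k) * g 0" by simp
  finally show "(LINT z|hyp_vol. of_real (gap z ^ k) * g z) = of_real (weight_mass TYPE('n) k) * g 0" .
qed

lemma bounded_bilinear_vsmult: "bounded_bilinear (\<lambda>(c::complex) (v :: complex ^ 'n::finite). c *s v)"
proof (rule bounded_bilinear.intro)
  show "\<exists>K. \<forall>a b. norm (a *s b) \<le> norm a * norm (b :: complex ^ 'n) * K"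
    by (rule exI[of _ 1]) (simp add: norm_vsmult)
qed (simp_all add: vec_eq_iff algebra_simps)

lemma aut_factor_has_derivative:
  obtains l where "(aut_factor M has_derivative l) (at z)" "\<And>c v. l (c *s v) = c * l v"
proof -
  have "ell M 0 = aut_factor M" by (simp add: fun_eq_iff ell_def herm_def)
  then show ?thesis using that[of "ell_lin M 0"] ell_has_derivative[of M 0 z] ell_lin_scale by metis
qed

lemma act_has_derivative:
  assumes "M \<in> unitary_n1" "norm z < 1"
  shows "\<exists>f'. (act M has_derivative f') (at z) \<and> (\<forall>c v. f' (c *s v) = c *s f' v)"
proof -
  let ?a = "aut_factor M z"
  obtain l where l: "(aut_factor M has_derivative l) (at z)" "\<And>c v. l (c *s v) = c * l v"
    using aut_factor_has_derivative by blast
  have a: "?a \<noteq> 0" by (rule aut_factor_nz[OF assms])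
  have 1: "((\<lambda>z. inverse (aut_factor M z)) has_derivative (\<lambda>h. - (inverse ?a * l h * inverse ?a))) (at z)"
    by (rule Deriv.has_derivative_inverse[OF a l(1)])
  have "bounded_linear (\<lambda>z. block_A M *v z)" using linear_mat_vec linear_conv_bounded_linear by blast
  then have 2: "((\<lambda>z. block_A M *v z + block_B M) has_derivative (\<lambda>h. block_A M *v h)) (at z)"
    by (auto intro!: derivative_eq_intros bounded_linear_imp_has_derivative)
  show ?thesis
    unfolding act_def
    by (intro exI conjI, rule bounded_bilinear.FDERIV[OF bounded_bilinear_vsmult 1 2])
       (simp add: l(2) vector_scalar_commute vec_eq_iff algebra_simps)
qed

text \<open>The slash operator of weight k. It is applied to a translation taking the origin to w,
  generally outside \<Gamma>, in order to use the mean value property at the origin.\<close>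

lemma holomorphic_ball_act:
  assumes f: "holomorphic_ball f" and M: "M \<in> unitary_n1"
  shows "holomorphic_ball (\<lambda>z. f (act M z) * inverse (aut_factor M z ^ k))"
  unfolding holomorphic_ball_def
proof
  fix z :: "complex ^ 'a" assume "z \<in> unit_ball"
  then have z: "norm z < 1" by simp
  obtain A where A: "(act M has_derivative A) (at z)" "\<And>c v. A (c *s v) = c *s A v" using act_has_derivative[OF M z] by blast
  have "act M z \<in> unit_ball" using act_ball[OF M z] by simp
  then obtain f' where f': "(f has_derivative f') (at (act M z))" "\<And>c v. f' (c *s v) = c * f' v"
    using f unfolding holomorphic_ball_def by blast
  let ?a = "aut_factor M z"
  obtain l where l: "(aut_factor M has_derivative l) (at z)" "\<And>c v. l (c *s v) = c * l v"
    using aut_factor_has_derivative by blast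
  have a: "?a \<noteq> 0" by (rule aut_factor_nz[OF M z])
  define D where "D = - (of_nat k * ?a ^ (k - 1)) / (?a ^ k)\<^sup>2"
  have "((\<lambda>x. inverse (x ^ k)) has_field_derivative D) (at ?a)"
    unfolding D_def using a by (auto intro!: derivative_eq_intros simp: power2_eq_square field_simps)
  then have 1: "((\<lambda>z. inverse (aut_factor M z ^ k)) has_derivative (\<lambda>h. D * l h)) (at z)"
    unfolding has_field_derivative_def by (rule has_derivative_compose[OF l(1)])
  have 2: "((\<lambda>z. f (act M z)) has_derivative (\<lambda>h. f' (A h))) (at z)"
    by (rule has_derivative_compose[OF A(1) f'(1)])
  show "\<exists>f'. ((\<lambda>z. f (act M z) * inverse (aut_factor M z ^ k)) has_derivative f') (at z) \<and> (\<forall>c v. f' (c *s v) = c * f' v)"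
    by (intro exI conjI, rule has_derivative_mult[OF 2 1]) (simp add: A f' l(2) algebra_simps)
qed

lemma AE_hyp_vol_lborel:
  fixes P :: "complex ^ 'n::finite \<Rightarrow> bool"
  assumes "AE z in lborel. P z" shows "AE z in hyp_vol. P z"
proof -
  have m: "(\<lambda>z :: complex ^ 'n. ennreal (indicator unit_ball z * Re (det (hyp_metric z)))) \<in> borel_measurable lborel"
  proof -
    have "(\<lambda>z :: complex ^ 'n. ennreal (indicator unit_ball z * Re (det (hyp_metric z))))
       = (\<lambda>z. ennreal (indicator unit_ball z * (4 ^ CARD('n) / gap z ^ (CARD('n) + 1))))"
    proof
      fix z :: "complex ^ 'n"
      show "ennreal (indicator unit_ball z * Re (det (hyp_metric z))) = ennreal (indicator unit_ball z * (4 ^ CARD('n) / gap z ^ (CARD('n) + 1)))"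
        by (cases "norm z < 1") (simp_all only: det_hyp_metric Re_complex_of_real, simp)
    qed
    then show ?thesis by simp
  qed
  show ?thesis unfolding hyp_vol_def AE_density[OF m] using assms by auto
qed

section \<open>Unfolding integrals over a fundamental domain\<close>

locale picard_domain = cocompact_lattice +
  fixes F
  assumes fd: "fundamental_domain \<Gamma> F"
begin

lemma F_sets [measurable]: "F \<in> sets borel" and F_ball: "F \<subseteq> unit_ball"
  using fd by (auto simp: fundamental_domain_def)

text \<open>If \<alpha> and \<beta> both move z into F, then \<open>act \<alpha> z\<close> lies in
  the overlap of F with its translate by \<alpha>\<beta>^(-1). These overlaps are null, their
  preimages are null by invariance of the volume, and countability of \<Gamma> collects them into
  one null set.\<close>

lemma AE_unique_translate:
  "AE z in hyp_vol. \<exists>!\<gamma>. \<gamma> \<in> \<Gamma> \<and> act \<gamma> z \<in> F"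
proof -
  have ex: "AE z in hyp_vol. norm z < 1 \<longrightarrow> z \<in> (\<Union>\<gamma>\<in>\<Gamma>. act \<gamma> ` F)"
    using fd by (intro AE_hyp_vol_lborel) (simp add: fundamental_domain_def)
  have "AE z in hyp_vol. act \<delta> z \<notin> F \<inter> act \<gamma> ` F" if "\<gamma> \<in> \<Gamma>" "\<gamma> \<noteq> mat 1" "\<delta> \<in> \<Gamma>" for \<gamma> \<delta>
  proof -
    have "AE z in hyp_vol. z \<notin> F \<inter> act \<gamma> ` F"
      using fd that by (intro AE_hyp_vol_lborel) (simp add: fundamental_domain_def)
    then have "AE z in distr hyp_vol borel (act \<delta>). z \<notin> F \<inter> act \<gamma> ` F"
      unfolding distr_hyp_vol_act[OF Gamma_unitary[OF that(3)]] .
    then show ?thesis by (rule AE_distrD[rotated]) measurable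
  qed
  then have un: "AE z in hyp_vol. \<forall>\<gamma>\<in>\<Gamma> - {mat 1}. \<forall>\<delta>\<in>\<Gamma>. act \<delta> z \<notin> F \<inter> act \<gamma> ` F"
    using countable_Gamma by (auto simp: AE_ball_countable)
  show ?thesis using ex un AE_hyp_vol_ball
  proof eventually_elim
    case (elim z)
    note z = elim(3)
    obtain \<gamma> u where g: "\<gamma> \<in> \<Gamma>" "u \<in> F" "z = act \<gamma> u" using elim by auto
    have "act (u_inv \<gamma>) z = u" using act_u_inv(1)[OF Gamma_unitary[OF g(1)], of u] g F_ball by auto
    then have 1: "u_inv \<gamma> \<in> \<Gamma> \<and> act (u_inv \<gamma>) z \<in> F" using g Gamma_inv by simp
    have "\<alpha> = \<beta>" if a: "\<alpha> \<in> \<Gamma>" "act \<alpha> z \<in> F" and b: "\<beta> \<in> \<Gamma>" "act \<beta> z \<in> F" for \<alpha> \<beta>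
    proof (rule ccontr)
      assume ne: "\<alpha> \<noteq> \<beta>"
      note ua = Gamma_unitary[OF a(1)] and ub = Gamma_unitary[OF b(1)]
      define \<tau> where "\<tau> = \<alpha> ** u_inv \<beta>"
      have t: "\<tau> \<in> \<Gamma>" unfolding \<tau>_def using a b by (intro Gamma_mult Gamma_inv)
      have tb: "\<tau> ** \<beta> = \<alpha>" using u_inv(1)[OF ub] by (simp add: \<tau>_def matrix_mul_assoc[symmetric])
      have "\<tau> \<noteq> mat 1" using tb ne by auto
      then have "act \<alpha> z \<notin> F \<inter> act \<tau> ` F" using elim(2) t a(1) by blast
      moreover have "act \<alpha> z = act \<tau> (act \<beta> z)" using act_aut_mult(1)[OF Gamma_unitary[OF t] ub z] tb by simp
      ultimately show False using a b by blast
    qed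
    then show ?case using 1 by blast
  qed
qed

lemma bij_u_inv:
  assumes "bij_betw e (UNIV :: nat set) \<Gamma>" shows "bij_betw (\<lambda>m. u_inv (e m)) UNIV \<Gamma>"
proof -
  have "bij_betw u_inv \<Gamma> \<Gamma>"
    by (rule bij_betw_byWitness[where f' = u_inv]) (auto simp: u_inv_u_inv Gamma_unitary Gamma_inv)
  then show ?thesis using bij_betw_trans[OF assms, of u_inv \<Gamma>] by (simp add: o_def)
qed

lemma indicator_sums:
  assumes e: "bij_betw e (UNIV :: nat set) \<Gamma>" and u: "\<exists>!\<gamma>. \<gamma> \<in> \<Gamma> \<and> act \<gamma> z \<in> F"
  shows "(\<lambda>m. indicator F (act (e m) z) *\<^sub>R (c::'c::real_normed_vector)) sums c" and "(\<Sum>m. indicator F (act (e m) z) :: ennreal) = 1"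
proof -
  obtain \<gamma> where g: "\<gamma> \<in> \<Gamma>" "act \<gamma> z \<in> F" "\<And>\<delta>. \<delta> \<in> \<Gamma> \<Longrightarrow> act \<delta> z \<in> F \<Longrightarrow> \<delta> = \<gamma>" using u by blast
  obtain m where m: "e m = \<gamma>" using e g(1) by (auto simp: bij_betw_def)
  have iff: "act (e i) z \<in> F \<longleftrightarrow> i = m" for i
  proof
    assume "act (e i) z \<in> F"
    then have "e i = e m" using g(3)[of "e i"] m e by (auto simp: bij_betw_def)
    then show "i = m" using e by (auto simp: bij_betw_def inj_def)
  qed (use g(2) m in simp)
  have "(\<lambda>i. if i = m then c else 0) sums c" by (rule sums_single)
  moreover have "(\<lambda>i. if i = m then c else 0) = (\<lambda>i. indicator F (act (e i) z) *\<^sub>R c)" by (auto simp: iff indicator_def)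
  ultimately show "(\<lambda>m. indicator F (act (e m) z) *\<^sub>R c) sums c" by simp
  have "(\<lambda>i. if i = m then 1 else 0 :: ennreal) sums 1" by (rule sums_single)
  moreover have "(\<lambda>i. if i = m then 1 else 0) = (\<lambda>i. indicator F (act (e i) z) :: ennreal)" by (auto simp: iff indicator_def)
  ultimately show "(\<Sum>m. indicator F (act (e m) z) :: ennreal) = 1" by (simp add: sums_iff)
qed

text \<open>Almost everywhere 1 is the sum of the indicators of F at the translates by
  \<open>u_inv (e m)\<close>. Inserting this and substituting \<open>act (e m)\<close> in the m-th
  summand moves each piece to F.\<close>

lemma unfold_nn:
  fixes \<phi> :: "complex ^ 'a \<Rightarrow> ennreal"
  assumes e: "bij_betw e (UNIV :: nat set) \<Gamma>" and [measurable]: "\<phi> \<in> borel_measurable borel"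
  shows "(\<integral>\<^sup>+z. \<phi> z \<partial>hyp_vol) = (\<Sum>m. \<integral>\<^sup>+z. indicator F z * \<phi> (act (e m) z) \<partial>hyp_vol)"
proof -
  have eU: "e m \<in> unitary_n1" for m using e Gamma_unitary by (auto simp: bij_betw_def)
  note e' = bij_u_inv[OF e]
  have eq: "(\<integral>\<^sup>+z. indicator F (act (u_inv (e m)) z) * \<phi> z \<partial>hyp_vol) = (\<integral>\<^sup>+z. indicator F z * \<phi> (act (e m) z) \<partial>hyp_vol)" for m
  proof -
    have "(\<integral>\<^sup>+z. indicator F (act (u_inv (e m)) z) * \<phi> z \<partial>hyp_vol) = (\<integral>\<^sup>+z. indicator F (act (u_inv (e m)) (act (e m) z)) * \<phi> (act (e m) z) \<partial>hyp_vol)"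
      by (rule nn_integral_hyp_vol_act[OF _ eU, symmetric]) measurable
    also have "\<dots> = (\<integral>\<^sup>+z. indicator F z * \<phi> (act (e m) z) \<partial>hyp_vol)"
      by (rule nn_integral_cong_AE, use AE_hyp_vol_ball in eventually_elim) (simp add: act_u_inv(1)[OF eU])
    finally show ?thesis .
  qed
  have "(\<integral>\<^sup>+z. \<phi> z \<partial>hyp_vol) = (\<integral>\<^sup>+z. (\<Sum>m. indicator F (act (u_inv (e m)) z) * \<phi> z) \<partial>hyp_vol)"
  proof (rule nn_integral_cong_AE, use AE_unique_translate in eventually_elim)
    fix z assume "\<exists>!\<gamma>. \<gamma> \<in> \<Gamma> \<and> act \<gamma> z \<in> F"
    then show "\<phi> z = (\<Sum>m. indicator F (act (u_inv (e m)) z) * \<phi> z)"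
      by (simp add: indicator_sums(2)[OF e'])
  qed
  also have "\<dots> = (\<Sum>m. \<integral>\<^sup>+z. indicator F (act (u_inv (e m)) z) * \<phi> z \<partial>hyp_vol)"
    by (rule nn_integral_suminf) measurable
  also have "\<dots> = (\<Sum>m. \<integral>\<^sup>+z. indicator F z * \<phi> (act (e m) z) \<partial>hyp_vol)" unfolding eq ..
  finally show ?thesis .
qed

text \<open>The same argument for complex integrands. The nonnegative version, applied to |\<phi>|,
  supplies the absolute convergence that justifies both exchanges of sum and integral.\<close>

lemma unfold_integral:
  fixes \<phi> :: "complex ^ 'a \<Rightarrow> complex"
  assumes e: "bij_betw e (UNIV :: nat set) \<Gamma>" and m\<phi>[measurable]: "\<phi> \<in> borel_measurable borel"
    and int: "integrable hyp_vol \<phi>"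
    and summ: "\<And>z. norm z < 1 \<Longrightarrow> summable (\<lambda>m. cmod (\<phi> (act (e m) z)))"
  shows "(LINT z|hyp_vol. indicator F z *\<^sub>R (\<Sum>m. \<phi> (act (e m) z))) = (LINT z|hyp_vol. \<phi> z)"
proof -
  have eU: "e m \<in> unitary_n1" for m using e Gamma_unitary by (auto simp: bij_betw_def)
  note e' = bij_u_inv[OF e]
  let ?f = "\<lambda>m z. indicator F z *\<^sub>R \<phi> (act (e m) z)" and ?g = "\<lambda>m z. indicator F (act (u_inv (e m)) z) *\<^sub>R \<phi> z"
  have ig: "integrable hyp_vol (?g m)" for m
    by (rule Bochner_Integration.integrable_bound[OF int]) (auto split: split_indicator)
  have fg: "AE z in hyp_vol. ?g m (act (e m) z) = ?f m z" for m
    using AE_hyp_vol_ball by eventually_elim (simp add: act_u_inv(1)[OF eU])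
  have ig': "integrable hyp_vol (\<lambda>z. ?g m (act (e m) z))" for m
  proof -
    have "integrable (distr hyp_vol borel (act (e m))) (?g m)" unfolding distr_hyp_vol_act[OF eU] by (rule ig)
    then show ?thesis by (subst (asm) integrable_distr_eq) measurable
  qed
  have if': "integrable hyp_vol (?f m)" for m
    by (rule integrable_cong_AE_imp[OF ig' _ fg]) measurable
  have ifg: "(LINT z|hyp_vol. ?f m z) = (LINT z|hyp_vol. ?g m z)" for m
  proof -
    have "(LINT z|hyp_vol. ?g m z) = (LINT z|distr hyp_vol borel (act (e m)). ?g m z)" unfolding distr_hyp_vol_act[OF eU] ..
    also have "\<dots> = (LINT z|hyp_vol. ?g m (act (e m) z))" by (rule integral_distr) measurable
    also have "\<dots> = (LINT z|hyp_vol. ?f m z)" by (rule integral_cong_AE) (use fg in measurable)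
    finally show ?thesis ..
  qed
  have fin: "(\<Sum>m. \<integral>\<^sup>+z. ennreal (cmod (?f m z)) \<partial>hyp_vol) < \<infinity>"
  proof -
    have "(\<Sum>m. \<integral>\<^sup>+z. ennreal (cmod (?f m z)) \<partial>hyp_vol) = (\<Sum>m. \<integral>\<^sup>+z. indicator F z * ennreal (cmod (\<phi> (act (e m) z))) \<partial>hyp_vol)"
      by (intro suminf_cong nn_integral_cong) (auto split: split_indicator)
    also have "\<dots> = (\<integral>\<^sup>+z. ennreal (cmod (\<phi> z)) \<partial>hyp_vol)" by (rule unfold_nn[OF e, symmetric]) measurable
    also have "\<dots> < \<infinity>" using int by (simp add: integrable_iff_bounded)
    finally show ?thesis .
  qed
  have sn: "summable (\<lambda>m. LINT z|hyp_vol. cmod (?f m z))"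
  proof (rule summable_suminf_not_top)
    have "(\<Sum>m. ennreal (LINT z|hyp_vol. cmod (?f m z))) = (\<Sum>m. \<integral>\<^sup>+z. ennreal (cmod (?f m z)) \<partial>hyp_vol)"
      by (intro suminf_cong nn_integral_eq_integral[symmetric] integrable_norm if') auto
    then show "(\<Sum>m. ennreal (LINT z|hyp_vol. cmod (?f m z))) \<noteq> top_class.top" using fin by (simp add: less_top)
  qed simp
  have sa: "AE z in hyp_vol. summable (\<lambda>m. cmod (?f m z))"
    using AE_hyp_vol_ball by eventually_elim (use summ in \<open>auto split: split_indicator intro: summable_mult\<close>)
  have s1: "(LINT z|hyp_vol. (\<Sum>m. ?f m z)) = (\<Sum>m. LINT z|hyp_vol. ?f m z)"
    by (rule integral_suminf[OF if' sa sn])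
  have ng: "(LINT z|hyp_vol. cmod (?g m z)) = (LINT z|hyp_vol. cmod (?f m z))" for m
  proof -
    have "(LINT z|hyp_vol. cmod (?g m z)) = (LINT z|distr hyp_vol borel (act (e m)). cmod (?g m z))" unfolding distr_hyp_vol_act[OF eU] ..
    also have "\<dots> = (LINT z|hyp_vol. cmod (?g m (act (e m) z)))" by (rule integral_distr) measurable
    also have "\<dots> = (LINT z|hyp_vol. cmod (?f m z))" 
    proof (rule integral_cong_AE)
      show "AE z in hyp_vol. cmod (?g m (act (e m) z)) = cmod (?f m z)" using fg[of m] by eventually_elim (simp only:)
    qed measurable
    finally show ?thesis .
  qed
  have sga: "AE z in hyp_vol. summable (\<lambda>m. cmod (?g m z))"
    using AE_unique_translate
  proof eventually_elim
    case (elim z)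
    have "(\<lambda>m. cmod (?g m z)) = (\<lambda>m. indicator F (act (u_inv (e m)) z) *\<^sub>R cmod (\<phi> z))" by (simp split: split_indicator)
    then show ?case using indicator_sums(1)[OF e' elim, of "cmod (\<phi> z)"] by (simp add: sums_iff)
  qed
  have "(LINT z|hyp_vol. (\<Sum>m. ?g m z)) = (\<Sum>m. LINT z|hyp_vol. ?g m z)"
    by (rule integral_suminf[OF ig sga]) (simp only: ng sn)
  moreover have "(LINT z|hyp_vol. (\<Sum>m. ?g m z)) = (LINT z|hyp_vol. \<phi> z)"
  proof (rule integral_cong_AE)
    show "AE z in hyp_vol. (\<Sum>m. ?g m z) = \<phi> z"
      using AE_unique_translate by eventually_elim (use indicator_sums(1)[OF e'] sums_unique in metis)
  qed measurable
  moreover have "(LINT z|hyp_vol. indicator F z *\<^sub>R (\<Sum>m. \<phi> (act (e m) z))) = (LINT z|hyp_vol. (\<Sum>m. ?f m z))"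
    by (intro Bochner_Integration.integral_cong) (auto split: split_indicator)
  ultimately show ?thesis using s1 ifg by simp
qed

lemma poincare_reproducing:
  assumes f: "f \<in> cusp_forms \<Gamma> k" and w: "norm w < 1" and k: "k \<ge> 2 * CARD('a) + 2"
  shows "petersson F k f (poincare k w) = of_real (weight_mass TYPE('a) k) * f w"
proof -
  have hol: "holomorphic_ball f" and out: "\<And>z. z \<notin> unit_ball \<Longrightarrow> f z = 0"
    and mod: "\<And>\<gamma> z. \<gamma> \<in> \<Gamma> \<Longrightarrow> norm z < 1 \<Longrightarrow> f (act \<gamma> z) = aut_factor \<gamma> z ^ k * f z"
    using f by (auto simp: cusp_forms_def)
  have [measurable]: "f \<in> borel_measurable borel" by (rule holomorphic_ball_measurable[OF hol out])
  obtain C where C: "\<And>z. norm z < 1 \<Longrightarrow> (gap z) ^ k * (cmod (f z))\<^sup>2 \<le> C" using cusp_form_bounded[OF f] by blast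
  \<comment> \<open>The integrand belonging to the identity term of the series. Automorphy of f
    turns \<phi> at \<open>act \<gamma> z\<close> into the integrand of the term of \<gamma>, so the
    Petersson product unfolds to the integral of \<phi> over the ball.\<close>
  define \<phi> where "\<phi> u = complex_of_real (gap u ^ k) * f u * cnj (inverse (Q_ker u w ^ k))" for u
  have m\<phi>[measurable]: "\<phi> \<in> borel_measurable borel" unfolding \<phi>_def by measurable
  define e where "e = from_nat_into \<Gamma>"
  have e: "bij_betw e UNIV \<Gamma>" using enumeration by (simp add: e_def)
  have eG: "e m \<in> \<Gamma>" for m using e by (auto simp: bij_betw_def)
  have \<phi>e: "\<phi> (act \<gamma> z) = complex_of_real (gap z ^ k) * f z * cnj (inverse (ell \<gamma> w z ^ k))"
    if g: "\<gamma> \<in> \<Gamma>" and z: "norm z < 1" for \<gamma> z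
  proof -
    note u = Gamma_unitary[OF g]
    define j where "j = aut_factor \<gamma> z"
    have j: "j \<noteq> 0" using aut_factor_nz[OF u z] by (simp add: j_def)
    define q where "q = gap (act \<gamma> z)"
    have "complex_of_real (gap z) = of_real q * (j * cnj j)"
      unfolding one_minus_norm_act[OF u z, symmetric] of_real_mult complex_norm_square q_def j_def ..
    then show ?thesis
      unfolding \<phi>_def mod[OF g z] ell_eq[OF aut_factor_nz[OF u z]] of_real_power q_def[symmetric] j_def[symmetric]
      using j by (simp add: power_mult_distrib)
  qed
  define \<sigma> where "\<sigma> = boost w"
  have \<sigma>: "\<sigma> \<in> unitary_n1" "act \<sigma> 0 = w" using boost[OF w] by (auto simp: \<sigma>_def)
  \<comment> \<open>The pullback of f along the translation \<sigma>, holomorphic on the ball and,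
    up to an automorphy factor, equal at the origin to f at w.\<close>
  define g where "g v = (if norm v < 1 then f (act \<sigma> v) * inverse (aut_factor \<sigma> v ^ k) else 0)" for v
  have ghol: "holomorphic_ball g"
    by (rule holomorphic_ball_cong[OF holomorphic_ball_act[OF hol \<sigma>(1), of k]]) (simp add: g_def)
  have gout: "g z = 0" if "z \<notin> unit_ball" for z using that by (simp add: g_def)
  have gb: "gap z ^ k * (cmod (g z))\<^sup>2 \<le> C" if z: "norm z < 1" for z
  proof -
    define j where "j = aut_factor \<sigma> z"
    have j: "j \<noteq> 0" using aut_factor_nz[OF \<sigma>(1) z] by (simp add: j_def)
    have "gap z ^ k * (cmod (g z))\<^sup>2 = gap (act \<sigma> z) ^ k * (cmod (f (act \<sigma> z)))\<^sup>2"
    proof -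
      have cg: "cmod (g z) = cmod (f (act \<sigma> z)) / cmod j ^ k"
        using z by (simp add: g_def j_def norm_mult norm_inverse norm_power norm_divide divide_inverse)
      have "((cmod j)\<^sup>2) ^ k = (cmod j ^ k)\<^sup>2" by (simp add: power_mult[symmetric] mult.commute)
      then show ?thesis
        unfolding one_minus_norm_act[OF \<sigma>(1) z, symmetric] cg j_def[symmetric] power_mult_distrib power_divide
        using j by simp
    qed
    also have "\<dots> \<le> C" by (rule C[OF act_ball[OF \<sigma>(1) z]])
    finally show ?thesis .
  qed
  have mv: "integrable hyp_vol (\<lambda>z. of_real (gap z ^ k) * g z)"
    "(LINT z|hyp_vol. of_real (gap z ^ k) * g z) = of_real (weight_mass TYPE('a) k) * g 0"
    by (rule mean_value_hyp[OF ghol _ k]; rule gout gb; assumption)+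
  \<comment> \<open>Since \<open>act \<sigma> 0 = w\<close> and \<open>Q_ker v 0 = 1\<close>, the
    kernel at \<open>act \<sigma> v\<close> is a product of automorphy factors. Its antiholomorphic
    part is absorbed by the transformation of the weight, leaving a radial weight times the
    holomorphic g.\<close>
  have \<phi>\<sigma>: "\<phi> (act \<sigma> v) = aut_factor \<sigma> 0 ^ k * (of_real (gap v ^ k) * g v)" if v: "norm v < 1" for v
  proof -
    define j where "j = aut_factor \<sigma> v"
    have j: "j \<noteq> 0" using aut_factor_nz[OF \<sigma>(1) v] by (simp add: j_def)
    define j0 where "j0 = aut_factor \<sigma> 0"
    have j0: "j0 \<noteq> 0" using aut_factor_nz[OF \<sigma>(1), of 0] by (simp add: j0_def)
    define q where "q = gap (act \<sigma> v)"
    have 1: "complex_of_real (gap v) = of_real q * (j * cnj j)"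
      unfolding one_minus_norm_act[OF \<sigma>(1) v, symmetric] of_real_mult complex_norm_square q_def j_def ..
    have "Q_ker (act \<sigma> v) w * j * cnj j0 = 1"
      using Q_ker_act[OF \<sigma>(1) v, of 0] by (simp add: \<sigma>(2) j_def j0_def Q_ker_def herm_def)
    then have "inverse (Q_ker (act \<sigma> v) w) = j * cnj j0" by (metis inverse_unique mult.assoc)
    then have 2: "cnj (inverse (Q_ker (act \<sigma> v) w ^ k)) = cnj j ^ k * j0 ^ k"
      by (simp add: power_inverse[symmetric] power_mult_distrib)
    show ?thesis unfolding \<phi>_def 2 of_real_power 1 q_def[symmetric] j0_def[symmetric] g_def j_def[symmetric]
      using j v by (simp add: power_mult_distrib)
  qed
  have i\<sigma>: "integrable hyp_vol (\<lambda>v. \<phi> (act \<sigma> v))"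
  proof (rule integrable_cong_AE_imp[OF integrable_mult_right[OF mv(1), of "aut_factor \<sigma> 0 ^ k"]])
    show "AE v in hyp_vol. aut_factor \<sigma> 0 ^ k * (of_real (gap v ^ k) * g v) = \<phi> (act \<sigma> v)"
      using AE_hyp_vol_ball by eventually_elim (simp add: \<phi>\<sigma>)
  qed measurable
  have i\<phi>: "integrable hyp_vol \<phi>"
  proof -
    have "integrable (distr hyp_vol borel (act \<sigma>)) \<phi>" by (subst integrable_distr_eq) (use i\<sigma> in measurable)
    then show ?thesis unfolding distr_hyp_vol_act[OF \<sigma>(1)] .
  qed
  have [measurable]: "g \<in> borel_measurable borel" by (rule holomorphic_ball_measurable[OF ghol gout])
  have "(LINT z|hyp_vol. \<phi> z) = (LINT z|distr hyp_vol borel (act \<sigma>). \<phi> z)" unfolding distr_hyp_vol_act[OF \<sigma>(1)] ..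
  also have "\<dots> = (LINT v|hyp_vol. \<phi> (act \<sigma> v))" by (rule integral_distr) measurable
  also have "\<dots> = (LINT v|hyp_vol. aut_factor \<sigma> 0 ^ k * (of_real (gap v ^ k) * g v))"
  proof (rule integral_cong_AE)
    show "AE v in hyp_vol. \<phi> (act \<sigma> v) = aut_factor \<sigma> 0 ^ k * (of_real (gap v ^ k) * g v)"
      using AE_hyp_vol_ball by eventually_elim (simp add: \<phi>\<sigma>)
  qed measurable
  also have "\<dots> = aut_factor \<sigma> 0 ^ k * (of_real (weight_mass TYPE('a) k) * g 0)"
    unfolding integral_mult_right_zero mv(2) ..
  also have "\<dots> = of_real (weight_mass TYPE('a) k) * f w"
    using aut_factor_nz[OF \<sigma>(1), of 0] by (simp add: g_def \<sigma>(2))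
  finally have L: "(LINT z|hyp_vol. \<phi> z) = of_real (weight_mass TYPE('a) k) * f w" .
  have summ: "summable (\<lambda>m. cmod (\<phi> (act (e m) z)))" if z: "norm z < 1" for z
    unfolding \<phi>e[OF eG z] norm_mult complex_mod_cnj by (intro summable_mult poincare_sums(2)[OF e z w k])
  have "petersson F k f (poincare k w) = (LINT z|hyp_vol. indicator F z *\<^sub>R (\<Sum>m. \<phi> (act (e m) z)))"
    unfolding petersson_def set_lebesgue_integral_def
  proof (rule Bochner_Integration.integral_cong[OF refl])
    fix z
    show "indicator F z *\<^sub>R (complex_of_real (gap z ^ k) * f z * cnj (poincare k w z)) = indicator F z *\<^sub>R (\<Sum>m. \<phi> (act (e m) z))"
    proof (cases "z \<in> F")
      case True
      then have z: "norm z < 1" using F_ball by auto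
      have "(\<lambda>m. cnj (inverse (ell (e m) w z ^ k))) sums cnj (poincare k w z)"
        using poincare_sums(1)[OF e z w k] by (simp only: sums_cnj)
      then have "(\<lambda>m. complex_of_real (gap z ^ k) * f z * cnj (inverse (ell (e m) w z ^ k)))
          sums (complex_of_real (gap z ^ k) * f z * cnj (poincare k w z))" by (rule sums_mult)
      then show ?thesis unfolding \<phi>e[OF eG z] by (simp add: sums_iff)
    qed simp
  qed
  also have "\<dots> = (LINT z|hyp_vol. \<phi> z)" by (rule unfold_integral[OF e m\<phi> i\<phi> summ])
  finally show ?thesis using L by simp
qed

end

subsection \<open>Orthonormal bases and the Bergman kernel\<close>

lemma cusp_forms_lincomb:
  assumes "f \<in> cusp_forms \<Gamma> k" "g \<in> cusp_forms \<Gamma> k"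
  shows "(\<lambda>z. f z + c * g z) \<in> cusp_forms \<Gamma> k"
proof -
  have "holomorphic_ball (\<lambda>z. f z + c * g z)"
    unfolding holomorphic_ball_def
  proof
    fix z :: "complex ^ 'a" assume z: "z \<in> unit_ball"
    obtain f' where f': "(f has_derivative f') (at z)" "\<And>c v. f' (c *s v) = c * f' v"
      using assms(1) z unfolding cusp_forms_def holomorphic_ball_def by blast
    obtain g' where g': "(g has_derivative g') (at z)" "\<And>c v. g' (c *s v) = c * g' v"
      using assms(2) z unfolding cusp_forms_def holomorphic_ball_def by blast
    have "((\<lambda>z. f z + c * g z) has_derivative (\<lambda>h. f' h + c * g' h)) (at z)"
      by (intro has_derivative_add has_derivative_mult_right f' g')
    moreover have "\<forall>d v. f' (d *s v) + c * g' (d *s v) = d * (f' v + c * g' v)" by (simp add: f' g' algebra_simps)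
    ultimately show "\<exists>f'. ((\<lambda>z. f z + c * g z) has_derivative f') (at z) \<and> (\<forall>c v. f' (c *s v) = c * f' v)" by blast
  qed
  then show ?thesis using assms by (auto simp: cusp_forms_def algebra_simps)
qed

lemma cusp_forms_zero: "(\<lambda>z. 0) \<in> cusp_forms \<Gamma> k"
  by (auto simp: cusp_forms_def holomorphic_ball_def intro!: exI[of _ "\<lambda>_. 0"])

lemma cusp_forms_sum:
  assumes "finite B" "B \<subseteq> cusp_forms \<Gamma> k"
  shows "(\<lambda>z. \<Sum>g\<in>B. c g * g z) \<in> cusp_forms \<Gamma> k"
  using assms
proof (induction B rule: finite_induct)
  case empty
  then show ?case using cusp_forms_zero by simp
next
  case (insert h B)
  then have "(\<lambda>z. (\<Sum>g\<in>B. c g * g z) + c h * h z) \<in> cusp_forms \<Gamma> k" by (intro cusp_forms_lincomb) auto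
  then show ?case using insert by (simp add: add.commute)
qed

section \<open>The Petersson inner product, finite dimension and the kernel asymptotics\<close>

context picard_domain
begin

text \<open>An arbitrary fundamental domain may approach the boundary of the ball, so its closure
  gives no bound. But each of its points has a translate in the core, so a multiple of the indicator
  of F lies below the sum of the translates of \<open>gap ^ (n+1)\<close>, which unfolds to a finite
  integral.\<close>

lemma hyp_vol_F_finite: "emeasure hyp_vol F < \<infinity>"
proof -
  let ?m = "CARD('a) + 1"
  obtain R where R: "0 < R" "R < 1" "\<And>z. norm z < 1 \<Longrightarrow> \<exists>\<gamma>\<in>\<Gamma>. norm (act \<gamma> z) \<le> R" using cocompact_radius by blast
  define c where "c = (1 - R\<^sup>2) ^ ?m"
  have R2: "0 < 1 - R\<^sup>2" using R by (simp add: abs_square_less_1)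
  have c: "c > 0" unfolding c_def using R2 by (rule zero_less_power)
  define \<phi> where "\<phi> u = ennreal (gap (u :: complex ^ 'a) ^ ?m)" for u
  have [measurable]: "\<phi> \<in> borel_measurable borel" unfolding \<phi>_def by measurable
  define e where "e = from_nat_into \<Gamma>"
  have e: "bij_betw e UNIV \<Gamma>" using enumeration by (simp add: e_def)
  have "ennreal c * emeasure hyp_vol F = (\<integral>\<^sup>+z. ennreal c * indicator F z \<partial>hyp_vol)"
    by (subst nn_integral_cmult_indicator) auto
  also have "\<dots> \<le> (\<integral>\<^sup>+z. (\<Sum>m. indicator F z * \<phi> (act (e m) z)) \<partial>hyp_vol)"
  proof (rule nn_integral_mono)
    fix z
    show "ennreal c * indicator F z \<le> (\<Sum>m. indicator F z * \<phi> (act (e m) z))"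
    proof (cases "z \<in> F")
      case True
      then have "norm z < 1" using F_ball by auto
      then obtain \<gamma> where g: "\<gamma> \<in> \<Gamma>" "norm (act \<gamma> z) \<le> R" using R by blast
      obtain m where m: "e m = \<gamma>" using e g(1) by (auto simp: bij_betw_def)
      have "(norm (act \<gamma> z))\<^sup>2 \<le> R\<^sup>2" using g(2) by (intro power_mono) auto
      then have "c \<le> (gap (act \<gamma> z)) ^ ?m" unfolding c_def using R2 by (intro power_mono) auto
      then have "ennreal c \<le> \<phi> (act (e m) z)" unfolding \<phi>_def m by (rule ennreal_leI)
      also have "\<dots> = (\<Sum>m\<in>{m}. indicator F z * \<phi> (act (e m) z))" using True by simp
      also have "\<dots> \<le> (\<Sum>m. indicator F z * \<phi> (act (e m) z))" by (rule sum_le_suminf) auto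
      finally show ?thesis using True by simp
    qed simp
  qed
  also have "\<dots> = (\<Sum>m. \<integral>\<^sup>+z. indicator F z * \<phi> (act (e m) z) \<partial>hyp_vol)" by (rule nn_integral_suminf) measurable
  also have "\<dots> = (\<integral>\<^sup>+z. \<phi> z \<partial>hyp_vol)" by (rule unfold_nn[OF e, symmetric]) measurable
  also have "\<dots> < \<infinity>" unfolding \<phi>_def by (rule nn_integral_weight_finite) simp
  finally show ?thesis using c by (auto simp: ennreal_mult_less_top)
qed

lemma cusp_form_measurable: "f \<in> cusp_forms \<Gamma> k \<Longrightarrow> f \<in> borel_measurable borel"
  by (rule holomorphic_ball_measurable) (auto simp: cusp_forms_def)

lemma petersson_integrable:
  assumes "f \<in> cusp_forms \<Gamma> k" "g \<in> cusp_forms \<Gamma> k"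
  shows "integrable hyp_vol (\<lambda>z. indicator F z *\<^sub>R (complex_of_real (gap z ^ k) * f z * cnj (g z)))"
proof -
  obtain A where A: "A \<ge> 0" "\<And>z. norm z < 1 \<Longrightarrow> (gap z) ^ k * (cmod (f z))\<^sup>2 \<le> A" using cusp_form_bounded[OF assms(1)] by blast
  obtain B where B: "B \<ge> 0" "\<And>z. norm z < 1 \<Longrightarrow> (gap z) ^ k * (cmod (g z))\<^sup>2 \<le> B" using cusp_form_bounded[OF assms(2)] by blast
  have [measurable]: "f \<in> borel_measurable borel" "g \<in> borel_measurable borel" using assms cusp_form_measurable by auto
  show ?thesis
  proof (rule Bochner_Integration.integrable_bound[of _ "\<lambda>z. (A + B) * indicator F z"])
    show "integrable hyp_vol (\<lambda>z. (A + B) * indicator F z)"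
      using hyp_vol_F_finite by (intro integrable_mult_right integrable_real_indicator) auto
    show "AE z in hyp_vol. norm (indicator F z *\<^sub>R (complex_of_real (gap z ^ k) * f z * cnj (g z))) \<le> norm ((A + B) * indicator F z)"
    proof (rule AE_I2)
      fix z
      show "norm (indicator F z *\<^sub>R (complex_of_real (gap z ^ k) * f z * cnj (g z))) \<le> norm ((A + B) * indicator F z)"
      proof (cases "z \<in> F")
        case True
        then have z: "norm z < 1" using F_ball by auto
        define r where "r = gap z ^ k"
        have r: "r > 0" unfolding r_def using one_minus_norm_sq_pos[OF z] by simp
        have "cmod (f z) * cmod (g z) \<le> (cmod (f z))\<^sup>2 + (cmod (g z))\<^sup>2"
          using sum_squares_bound[of "cmod (f z)" "cmod (g z)"] mult_nonneg_nonneg[OF norm_ge_zero norm_ge_zero, of "f z" "g z"] by linarith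
        then have "r * (cmod (f z) * cmod (g z)) \<le> r * ((cmod (f z))\<^sup>2 + (cmod (g z))\<^sup>2)" using r by (intro mult_left_mono) auto
        also have "\<dots> \<le> A + B" using A(2)[OF z] B(2)[OF z] by (simp add: r_def distrib_left)
        finally show ?thesis using True r A(1) B(1) unfolding r_def[symmetric] by (simp add: norm_mult mult.assoc)
      qed simp
    qed
  qed measurable
qed

lemma petersson_lincomb:
  assumes "f \<in> cusp_forms \<Gamma> k" "g \<in> cusp_forms \<Gamma> k" "h \<in> cusp_forms \<Gamma> k"
  shows "petersson F k (\<lambda>z. f z + c * g z) h = petersson F k f h + c * petersson F k g h"
proof -
  note i = petersson_integrable[OF assms(1,3)] petersson_integrable[OF assms(2,3)]
  have "petersson F k (\<lambda>z. f z + c * g z) h = (LINT z|hyp_vol.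
      indicator F z *\<^sub>R (complex_of_real (gap z ^ k) * f z * cnj (h z))
      + c * (indicator F z *\<^sub>R (complex_of_real (gap z ^ k) * g z * cnj (h z))))"
    unfolding petersson_def set_lebesgue_integral_def
    by (intro Bochner_Integration.integral_cong refl) (simp add: scaleR_conv_of_real algebra_simps)
  also have "\<dots> = petersson F k f h + c * petersson F k g h"
    unfolding petersson_def set_lebesgue_integral_def
      Bochner_Integration.integral_add[OF i(1) integrable_mult_right[OF i(2)]] integral_mult_right_zero ..
  finally show ?thesis .
qed

lemma petersson_cnj: "cnj (petersson F k f g) = petersson F k g f"
  unfolding petersson_def set_lebesgue_integral_def Bochner_Integration.integral_cnj[symmetric]
  by (intro Bochner_Integration.integral_cong refl) (simp add: mult_ac)

lemma petersson_zero: "petersson F k (\<lambda>z. 0) h = 0"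
  by (simp add: petersson_def set_lebesgue_integral_def)

lemma petersson_sum:
  assumes "finite B" "B \<subseteq> cusp_forms \<Gamma> k" "h \<in> cusp_forms \<Gamma> k"
  shows "petersson F k (\<lambda>z. \<Sum>g\<in>B. c g * g z) h = (\<Sum>g\<in>B. c g * petersson F k g h)"
  using assms(1,2)
proof (induction B rule: finite_induct)
  case empty
  then show ?case by (simp add: petersson_zero)
next
  case (insert x B)
  have "petersson F k (\<lambda>z. (\<Sum>g\<in>B. c g * g z) + c x * x z) h = petersson F k (\<lambda>z. \<Sum>g\<in>B. c g * g z) h + c x * petersson F k x h"
    using insert assms(3) by (intro petersson_lincomb cusp_forms_sum) auto
  then show ?case using insert by (simp add: add.commute)
qed

abbreviation pet_density :: "nat \<Rightarrow> (complex ^ 'a \<Rightarrow> complex) \<Rightarrow> complex ^ 'a \<Rightarrow> real" where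
  "pet_density k f z \<equiv> indicator F z * (gap z ^ k * (cmod (f z))\<^sup>2)"

lemma petersson_self:
  "petersson F k f f = of_real (LINT z|hyp_vol. pet_density k f z)"
proof -
  have "petersson F k f f = (LINT z|hyp_vol. complex_of_real (pet_density k f z))"
    unfolding petersson_def set_lebesgue_integral_def
  proof (intro Bochner_Integration.integral_cong refl)
    fix z
    show "indicator F z *\<^sub>R (complex_of_real (gap z ^ k) * f z * cnj (f z)) = complex_of_real (pet_density k f z)"
      unfolding of_real_mult complex_norm_square scaleR_conv_of_real by (simp add: mult_ac)
  qed
  then show ?thesis unfolding integral_complex_of_real .
qed

lemma petersson_self_integrable:
  assumes "f \<in> cusp_forms \<Gamma> k"
  shows "integrable hyp_vol (\<lambda>z. pet_density k f z)"
proof -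
  have eq: "Re (indicator F z *\<^sub>R (complex_of_real (gap z ^ k) * f z * cnj (f z))) = pet_density k f z" for z
  proof -
    have "complex_of_real (gap z ^ k) * f z * cnj (f z) = complex_of_real (gap z ^ k * (cmod (f z))\<^sup>2)"
      unfolding of_real_mult complex_norm_square by (simp only: mult.assoc)
    then show ?thesis by (simp only: scaleR_complex.simps Re_complex_of_real)
  qed
  show ?thesis using integrable_Re[OF petersson_integrable[OF assms assms]] unfolding eq .
qed

lemma petersson_self_nonneg: "Re (petersson F k f f) \<ge> 0"
  unfolding petersson_self Re_complex_of_real
proof (rule Bochner_Integration.integral_nonneg)
  fix z show "0 \<le> pet_density k f z"
    using F_ball one_minus_norm_sq_pos[of z] by (cases "z \<in> F") auto
qed

text \<open>A vanishing norm gives f = 0 only almost everywhere on F. This suffices to annihilate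
  the product with each Poincare series, and the reproducing property converts that into vanishing
  at every point of the ball.\<close>

lemma petersson_definite:
  assumes f: "f \<in> cusp_forms \<Gamma> k" and k: "k \<ge> 2 * CARD('a) + 2" and 0: "petersson F k f f = 0"
  shows "f = (\<lambda>z. 0)"
proof
  fix w
  show "f w = 0"
  proof (cases "norm w < 1")
    case True
    have nn: "0 \<le> pet_density k f z" for z
      using F_ball one_minus_norm_sq_pos[of z] by (cases "z \<in> F") auto
    have "(LINT z|hyp_vol. pet_density k f z) = 0" using 0 unfolding petersson_self by simp
    then have ae: "AE z in hyp_vol. pet_density k f z = 0"
      using integral_nonneg_eq_0_iff_AE[OF petersson_self_integrable[OF f]] nn by simp
    have "petersson F k f (poincare k w) = (LINT z|(hyp_vol :: (complex ^ 'a) measure). 0)"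
      unfolding petersson_def set_lebesgue_integral_def
    proof (rule integral_cong_AE)
      have [measurable]: "f \<in> borel_measurable borel" "poincare k w \<in> borel_measurable borel"
        using f poincare_cusp_form[OF True k] cusp_form_measurable by auto
      show "(\<lambda>z. indicator F z *\<^sub>R (complex_of_real (gap z ^ k) * f z * cnj (poincare k w z))) \<in> borel_measurable hyp_vol" by measurable
      show "AE z in hyp_vol. indicator F z *\<^sub>R (complex_of_real (gap z ^ k) * f z * cnj (poincare k w z)) = 0"
        using ae
      proof eventually_elim
        case (elim z)
        show ?case
        proof (cases "z \<in> F")
          case z: True
          then have "norm z < 1" using F_ball by auto
          then have "(norm z)\<^sup>2 \<noteq> 1" using one_minus_norm_sq_pos[of z] by linarith
          then have "f z = 0" using elim z by simp
          then show ?thesis by simp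
        qed simp
      qed
    qed simp
    then have "of_real (weight_mass TYPE('a) k) * f w = 0" using poincare_reproducing[OF f True k] by simp
    then show ?thesis using weight_mass_pos[where 'n='a, of k] by simp
  qed (use f in \<open>auto simp: cusp_forms_def\<close>)
qed

text \<open>The conditions on an orthonormal basis except for spanning, so that a system of maximal
  size can be sought.\<close>

definition orthonormal :: "nat \<Rightarrow> (complex ^ 'a \<Rightarrow> complex) set \<Rightarrow> bool" where
  "orthonormal k B \<longleftrightarrow> finite B \<and> B \<subseteq> cusp_forms \<Gamma> k \<and> (\<forall>f\<in>B. \<forall>g\<in>B. petersson F k f g = (if f = g then 1 else 0))"

lemma petersson_projection:
  assumes B: "orthonormal k B" and f: "f \<in> cusp_forms \<Gamma> k"
  defines "h \<equiv> \<lambda>z. f z + (- 1) * (\<Sum>g\<in>B. petersson F k f g * g z)"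
  shows "h \<in> cusp_forms \<Gamma> k" and "\<And>g. g \<in> B \<Longrightarrow> petersson F k h g = 0"
proof -
  have fin: "finite B" and sub: "B \<subseteq> cusp_forms \<Gamma> k"
    and on: "\<And>f g. f \<in> B \<Longrightarrow> g \<in> B \<Longrightarrow> petersson F k f g = (if f = g then 1 else 0)"
    using B by (auto simp: orthonormal_def)
  note s = cusp_forms_sum[OF fin sub, of "petersson F k f"]
  show "h \<in> cusp_forms \<Gamma> k" unfolding h_def by (rule cusp_forms_lincomb[OF f s])
  fix g assume g: "g \<in> B"
  have "petersson F k h g = petersson F k f g + (- 1) * (\<Sum>x\<in>B. petersson F k f x * petersson F k x g)"
    unfolding h_def using petersson_lincomb[OF f s, of g "- 1"] petersson_sum[OF fin sub, of g] g sub by auto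
  also have "(\<Sum>x\<in>B. petersson F k f x * petersson F k x g) = (\<Sum>x\<in>B. if x = g then petersson F k f g else 0)"
    by (rule sum.cong) (auto simp: on g)
  finally show "petersson F k h g = 0" using fin g by simp
qed

lemma poincare_coefficient:
  assumes "g \<in> cusp_forms \<Gamma> k" "norm w < 1" "k \<ge> 2 * CARD('a) + 2"
  shows "petersson F k (poincare k w) g = of_real (weight_mass TYPE('a) k) * cnj (g w)"
  using arg_cong[OF poincare_reproducing[OF assms], of cnj] by (simp add: petersson_cnj)

text \<open>The Fourier coefficients of the Poincare series are point evaluations.\<close>

lemma bessel_poincare:
  assumes B: "orthonormal k B" and w: "norm w < 1" and k: "k \<ge> 2 * CARD('a) + 2"
  shows "weight_mass TYPE('a) k * (\<Sum>g\<in>B. (cmod (g w))\<^sup>2) \<le> cmod (poincare k w w)"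
proof -
  have fin: "finite B" and sub: "B \<subseteq> cusp_forms \<Gamma> k" using B by (auto simp: orthonormal_def)
  define I where "I = weight_mass TYPE('a) k"
  have I: "I > 0" using weight_mass_pos by (simp add: I_def)
  let ?P = "poincare k w"
  note P = poincare_cusp_form[OF w k]
  define S where "S z = (\<Sum>g\<in>B. petersson F k ?P g * g z)" for z
  define h where "h z = ?P z + (- 1) * S z" for z
  have h: "h \<in> cusp_forms \<Gamma> k" "\<And>g. g \<in> B \<Longrightarrow> petersson F k h g = 0"
    using petersson_projection[OF B P] by (simp_all add: h_def[abs_def] S_def[abs_def])
  have S: "S \<in> cusp_forms \<Gamma> k" using cusp_forms_sum[OF fin sub] by (simp add: S_def[abs_def])
  have "petersson F k S h = (\<Sum>g\<in>B. petersson F k ?P g * petersson F k g h)"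
    using petersson_sum[OF fin sub h(1)] by (simp add: S_def[abs_def])
  also have "\<dots> = 0" using h(2) petersson_cnj by (intro sum.neutral) (metis complex_cnj_zero mult_zero_right)
  finally have Sh: "petersson F k S h = 0" .
  \<comment> \<open>The residual h is orthogonal to its subtracted part, so its norm square is its
    product with the Poincare series, a positive multiple of the conjugate of h(w). Nonnegativity of
    the norm is therefore an inequality at the single point w.\<close>
  have "petersson F k h h = petersson F k ?P h"
    using petersson_lincomb[OF P S h(1), of "- 1"] Sh by (simp add: h_def[abs_def])
  also have "\<dots> = of_real I * cnj (h w)" unfolding I_def by (rule poincare_coefficient[OF h(1) w k])
  finally have "Re (of_real I * cnj (h w)) \<ge> 0" using petersson_self_nonneg[of k h] by simp
  then have hw: "Re (h w) \<ge> 0" using I by (simp add: zero_le_mult_iff)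
  have "S w = (\<Sum>g\<in>B. complex_of_real (I * (cmod (g w))\<^sup>2))"
    unfolding S_def
  proof (rule sum.cong[OF refl])
    fix g assume g: "g \<in> B"
    show "petersson F k ?P g * g w = complex_of_real (I * (cmod (g w))\<^sup>2)"
      using poincare_coefficient[OF _ w k, of g] g sub unfolding of_real_mult complex_norm_square I_def by (auto simp: mult_ac)
  qed
  also have "\<dots> = complex_of_real (I * (\<Sum>g\<in>B. (cmod (g w))\<^sup>2))" by (simp add: sum_distrib_left)
  finally have "Re (h w) = Re (?P w) - I * (\<Sum>g\<in>B. (cmod (g w))\<^sup>2)" by (simp add: h_def)
  then show ?thesis using hw complex_Re_le_cmod[of "?P w"] unfolding I_def by linarith
qed

text \<open>The identity term is exactly 1 after normalisation. In every other term, 2n+2 of the k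
  factors \<open>sqrt (rho (act \<gamma> z) z)\<close> go into the bounded lattice sum, and each of
  the others is at most \<open>sqrt \<delta>\<close> by the displacement bound.\<close>

lemma poincare_diagonal:
  obtains C \<delta> where "0 < C" "0 < \<delta>" "\<delta> < 1"
    "\<And>k z. k \<ge> 2 * CARD('a) + 2 \<Longrightarrow> norm z < 1 \<Longrightarrow>
       cmod (of_real (gap z ^ k) * poincare k z z - 1) \<le> C * sqrt \<delta> ^ (k - (2 * CARD('a) + 2))"
proof -
  let ?m = "CARD('a) + 1"
  obtain \<delta> where \<delta>: "0 < \<delta>" "\<delta> < 1"
    "\<And>\<gamma> z. \<gamma> \<in> \<Gamma> \<Longrightarrow> \<gamma> \<noteq> mat 1 \<Longrightarrow> norm z < 1 \<Longrightarrow> rho (act \<gamma> z) z \<le> \<delta>" using displacement by blast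
  obtain C where C: "0 < C" "\<And>T z w. finite T \<Longrightarrow> T \<subseteq> \<Gamma> \<Longrightarrow> norm z < 1 \<Longrightarrow> norm w < 1 \<Longrightarrow> (\<Sum>\<gamma>\<in>T. rho (act \<gamma> z) w ^ ?m) \<le> C"
    by (rule rho_sum_bound) (rule that, assumption, presburger)
  show ?thesis
  proof (rule that[OF C(1) \<delta>(1,2)])
    fix k and z :: "complex ^ 'a" assume k: "k \<ge> 2 * CARD('a) + 2" and z: "norm z < 1"
    define r where "r = gap z"
    have r: "r > 0" using one_minus_norm_sq_pos[OF z] by (simp add: r_def)
    let ?t = "\<lambda>\<gamma>. inverse (ell \<gamma> z z ^ k)" and ?G = "\<Gamma> - {mat 1}"
    let ?s = "sqrt \<delta> ^ (k - (2 * CARD('a) + 2))"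
    have sm: "(\<lambda>\<gamma>. cmod (?t \<gamma>)) summable_on \<Gamma>" by (rule ell_abs_summable[OF z z k])
    then have smG: "(\<lambda>\<gamma>. cmod (?t \<gamma>)) summable_on ?G" by (rule summable_on_subset_banach) auto
    have "poincare k z z = infsum ?t (insert (mat 1) ?G)" using z Gamma_one by (simp add: poincare_def insert_absorb)
    also have "\<dots> = ?t (mat 1) + infsum ?t ?G"
      by (rule infsum_insert) (use abs_summable_summable[OF smG] in auto)
    also have "?t (mat 1) = inverse (of_real (r ^ k))"
      using aut_factor_one[of z] by (simp add: ell_eq Q_ker_def herm_self r_def)
    finally have "of_real (r ^ k) * poincare k z z - 1 = of_real (r ^ k) * infsum ?t ?G"
      using r by (simp add: distrib_left)
    then have "cmod (of_real (r ^ k) * poincare k z z - 1) = r ^ k * cmod (infsum ?t ?G)"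
      using r by (simp add: norm_mult norm_power)
    also have "\<dots> \<le> r ^ k * (C * ?s * (1 / r) ^ k)"
    proof (rule mult_left_mono)
      have "cmod (infsum ?t ?G) \<le> infsum (\<lambda>\<gamma>. cmod (?t \<gamma>)) ?G" by (rule norm_infsum_bound[OF smG])
      also have "\<dots> \<le> C * ?s * (1 / r) ^ k"
      proof (rule infsum_le_finite_sums[OF smG])
        fix T assume T: "finite T" "T \<subseteq> ?G"
        have "cmod (?t \<gamma>) \<le> rho (act \<gamma> z) z ^ ?m * (?s * (1 / r) ^ k)" if "\<gamma> \<in> T" for \<gamma>
        proof -
          have g: "\<gamma> \<in> \<Gamma>" "\<gamma> \<noteq> mat 1" using that T by auto
          note u = Gamma_unitary[OF g(1)]
          have kk: "2 * ?m + (k - (2 * CARD('a) + 2)) = k" using k by simp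
          define x where "x = rho (act \<gamma> z) z"
          have x: "0 < x" "x \<le> \<delta>" using rho_pos[OF act_ball[OF u z] z] \<delta>(3)[OF g z] by (auto simp: x_def)
          have "cmod (?t \<gamma>) = (sqrt x / r) ^ k" using cmod_ell[OF u z z, of k] r by (simp add: x_def r_def real_sqrt_mult)
          also have "\<dots> = sqrt x ^ k * (1 / r) ^ k" by (simp add: power_divide)
          also have "sqrt x ^ k = sqrt x ^ (2 * ?m) * sqrt x ^ (k - (2 * CARD('a) + 2))"
            by (simp only: power_add[symmetric] kk)
          also have "sqrt x ^ (2 * ?m) = x ^ ?m" using x unfolding power_mult by simp
          also have "x ^ ?m * sqrt x ^ (k - (2 * CARD('a) + 2)) * (1 / r) ^ k \<le> x ^ ?m * ?s * (1 / r) ^ k"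
            using x r by (intro mult_right_mono mult_left_mono power_mono real_sqrt_le_mono) auto
          finally show ?thesis by (simp add: x_def mult.assoc)
        qed
        then have "(\<Sum>\<gamma>\<in>T. cmod (?t \<gamma>)) \<le> (\<Sum>\<gamma>\<in>T. rho (act \<gamma> z) z ^ ?m * (?s * (1 / r) ^ k))" by (rule sum_mono)
        also have "\<dots> = (\<Sum>\<gamma>\<in>T. rho (act \<gamma> z) z ^ ?m) * (?s * (1 / r) ^ k)" by (rule sum_distrib_right[symmetric])
        also have "\<dots> \<le> C * (?s * (1 / r) ^ k)" using C(2)[of T z z] T z \<delta> r by (intro mult_right_mono) auto
        finally show "(\<Sum>\<gamma>\<in>T. cmod (?t \<gamma>)) \<le> C * ?s * (1 / r) ^ k" by (simp add: mult.assoc)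
      qed
      finally show "cmod (infsum ?t ?G) \<le> C * ?s * (1 / r) ^ k" .
    qed (use r in simp)
    also have "\<dots> = C * ?s" using r by (simp add: power_divide)
    finally show "cmod (of_real (gap z ^ k) * poincare k z z - 1) \<le> C * ?s" by (simp add: r_def)
  qed
qed

text \<open>Integrating Bessel's inequality over \<open>F\<close> bounds the dimension of the space of cusp forms.\<close>

lemma orthonormal_card_bound:
  assumes k: "k \<ge> 2 * CARD('a) + 2"
  obtains N where "\<And>B. orthonormal k B \<Longrightarrow> card B \<le> N"
proof -
  obtain C \<delta> where C: "0 < C" "0 < \<delta>" "\<delta> < 1"
    and diag: "\<And>k z. k \<ge> 2 * CARD('a) + 2 \<Longrightarrow> norm z < 1 \<Longrightarrow>
       cmod (of_real (gap z ^ k) * poincare k z z - 1) \<le> C * sqrt \<delta> ^ (k - (2 * CARD('a) + 2))"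
    by (rule poincare_diagonal) (rule that, assumption, assumption, assumption, presburger)
  define I where "I = weight_mass TYPE('a) k"
  have I: "I > 0" using weight_mass_pos by (simp add: I_def)
  have P: "gap w ^ k * cmod (poincare k w w) \<le> C + 1" if w: "norm w < 1" for w
  proof -
    have "sqrt \<delta> ^ (k - (2 * CARD('a) + 2)) \<le> 1" using C by (intro power_le_one) auto
    then have "C * sqrt \<delta> ^ (k - (2 * CARD('a) + 2)) \<le> C" using C by simp
    then have "cmod (of_real (gap w ^ k) * poincare k w w - 1) \<le> C" using diag[OF k w] by linarith
    then have "cmod (of_real (gap w ^ k) * poincare k w w) \<le> C + 1"
      using norm_triangle_sub[of "of_real (gap w ^ k) * poincare k w w" 1] by simp
    moreover have "cmod (of_real (gap w ^ k)) = gap w ^ k"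
      unfolding norm_of_real using one_minus_norm_sq_pos[OF w] by simp
    ultimately show ?thesis unfolding norm_mult by simp
  qed
  show ?thesis
  proof (rule that[of "nat \<lceil>(C + 1) / I * measure hyp_vol F\<rceil>"])
    fix B assume B: "orthonormal k B"
    have fin: "finite B" and sub: "B \<subseteq> cusp_forms \<Gamma> k"
      and on: "\<And>f. f \<in> B \<Longrightarrow> petersson F k f f = 1" using B by (auto simp: orthonormal_def)
    have int: "integrable hyp_vol (\<lambda>z. pet_density k g z)" if "g \<in> B" for g
      using petersson_self_integrable that sub by blast
    have "real (card B) = (\<Sum>g\<in>B. (LINT z|hyp_vol. pet_density k g z))"
    proof -
      have "(LINT z|hyp_vol. pet_density k g z) = 1" if "g \<in> B" for g
        using on[OF that] unfolding petersson_self using of_real_eq_1_iff by blast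
      then show ?thesis by simp
    qed
    also have "\<dots> = (LINT z|hyp_vol. (\<Sum>g\<in>B. pet_density k g z))"
      using int by (intro Bochner_Integration.integral_sum[symmetric])
    also have "\<dots> \<le> (LINT z|hyp_vol. (C + 1) / I * indicator F z)"
    proof (rule integral_mono)
      show "integrable hyp_vol (\<lambda>z. \<Sum>g\<in>B. pet_density k g z)"
        using int by (intro Bochner_Integration.integrable_sum)
      show "integrable hyp_vol (\<lambda>z. (C + 1) / I * indicator F z)"
        using hyp_vol_F_finite by (intro integrable_mult_right integrable_real_indicator) auto
      fix z
      show "(\<Sum>g\<in>B. pet_density k g z) \<le> (C + 1) / I * indicator F z"
      proof (cases "z \<in> F")
        case True
        then have z: "norm z < 1" using F_ball by auto
        define r where "r = gap z ^ k"
        have r: "r > 0" unfolding r_def using one_minus_norm_sq_pos[OF z] by simp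
        have "I * (r * (\<Sum>g\<in>B. (cmod (g z))\<^sup>2)) = r * (I * (\<Sum>g\<in>B. (cmod (g z))\<^sup>2))" by simp
        also have "\<dots> \<le> r * cmod (poincare k z z)"
          using bessel_poincare[OF B z k] r unfolding I_def by (intro mult_left_mono) auto
        also have "\<dots> \<le> C + 1" using P[OF z] by (simp add: r_def)
        finally have "r * (\<Sum>g\<in>B. (cmod (g z))\<^sup>2) \<le> (C + 1) / I" using I by (simp add: field_simps)
        then show ?thesis using True unfolding r_def[symmetric] by (simp add: sum_distrib_left)
      qed simp
    qed
    also have "\<dots> = (C + 1) / I * measure hyp_vol F" by simp
    finally show "card B \<le> nat \<lceil>(C + 1) / I * measure hyp_vol F\<rceil>" by linarith
  qed
qed

text \<open>Sizes of orthonormal systems are bounded, so one of maximal size exists. It spans, since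
  otherwise the normalised residual of some form would enlarge it. This guarantees that the choice
  in \<open>bergman_kernel\<close> picks an actual basis.\<close>

lemma orthonormal_basis_exists:
  assumes k: "k \<ge> 2 * CARD('a) + 2"
  shows "\<exists>B. orthonormal_basis \<Gamma> F k B"
proof -
  obtain N where N: "\<And>B. orthonormal k B \<Longrightarrow> card B \<le> N" using orthonormal_card_bound[OF k] by blast
  have e0: "orthonormal k {}" by (simp add: orthonormal_def)
  have "\<exists>B. orthonormal k B \<and> (\<forall>B'. orthonormal k B' \<longrightarrow> card B' \<le> card B)"
  proof (rule ex_has_greatest_nat[where k = "{}" and b = "Suc N"])
    show "\<forall>B. orthonormal k B \<longrightarrow> card B < Suc N" using N by (simp add: less_Suc_eq_le)
  qed (rule e0)
  then obtain B where B: "orthonormal k B" and max: "\<And>B'. orthonormal k B' \<Longrightarrow> card B' \<le> card B"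
    by (elim exE conjE) (rule that, assumption, simp)
  have fin: "finite B" and sub: "B \<subseteq> cusp_forms \<Gamma> k"
    and on: "\<And>f g. f \<in> B \<Longrightarrow> g \<in> B \<Longrightarrow> petersson F k f g = (if f = g then 1 else 0)"
    using B by (auto simp: orthonormal_def)
  have "f = (\<lambda>z. \<Sum>g\<in>B. petersson F k f g * g z)" if f: "f \<in> cusp_forms \<Gamma> k" for f
  proof (rule ccontr)
    assume ne: "f \<noteq> (\<lambda>z. \<Sum>g\<in>B. petersson F k f g * g z)"
    define h where "h z = f z + (- 1) * (\<Sum>g\<in>B. petersson F k f g * g z)" for z
    have h: "h \<in> cusp_forms \<Gamma> k" "\<And>g. g \<in> B \<Longrightarrow> petersson F k h g = 0"
      using petersson_projection[OF B f] by (simp_all add: h_def[abs_def])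
    have "h \<noteq> (\<lambda>z. 0)" using ne by (auto simp: h_def fun_eq_iff)
    then have n0: "petersson F k h h \<noteq> 0" using petersson_definite[OF h(1) k] by blast
    define r where "r = Re (petersson F k h h)"
    have rr: "petersson F k h h = of_real r" unfolding r_def petersson_self by simp
    have r: "r > 0" using petersson_self_nonneg[of k h] n0 rr unfolding r_def[symmetric] by (metis of_real_0 order_le_less)
    define c where "c = complex_of_real (1 / sqrt r)"
    define u where "u z = 0 + c * h z" for z
    have u: "u \<in> cusp_forms \<Gamma> k" unfolding u_def by (rule cusp_forms_lincomb[OF cusp_forms_zero h(1)])
    have ux: "petersson F k u x = c * petersson F k h x" if "x \<in> cusp_forms \<Gamma> k" for x
      unfolding u_def using petersson_lincomb[OF cusp_forms_zero h(1) that, of c] by (simp add: petersson_zero)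
    have ug: "petersson F k u g = 0" "petersson F k g u = 0" if "g \<in> B" for g
    proof -
      show "petersson F k u g = 0" using ux[of g] h(2)[OF that] that sub by auto
      then show "petersson F k g u = 0" using petersson_cnj[of k u g] by simp
    qed
    have "petersson F k h u = cnj c * of_real r" using petersson_cnj[of k u h] ux[OF h(1)] by (simp add: rr)
    then have "petersson F k u u = c * (cnj c * of_real r)" using ux[OF u] by simp
    also have "\<dots> = of_real (1 / sqrt r * (1 / sqrt r * r))" by (simp only: c_def complex_cnj_complex_of_real of_real_mult)
    also have "1 / sqrt r * (1 / sqrt r * r) = 1" using r by (simp add: field_simps)
    finally have uu: "petersson F k u u = 1" by simp
    have nin: "u \<notin> B" using ug(1)[of u] uu by auto
    have "orthonormal k (insert u B)"
      unfolding orthonormal_def using fin sub u uu ug on nin by auto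
    then show False using max[of "insert u B"] nin fin by simp
  qed
  then have "orthonormal_basis \<Gamma> F k B" unfolding orthonormal_basis_def using fin sub on by blast
  then show ?thesis by blast
qed

text \<open>Expanding the Poincare series in the chosen basis, its coefficient at g is, by the
  reproducing property, the conjugate of g(w) times the weight mass; the expansion is therefore a
  multiple of the kernel.\<close>

lemma bergman_kernel_poincare:
  assumes k: "k \<ge> 2 * CARD('a) + 2" and w: "norm w < 1"
  shows "poincare k w z = of_real (weight_mass TYPE('a) k) * bergman_kernel \<Gamma> F k z w"
proof -
  define B where "B = (SOME B. orthonormal_basis \<Gamma> F k B)"
  have "orthonormal_basis \<Gamma> F k B" unfolding B_def using orthonormal_basis_exists[OF k] by (rule someI_ex)
  then have fin: "finite B" and sub: "B \<subseteq> cusp_forms \<Gamma> k"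
    and on: "\<And>f g. f \<in> B \<Longrightarrow> g \<in> B \<Longrightarrow> petersson F k f g = (if f = g then 1 else 0)"
    and span: "\<And>f. f \<in> cusp_forms \<Gamma> k \<Longrightarrow> \<exists>c. f = (\<lambda>z. \<Sum>g\<in>B. c g * g z)"
    unfolding orthonormal_basis_def by blast+
  obtain c where c: "poincare k w = (\<lambda>z. \<Sum>g\<in>B. c g * g z)" using span[OF poincare_cusp_form[OF w k]] by blast
  have "c g = of_real (weight_mass TYPE('a) k) * cnj (g w)" if g: "g \<in> B" for g
  proof -
    have gs: "g \<in> cusp_forms \<Gamma> k" using g sub by blast
    have "petersson F k (poincare k w) g = (\<Sum>x\<in>B. c x * petersson F k x g)" unfolding c by (rule petersson_sum[OF fin sub gs])
    also have "\<dots> = (\<Sum>x\<in>B. if x = g then c g else 0)" by (rule sum.cong) (auto simp: on g)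
    also have "\<dots> = c g" using fin g by simp
    finally show ?thesis using poincare_coefficient[OF gs w k] by simp
  qed
  then have "poincare k w z = (\<Sum>g\<in>B. of_real (weight_mass TYPE('a) k) * cnj (g w) * g z)" unfolding c by simp
  also have "\<dots> = of_real (weight_mass TYPE('a) k) * (\<Sum>g\<in>B. g z * cnj (g w))"
    by (simp add: sum_distrib_left mult_ac)
  finally show ?thesis by (simp add: bergman_kernel_def B_def)
qed

text \<open>The normalised kernel is a product \<open>a k * x\<close>. The factor
  \<open>a k\<close>, free of z, tends to the limit by the factorial asymptotics, and x stays within
  \<open>\<epsilon> k\<close> of 1 for all z at once.\<close>

lemma bergman_pet_uniform:
  "uniform_limit unit_ball (\<lambda>k z. 1 / real k ^ CARD('a) * bergman_pet \<Gamma> F k z) (\<lambda>z. 1 / (4 * pi) ^ CARD('a)) sequentially"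
proof -
  obtain C \<delta> where C: "0 < C" "0 < \<delta>" "\<delta> < 1"
    and diag: "\<And>k z. k \<ge> 2 * CARD('a) + 2 \<Longrightarrow> norm z < 1 \<Longrightarrow>
       cmod (of_real (gap z ^ k) * poincare k z z - 1) \<le> C * sqrt \<delta> ^ (k - (2 * CARD('a) + 2))"
    by (rule poincare_diagonal) (rule that, assumption, assumption, assumption, presburger)
  define a where "a k = 1 / real k ^ CARD('a) * (1 / weight_mass TYPE('a) k)" for k
  define L where "L = 1 / (4 * pi) ^ CARD('a)"
  define \<epsilon> where "\<epsilon> k = C * sqrt \<delta> ^ (k - (2 * CARD('a) + 2))" for k
  have a0: "a k \<ge> 0" for k using weight_mass_pos[where 'n='a, of k] by (simp add: a_def)
  have aL: "a \<longlonglongrightarrow> L" unfolding a_def L_def by (rule weight_mass_asymp)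
  define K where "K = 2 * CARD('a) + 2"
  \<comment> \<open>Shifting k by K removes the truncated subtraction from the exponent and leaves a
    geometric sequence.\<close>
  have "(\<lambda>k. sqrt \<delta> ^ (k + K - K)) \<longlonglongrightarrow> 0"
    unfolding add_diff_cancel_right' by (rule LIMSEQ_power_zero) (use C in auto)
  then have "(\<lambda>k. sqrt \<delta> ^ (k - K)) \<longlonglongrightarrow> 0"
    by (rule LIMSEQ_offset[of "\<lambda>k. sqrt \<delta> ^ (k - K)" K])
  then have e0: "\<epsilon> \<longlonglongrightarrow> 0" unfolding \<epsilon>_def K_def[symmetric] by (rule tendsto_mult_right_zero)
  have b0: "(\<lambda>k. a k * \<epsilon> k + \<bar>a k - L\<bar>) \<longlonglongrightarrow> L * 0 + \<bar>L - L\<bar>"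
    by (intro tendsto_intros aL e0)
  have est: "\<bar>1 / real k ^ CARD('a) * bergman_pet \<Gamma> F k z - L\<bar> \<le> a k * \<epsilon> k + \<bar>a k - L\<bar>"
    if k: "k \<ge> 2 * CARD('a) + 2" and z: "norm z < 1" for k z
  proof -
    define I where "I = weight_mass TYPE('a) k"
    have I: "I > 0" using weight_mass_pos by (simp add: I_def)
    define q where "q = gap z ^ k"
    have q: "q > 0" unfolding q_def using one_minus_norm_sq_pos[OF z] by simp
    define x where "x = cmod (of_real q * poincare k z z)"
    have "x = q * (I * cmod (bergman_kernel \<Gamma> F k z z))"
      unfolding x_def bergman_kernel_poincare[OF k z] norm_mult I_def[symmetric] using q I by simp
    then have "bergman_pet \<Gamma> F k z = x / I" using I by (simp add: bergman_pet_def q_def)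
    then have bp: "1 / real k ^ CARD('a) * bergman_pet \<Gamma> F k z = a k * x" by (simp add: a_def I_def)
    have "\<bar>x - 1\<bar> \<le> cmod (of_real q * poincare k z z - 1)"
      unfolding x_def using norm_triangle_ineq3[of "of_real q * poincare k z z" 1] by simp
    also have "\<dots> \<le> \<epsilon> k" using diag[OF k z] by (simp add: q_def \<epsilon>_def)
    finally have x: "\<bar>x - 1\<bar> \<le> \<epsilon> k" .
    have "\<bar>a k * x - L\<bar> = \<bar>a k * (x - 1) + (a k - L)\<bar>" by (simp add: algebra_simps)
    also have "\<dots> \<le> a k * \<bar>x - 1\<bar> + \<bar>a k - L\<bar>" using a0[of k] abs_triangle_ineq[of "a k * (x - 1)" "a k - L"] by (simp add: abs_mult)
    also have "\<dots> \<le> a k * \<epsilon> k + \<bar>a k - L\<bar>" using x a0[of k] by (intro add_right_mono mult_left_mono) auto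
    finally show ?thesis unfolding bp .
  qed
  show ?thesis
    unfolding L_def[symmetric]
  proof (rule uniform_limitI)
    fix d :: real assume d: "d > 0"
    have "eventually (\<lambda>k. a k * \<epsilon> k + \<bar>a k - L\<bar> < d) sequentially" using order_tendstoD(2)[OF b0, of d] d by simp
    then show "\<forall>\<^sub>F k in sequentially. \<forall>z\<in>unit_ball. dist (1 / real k ^ CARD('a) * bergman_pet \<Gamma> F k z) L < d"
      using eventually_ge_at_top[of "2 * CARD('a) + 2"]
    proof eventually_elim
      case (elim k)
      show ?case
      proof
        fix z :: "complex ^ 'a" assume "z \<in> unit_ball"
        then have "norm z < 1" by simp
        then show "dist (1 / real k ^ CARD('a) * bergman_pet \<Gamma> F k z) L < d"
          unfolding dist_real_def by (rule order_le_less_trans[OF est[OF elim(2)] elim(1)])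
      qed
    qed
  qed
qed

end

theorem theorem3p1:
  fixes \<Gamma> :: "'n::finite mat1 set" and F :: "(complex ^ 'n) set"
  assumes "CARD('n) \<ge> 2"
    and "subgroup \<Gamma> SU_n1"
    and "discrete \<Gamma>"
    and "torsion_free \<Gamma>"
    and "compact_space (ball_quotient \<Gamma>)"
    and "fundamental_domain \<Gamma> F"
  shows "(\<forall>z\<in>unit_ball.
            (\<lambda>k. 1 / real k ^ CARD('n) * bergman_pet \<Gamma> F k z)
              \<longlonglongrightarrow> 1 / (4 * pi) ^ CARD('n)) \<and>
         uniform_limit unit_ball
            (\<lambda>k z. 1 / real k ^ CARD('n) * bergman_pet \<Gamma> F k z)
            (\<lambda>z. 1 / (4 * pi) ^ CARD('n)) sequentially"
proof -
  interpret picard_domain \<Gamma> F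
    by (intro picard_domain.intro cocompact_lattice.intro picard_domain_axioms.intro assms)
  show ?thesis using bergman_pet_uniform by (auto intro: tendsto_uniform_limitI)
qed

end
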